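(* Let $\mathcal H=(\mathcal H_L,\mathcal H_R,S)$ be a Hopf algebroid and $B\subseteq A$ a right $\mathcal H$-extension. Then the following statements are equivalent: (1) $B\subseteq A$ is an $\mathcal H$-cleft extension. (2) (a) The extension $B\subseteq A$ is $\mathcal H_R$-Galois, i.e. the canonical map $\mathrm{can}_R: A\otimes_B A\to A\otimes_R H$, $a\otimes_B a'\mapsto a a'^{[0]}\otimes_R a'^{[1]}$, is bijective; and (b) $B$ is an $L$-ring and $A\simeq B\otimes_L H$ as left $B$-modules and right $\mathcal H$-comodules.
   Context: $k$ is a commutative unital ring; algebras are associative unital $k$-algebras; for an algebra $R$, an $R$-ring is an algebra $A$ with an algebra map $R\to A$ (the unit map). Summation symbols are suppressed in Sweedler notation. Left bialgebroid $\mathcal H_L=(H,L,s_L,t_L,\gamma_L,\pi_L)$: algebras $H,L$; algebra maps $s_L:L\to H$, $t_L:L^{op}\to H$ with commuting images; $H$ is an $L$-bimodule via $l h l'=s_L(l)t_L(l')h$; $L$-bimodule maps $\gamma_L:H\to H\otimes_L H$, $h\mapsto h_{(1)}\otimes_L h_{(2)}$, and $\pi_L:H\to L$ form a coassociative counital $L$-coring; $h_{(1)}t_L(l)\otimes_L h_{(2)}=h_{(1)}\otimes_L h_{(2)}s_L(l)$; $\gamma_L(1)=1\otimes_L 1$; $\gamma_L(hh')=\gamma_L(h)\gamma_L(h')$; $\pi_L(1)=1$; $\pi_L(hs_L(\pi_L(h')))=\pi_L(hh')=\pi_L(ht_L(\pi_L(h')))$. Right bialgebroid $\mathcal H_R=(H,R,s_R,t_R,\gamma_R,\pi_R)$: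 algebra maps $s_R:R\to H$, $t_R:R^{op}\to H$ with commuting images; $R$-bimodule $rhr'=h s_R(r')t_R(r)$; $R$-coring $\gamma_R:H\to H\otimes_RH$, $h\mapsto h^{(1)}\otimes_R h^{(2)}$, $\pi_R:H\to R$; $s_R(r)h^{(1)}\otimes_R h^{(2)}=h^{(1)}\otimes_R t_R(r)h^{(2)}$; $\gamma_R$ unital and multiplicative; $\pi_R(1)=1$; $\pi_R(s_R(\pi_R(h))h')=\pi_R(hh')=\pi_R(t_R(\pi_R(h))h')$. Hopf algebroid $\mathcal H=(\mathcal H_L,\mathcal H_R,S)$: a left bialgebroid $\mathcal H_L=(H,L,s_L,t_L,\gamma_L,\pi_L)$ and a right bialgebroid $\mathcal H_R=(H,R,s_R,t_R,\gamma_R,\pi_R)$ on the same algebra $H$ with $s_L\pi_Lt_R=t_R$, $t_L\pi_Ls_R=s_R$, $s_R\pi_Rt_L=t_L$, $t_R\pi_Rs_L=s_L$; $(\gamma_L\otimes_R H)\gamma_R=(H\otimes_L\gamma_R)\gamma_L$, $(\gamma_R\otimes_L H)\gamma_L=(H\otimes_R\gamma_L)\gamma_R$; and a $k$-linear antipode $S:H\to H$ with $S(t_L(l)ht_R(r))=s_R(r)S(h)s_L(l)$, $S(t_R(r)ht_L(l))=s_L(l)S(h)s_R(r)$, $S(h_{(1)})h_{(2)}=s_R(\pi_R(h))$, $h^{(1)}S(h^{(2)})=s_L(\pi_L(h))$. A right $\mathcal H_R$-comodule is a right comodule $m\mapsto m^{[0]}\otimes_R m^{[1]}$ of the $R$-coring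 $H$; it is an $R$-bimodule with left action $rm=m^{[0]}\pi_R(s_R(r)m^{[1]})$. A right $\mathcal H_L$-comodule is a right comodule $m\mapsto m_{[0]}\otimes_Lm_{[1]}$ of the $L$-coring $H$. A right $\mathcal H$-comodule is a right $R$- and right $L$-module $M$ with an $\mathcal H_R$-coaction $\varrho_R$ and an $\mathcal H_L$-coaction $\varrho_L$ such that $\varrho_R$ is right $L$-linear, $\varrho_L$ is right $R$-linear, $(M\otimes_R\gamma_L)\varrho_R=(\varrho_R\otimes_LH)\varrho_L$ and $(M\otimes_L\gamma_R)\varrho_L=(\varrho_L\otimes_RH)\varrho_R$ (here $(m\otimes_R h)l=m\otimes_R t_L(l)h$, $(m\otimes_L h)r=m\otimes_L hs_R(r)$). Morphisms are maps colinear for both coactions. $H$ itself is a right $\mathcal H$-comodule via $\gamma_R,\gamma_L$. A right $\mathcal H$-comodule algebra is an $R$-ring $A$ with unit map $\eta_R:R\to A$ that is a right $\mathcal H$-comodule, the $R$-bimodule structure being given by multiplication with $\eta_R$ (and the right $L$-action then being $al=\eta_R(\pi_R(t_L(l)))a$), such that both coactions are unital and multiplicative: $1^{[0]}\otimes_R1^{[1]}=1\otimes_R1$, $(aa')^{[0]}\otimes_R(aa')^{[1]}=a^{[0]}a'^{[0]}\otimes_Ra^{[1]}a'^{[1]}$, and likewise for $a_{[0]}\otimes_La_{[1]}$. A right $\mathcal H$-extension $B\subseteq A$ is a right $\mathcal H$-comodule algebra $A$ with $B=\{b\in A: b^{[0]}\otimes_R b^{[1]}=b\otimes_R 1_H\}$.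 The extension is $\mathcal H$-cleft if (a) $A$ is an $L$-ring with unit map $\eta_L:L\to A$, and $B$ is an $L$-subring (so $\eta_L(L)\subseteq B$); and (b) there is a left $L$-linear ($j(s_L(l)h)=\eta_L(l)j(h)$) right $\mathcal H$-comodule map $j:H\to A$ (a cleaving map) that is convolution invertible: there is a $k$-linear $j^{c}:H\to A$ (the convolution inverse) with $j^{c}(t_L(l)ht_R(r))=\eta_R(r)j^{c}(h)\eta_L(l)$, $j(h^{(1)})j^{c}(h^{(2)})=\eta_L(\pi_L(h))$, $j^{c}(h_{(1)})j(h_{(2)})=\eta_R(\pi_R(h))$. In $B\otimes_LH$ the left $L$-action on $H$ is left multiplication by $s_L(l)$; $B\otimes_LH$ is a left $B$-module via $B$ and a right $\mathcal H$-comodule via $H$ (coactions $B\otimes_L\gamma_R$, $B\otimes_L\gamma_L$). *)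

theory Defs
  imports Main "HOL-Library.Poly_Mapping" "HOL-Library.Set_Algebras"
begin

text \<open>
  Rings are types of sort \<open>{ring, monoid_mult}\<close>: associative with unit, the zero ring being allowed
  (\<open>ring_1\<close> would exclude it).  Only the coinvariant subalgebra \<open>B\<close> and tensor products
  are given by carrier sets.
\<close>

section \<open>Algebras over a commutative ring\<close>

locale k_algebra =
  fixes scale :: "'k::{comm_ring,comm_monoid_mult} \<Rightarrow> 'a::{ring,monoid_mult} \<Rightarrow> 'a"
  assumes scale_add_right: "scale c (x + y) = scale c x + scale c y"
    and scale_add_left: "scale (c + d) x = scale c x + scale d x"
    and scale_scale: "scale c (scale d x) = scale (c * d) x"
    and scale_one: "scale 1 x = x"
    and scale_mult_left: "scale c (x * y) = scale c x * y"
    and scale_mult_right: "scale c (x * y) = x * scale c y"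

definition k_linear ::
  "('k \<Rightarrow> 'a::plus \<Rightarrow> 'a) \<Rightarrow> ('k \<Rightarrow> 'b::plus \<Rightarrow> 'b) \<Rightarrow> ('a \<Rightarrow> 'b) \<Rightarrow> bool" where
  "k_linear sc sc' f \<longleftrightarrow> (\<forall>x y. f (x + y) = f x + f y) \<and> (\<forall>c x. f (sc c x) = sc' c (f x))"

definition algebra_map ::
  "('k \<Rightarrow> 'a::{ring,monoid_mult} \<Rightarrow> 'a) \<Rightarrow> ('k \<Rightarrow> 'b::{ring,monoid_mult} \<Rightarrow> 'b) \<Rightarrow> ('a \<Rightarrow> 'b) \<Rightarrow> bool" where
  "algebra_map sc sc' f \<longleftrightarrow> k_linear sc sc' f \<and> f 1 = 1 \<and> (\<forall>x y. f (x * y) = f x * f y)"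

definition algebra_antimap ::
  "('k \<Rightarrow> 'a::{ring,monoid_mult} \<Rightarrow> 'a) \<Rightarrow> ('k \<Rightarrow> 'b::{ring,monoid_mult} \<Rightarrow> 'b) \<Rightarrow> ('a \<Rightarrow> 'b) \<Rightarrow> bool" where
  "algebra_antimap sc sc' f \<longleftrightarrow> k_linear sc sc' f \<and> f 1 = 1 \<and> (\<forall>x y. f (x * y) = f y * f x)"

section \<open>Tensor products over noncommutative rings\<close>

text \<open>
  \<open>M \<otimes>\<^sub>Q N\<close>, for a right \<open>Q\<close>-module \<open>M\<close> with action \<open>ra\<close> and a left \<open>Q\<close>-module \<open>N\<close> with action
  \<open>la\<close>, is the quotient of the free abelian group on \<open>M \<times> N\<close> by the subgroup
  \<open>tensor_null M Q ra la\<close>; its elements are cosets.  The carriers of \<open>M\<close> and \<open>Q\<close> are sets; \<open>N\<close> is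
  always a full type.
\<close>

type_synonym ('m, 'n) tensor = "('m \<times> 'n \<Rightarrow>\<^sub>0 int) set"
type_synonym ('m, 'n, 'p) tensor3 = "('m \<times> 'n \<times> 'p \<Rightarrow>\<^sub>0 int) set"

inductive_set tensor_null ::
  "'m::plus set \<Rightarrow> 'q set \<Rightarrow> ('m \<Rightarrow> 'q \<Rightarrow> 'm) \<Rightarrow> ('q \<Rightarrow> 'n::plus \<Rightarrow> 'n) \<Rightarrow> ('m \<times> 'n \<Rightarrow>\<^sub>0 int) set"
  for M Q ra la where
  zero: "0 \<in> tensor_null M Q ra la"
| diff: "\<lbrakk>x \<in> tensor_null M Q ra la; y \<in> tensor_null M Q ra la\<rbrakk> \<Longrightarrow> x - y \<in> tensor_null M Q ra la"
| add1: "\<lbrakk>m \<in> M; m' \<in> M\<rbrakk> \<Longrightarrow>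
    frag_of (m + m', n) - frag_of (m, n) - frag_of (m', n) \<in> tensor_null M Q ra la"
| add2: "m \<in> M \<Longrightarrow>
    frag_of (m, n + n') - frag_of (m, n) - frag_of (m, n') \<in> tensor_null M Q ra la"
| balanced: "\<lbrakk>m \<in> M; q \<in> Q\<rbrakk> \<Longrightarrow>
    frag_of (ra m q, n) - frag_of (m, la q n) \<in> tensor_null M Q ra la"

definition tensor_carrier ::
  "'m::plus set \<Rightarrow> 'q set \<Rightarrow> ('m \<Rightarrow> 'q \<Rightarrow> 'm) \<Rightarrow> ('q \<Rightarrow> 'n::plus \<Rightarrow> 'n) \<Rightarrow> ('m, 'n) tensor set" where
  "tensor_carrier M Q ra la =
     {x +o tensor_null M Q ra la | x. Poly_Mapping.keys x \<subseteq> M \<times> UNIV}"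

text \<open>
  \<open>M \<otimes>\<^sub>P N \<otimes>\<^sub>Q K\<close>, where \<open>N\<close> has left \<open>P\<close>-action \<open>la\<close> and right \<open>Q\<close>-action \<open>ra'\<close>, is the quotient
  of the free abelian group on \<open>M \<times> N \<times> K\<close> by the following subgroup.
\<close>

inductive_set tensor3_null ::
  "'m::plus set \<Rightarrow> ('m \<Rightarrow> 'p \<Rightarrow> 'm) \<Rightarrow> ('p \<Rightarrow> 'n::plus \<Rightarrow> 'n) \<Rightarrow> ('n \<Rightarrow> 'q \<Rightarrow> 'n) \<Rightarrow> ('q \<Rightarrow> 'c::plus \<Rightarrow> 'c)
    \<Rightarrow> ('m \<times> 'n \<times> 'c \<Rightarrow>\<^sub>0 int) set"
  for M ra la ra' la' where
  zero: "0 \<in> tensor3_null M ra la ra' la'"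
| diff: "\<lbrakk>x \<in> tensor3_null M ra la ra' la'; y \<in> tensor3_null M ra la ra' la'\<rbrakk> \<Longrightarrow>
    x - y \<in> tensor3_null M ra la ra' la'"
| add1: "\<lbrakk>m \<in> M; m' \<in> M\<rbrakk> \<Longrightarrow>
    frag_of (m + m', n, c) - frag_of (m, n, c) - frag_of (m', n, c) \<in> tensor3_null M ra la ra' la'"
| add2: "m \<in> M \<Longrightarrow>
    frag_of (m, n + n', c) - frag_of (m, n, c) - frag_of (m, n', c) \<in> tensor3_null M ra la ra' la'"
| add3: "m \<in> M \<Longrightarrow>
    frag_of (m, n, c + c') - frag_of (m, n, c) - frag_of (m, n, c') \<in> tensor3_null M ra la ra' la'"
| balanced1: "m \<in> M \<Longrightarrow>
    frag_of (ra m p, n, c) - frag_of (m, la p n, c) \<in> tensor3_null M ra la ra' la'"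
| balanced2: "m \<in> M \<Longrightarrow>
    frag_of (m, ra' n q, c) - frag_of (m, n, la' q c) \<in> tensor3_null M ra la ra' la'"

text \<open>
  Maps out of a tensor product are written on a chosen representative \<open>rep t = \<Sum>\<^sub>i n\<^sub>i (m\<^sub>i, h\<^sub>i)\<close>
  (a choice of Sweedler components).  In every use below the map respects the null subgroup of the
  source, so the choice is immaterial.  In \<open>induced N\<close>, \<open>tens_map N\<close>, ..., the argument \<open>N\<close> is the
  null subgroup of the target.
\<close>

definition rep :: "'x set \<Rightarrow> 'x" where
  "rep t = (SOME x. x \<in> t)"

definition frag_map :: "('x \<Rightarrow> 'y) \<Rightarrow> ('x \<Rightarrow>\<^sub>0 int) \<Rightarrow> ('y \<Rightarrow>\<^sub>0 int)" where
  "frag_map g = frag_extend (\<lambda>x. frag_of (g x))"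

definition induced ::
  "('y \<Rightarrow>\<^sub>0 int) set \<Rightarrow> ('x \<Rightarrow> ('y \<Rightarrow>\<^sub>0 int)) \<Rightarrow> ('x \<Rightarrow>\<^sub>0 int) set \<Rightarrow> ('y \<Rightarrow>\<^sub>0 int) set" where
  "induced N f t = frag_extend f (rep t) +o N"

definition tens_map ::
  "('y \<Rightarrow>\<^sub>0 int) set \<Rightarrow> ('x \<Rightarrow> 'y) \<Rightarrow> ('x \<Rightarrow>\<^sub>0 int) set \<Rightarrow> ('y \<Rightarrow>\<^sub>0 int) set" where
  "tens_map N g t = frag_map g (rep t) +o N"

text \<open>\<open>f \<otimes> id\<close> and \<open>id \<otimes> f\<close> for a tensor-valued \<open>f\<close>\<close>

definition tens_fst ::
  "('a \<times> 'b \<times> 'n \<Rightarrow>\<^sub>0 int) set \<Rightarrow> ('m \<Rightarrow> ('a, 'b) tensor) \<Rightarrow> ('m, 'n) tensor \<Rightarrow> ('a, 'b, 'n) tensor3" where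
  "tens_fst N f = induced N (\<lambda>(m, n). frag_map (\<lambda>(a, b). (a, b, n)) (rep (f m)))"

definition tens_snd ::
  "('m \<times> 'a \<times> 'b \<Rightarrow>\<^sub>0 int) set \<Rightarrow> ('n \<Rightarrow> ('a, 'b) tensor) \<Rightarrow> ('m, 'n) tensor \<Rightarrow> ('m, 'a, 'b) tensor3" where
  "tens_snd N f = induced N (\<lambda>(m, n). frag_map (\<lambda>(a, b). (m, a, b)) (rep (f n)))"

text \<open>\<open>(\<Sum> a \<otimes> b) (\<Sum> c \<otimes> d) = \<Sum> a c \<otimes> b d\<close>\<close>

definition tens_mult ::
  "('a::times \<times> 'b::times \<Rightarrow>\<^sub>0 int) set \<Rightarrow> ('a, 'b) tensor \<Rightarrow> ('a, 'b) tensor \<Rightarrow> ('a, 'b) tensor" where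
  "tens_mult N t = induced N (\<lambda>(c, d). frag_map (\<lambda>(a, b). (a * c, b * d)) (rep t))"

definition int_mult :: "int \<Rightarrow> 'a::ab_group_add \<Rightarrow> 'a" where
  "int_mult n x = (((+) x) ^^ nat n) 0 - (((+) x) ^^ nat (- n)) 0"

text \<open>\<open>\<Sum>\<^sub>i n\<^sub>i f (m\<^sub>i, h\<^sub>i)\<close>: evaluation of Sweedler expressions with values in an abelian group\<close>

definition sweedler :: "('x \<Rightarrow> 'a::ab_group_add) \<Rightarrow> ('x \<Rightarrow>\<^sub>0 int) set \<Rightarrow> 'a" where
  "sweedler f t = (\<Sum>p \<in> Poly_Mapping.keys (rep t). int_mult (Poly_Mapping.lookup (rep t) p) (f p))"

section \<open>Bialgebroids\<close>

text \<open>
  Left bialgebroid: the \<open>L\<close>-bimodule structure of \<open>H\<close> is \<open>l h l' = s l * t l' * h\<close>, so the balancing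
  of \<open>H \<otimes>\<^sub>L H\<close> is \<open>t l * h \<otimes> h' = h \<otimes> s l * h'\<close>.
\<close>

definition HH_L_null :: "('l \<Rightarrow> 'h::{ring,monoid_mult}) \<Rightarrow> ('l \<Rightarrow> 'h) \<Rightarrow> ('h \<times> 'h \<Rightarrow>\<^sub>0 int) set" where
  "HH_L_null s t = tensor_null UNIV UNIV (\<lambda>h l. t l * h) (\<lambda>l h. s l * h)"

definition HHH_LL_null :: "('l \<Rightarrow> 'h::{ring,monoid_mult}) \<Rightarrow> ('l \<Rightarrow> 'h) \<Rightarrow> ('h \<times> 'h \<times> 'h \<Rightarrow>\<^sub>0 int) set" where
  "HHH_LL_null s t =
     tensor3_null UNIV (\<lambda>h l. t l * h) (\<lambda>l h. s l * h) (\<lambda>h l. t l * h) (\<lambda>l h. s l * h)"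

locale left_bialgebroid = H: k_algebra scH + L: k_algebra scL
  for scH :: "'k::{comm_ring,comm_monoid_mult} \<Rightarrow> 'h::{ring,monoid_mult} \<Rightarrow> 'h"
    and scL :: "'k \<Rightarrow> 'l::{ring,monoid_mult} \<Rightarrow> 'l" +
  fixes s t :: "'l \<Rightarrow> 'h" and \<gamma> :: "'h \<Rightarrow> ('h, 'h) tensor" and \<pi> :: "'h \<Rightarrow> 'l"
  assumes source: "algebra_map scL scH s"
    and target: "algebra_antimap scL scH t"
    and commute: "s l * t l' = t l' * s l"
    and comult_closed: "\<gamma> h \<in> tensor_carrier UNIV UNIV (\<lambda>h l. t l * h) (\<lambda>l h. s l * h)"
    and comult_add: "\<gamma> (h + h') = \<gamma> h + \<gamma> h'"
    and comult_bimodule: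
      "\<gamma> (s l * t l' * h) = tens_map (HH_L_null s t) (\<lambda>(a, b). (s l * a, t l' * b)) (\<gamma> h)"
    and counit_add: "\<pi> (h + h') = \<pi> h + \<pi> h'"
    and counit_bimodule: "\<pi> (s l * t l' * h) = l * \<pi> h * l'"
    and coassoc: "tens_fst (HHH_LL_null s t) \<gamma> (\<gamma> h) = tens_snd (HHH_LL_null s t) \<gamma> (\<gamma> h)"
    and counit_left: "sweedler (\<lambda>(a, b). s (\<pi> a) * b) (\<gamma> h) = h"
    and counit_right: "sweedler (\<lambda>(a, b). t (\<pi> b) * a) (\<gamma> h) = h"
    and takeuchi:
      "tens_map (HH_L_null s t) (\<lambda>(a, b). (a * t l, b)) (\<gamma> h) =
       tens_map (HH_L_null s t) (\<lambda>(a, b). (a, b * s l)) (\<gamma> h)"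
    and comult_one: "\<gamma> 1 = frag_of (1, 1) +o HH_L_null s t"
    and comult_mult: "\<gamma> (h * h') = tens_mult (HH_L_null s t) (\<gamma> h) (\<gamma> h')"
    and counit_one: "\<pi> 1 = 1"
    and counit_mult_s: "\<pi> (h * s (\<pi> h')) = \<pi> (h * h')"
    and counit_mult_t: "\<pi> (h * t (\<pi> h')) = \<pi> (h * h')"

text \<open>
  Right bialgebroid: \<open>r h r' = h * s r' * t r\<close>, so the balancing of \<open>H \<otimes>\<^sub>R H\<close> is
  \<open>h * s r \<otimes> h' = h \<otimes> h' * t r\<close>.
\<close>

definition HH_R_null :: "('r \<Rightarrow> 'h::{ring,monoid_mult}) \<Rightarrow> ('r \<Rightarrow> 'h) \<Rightarrow> ('h \<times> 'h \<Rightarrow>\<^sub>0 int) set" where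
  "HH_R_null s t = tensor_null UNIV UNIV (\<lambda>h r. h * s r) (\<lambda>r h. h * t r)"

definition HHH_RR_null :: "('r \<Rightarrow> 'h::{ring,monoid_mult}) \<Rightarrow> ('r \<Rightarrow> 'h) \<Rightarrow> ('h \<times> 'h \<times> 'h \<Rightarrow>\<^sub>0 int) set" where
  "HHH_RR_null s t =
     tensor3_null UNIV (\<lambda>h r. h * s r) (\<lambda>r h. h * t r) (\<lambda>h r. h * s r) (\<lambda>r h. h * t r)"

locale right_bialgebroid = H: k_algebra scH + R: k_algebra scR
  for scH :: "'k::{comm_ring,comm_monoid_mult} \<Rightarrow> 'h::{ring,monoid_mult} \<Rightarrow> 'h"
    and scR :: "'k \<Rightarrow> 'r::{ring,monoid_mult} \<Rightarrow> 'r" +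
  fixes s t :: "'r \<Rightarrow> 'h" and \<gamma> :: "'h \<Rightarrow> ('h, 'h) tensor" and \<pi> :: "'h \<Rightarrow> 'r"
  assumes source: "algebra_map scR scH s"
    and target: "algebra_antimap scR scH t"
    and commute: "s r * t r' = t r' * s r"
    and comult_closed: "\<gamma> h \<in> tensor_carrier UNIV UNIV (\<lambda>h r. h * s r) (\<lambda>r h. h * t r)"
    and comult_add: "\<gamma> (h + h') = \<gamma> h + \<gamma> h'"
    and comult_bimodule:
      "\<gamma> (h * s r' * t r) = tens_map (HH_R_null s t) (\<lambda>(a, b). (a * t r, b * s r')) (\<gamma> h)"
    and counit_add: "\<pi> (h + h') = \<pi> h + \<pi> h'"
    and counit_bimodule: "\<pi> (h * s r' * t r) = r * \<pi> h * r'"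
    and coassoc: "tens_fst (HHH_RR_null s t) \<gamma> (\<gamma> h) = tens_snd (HHH_RR_null s t) \<gamma> (\<gamma> h)"
    and counit_left: "sweedler (\<lambda>(a, b). b * t (\<pi> a)) (\<gamma> h) = h"
    and counit_right: "sweedler (\<lambda>(a, b). a * s (\<pi> b)) (\<gamma> h) = h"
    and takeuchi:
      "tens_map (HH_R_null s t) (\<lambda>(a, b). (s r * a, b)) (\<gamma> h) =
       tens_map (HH_R_null s t) (\<lambda>(a, b). (a, t r * b)) (\<gamma> h)"
    and comult_one: "\<gamma> 1 = frag_of (1, 1) +o HH_R_null s t"
    and comult_mult: "\<gamma> (h * h') = tens_mult (HH_R_null s t) (\<gamma> h) (\<gamma> h')"
    and counit_one: "\<pi> 1 = 1"
    and counit_mult_s: "\<pi> (s (\<pi> h) * h') = \<pi> (h * h')"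
    and counit_mult_t: "\<pi> (t (\<pi> h) * h') = \<pi> (h * h')"

section \<open>Hopf algebroids\<close>

record ('k, 'h, 'l, 'r) hopf_algebroid_data =
  scale\<^sub>H :: "'k \<Rightarrow> 'h \<Rightarrow> 'h"
  scale\<^sub>L :: "'k \<Rightarrow> 'l \<Rightarrow> 'l"
  scale\<^sub>R :: "'k \<Rightarrow> 'r \<Rightarrow> 'r"
  s\<^sub>L :: "'l \<Rightarrow> 'h"
  t\<^sub>L :: "'l \<Rightarrow> 'h"
  \<gamma>\<^sub>L :: "'h \<Rightarrow> ('h, 'h) tensor"
  \<pi>\<^sub>L :: "'h \<Rightarrow> 'l"
  s\<^sub>R :: "'r \<Rightarrow> 'h"
  t\<^sub>R :: "'r \<Rightarrow> 'h"
  \<gamma>\<^sub>R :: "'h \<Rightarrow> ('h, 'h) tensor"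
  \<pi>\<^sub>R :: "'h \<Rightarrow> 'r"
  antipode :: "'h \<Rightarrow> 'h"

definition HHH_LR_null ::
  "('k, 'h::{ring,monoid_mult}, 'l, 'r) hopf_algebroid_data \<Rightarrow> ('h \<times> 'h \<times> 'h \<Rightarrow>\<^sub>0 int) set" where
  "HHH_LR_null \<H> = tensor3_null UNIV
     (\<lambda>h l. t\<^sub>L \<H> l * h) (\<lambda>l h. s\<^sub>L \<H> l * h) (\<lambda>h r. h * s\<^sub>R \<H> r) (\<lambda>r h. h * t\<^sub>R \<H> r)"

definition HHH_RL_null ::
  "('k, 'h::{ring,monoid_mult}, 'l, 'r) hopf_algebroid_data \<Rightarrow> ('h \<times> 'h \<times> 'h \<Rightarrow>\<^sub>0 int) set" where
  "HHH_RL_null \<H> = tensor3_null UNIV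
     (\<lambda>h r. h * s\<^sub>R \<H> r) (\<lambda>r h. h * t\<^sub>R \<H> r) (\<lambda>h l. t\<^sub>L \<H> l * h) (\<lambda>l h. s\<^sub>L \<H> l * h)"

locale hopf_algebroid =
  fixes \<H> :: "('k::{comm_ring,comm_monoid_mult}, 'h::{ring,monoid_mult}, 'l::{ring,monoid_mult},
    'r::{ring,monoid_mult}) hopf_algebroid_data"
  assumes left: "left_bialgebroid (scale\<^sub>H \<H>) (scale\<^sub>L \<H>) (s\<^sub>L \<H>) (t\<^sub>L \<H>) (\<gamma>\<^sub>L \<H>) (\<pi>\<^sub>L \<H>)"
    and right: "right_bialgebroid (scale\<^sub>H \<H>) (scale\<^sub>R \<H>) (s\<^sub>R \<H>) (t\<^sub>R \<H>) (\<gamma>\<^sub>R \<H>) (\<pi>\<^sub>R \<H>)"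
    and sL_piL_tR: "s\<^sub>L \<H> (\<pi>\<^sub>L \<H> (t\<^sub>R \<H> r)) = t\<^sub>R \<H> r"
    and tL_piL_sR: "t\<^sub>L \<H> (\<pi>\<^sub>L \<H> (s\<^sub>R \<H> r)) = s\<^sub>R \<H> r"
    and sR_piR_tL: "s\<^sub>R \<H> (\<pi>\<^sub>R \<H> (t\<^sub>L \<H> l)) = t\<^sub>L \<H> l"
    and tR_piR_sL: "t\<^sub>R \<H> (\<pi>\<^sub>R \<H> (s\<^sub>L \<H> l)) = s\<^sub>L \<H> l"
    and mixed_coassoc_LR:
      "tens_fst (HHH_LR_null \<H>) (\<gamma>\<^sub>L \<H>) (\<gamma>\<^sub>R \<H> h) = tens_snd (HHH_LR_null \<H>) (\<gamma>\<^sub>R \<H>) (\<gamma>\<^sub>L \<H> h)"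
    and mixed_coassoc_RL:
      "tens_fst (HHH_RL_null \<H>) (\<gamma>\<^sub>R \<H>) (\<gamma>\<^sub>L \<H> h) = tens_snd (HHH_RL_null \<H>) (\<gamma>\<^sub>L \<H>) (\<gamma>\<^sub>R \<H> h)"
    and antipode_linear: "k_linear (scale\<^sub>H \<H>) (scale\<^sub>H \<H>) (antipode \<H>)"
    and antipode_twist1:
      "antipode \<H> (t\<^sub>L \<H> l * h * t\<^sub>R \<H> r) = s\<^sub>R \<H> r * antipode \<H> h * s\<^sub>L \<H> l"
    and antipode_twist2:
      "antipode \<H> (t\<^sub>R \<H> r * h * t\<^sub>L \<H> l) = s\<^sub>L \<H> l * antipode \<H> h * s\<^sub>R \<H> r"
    and antipode_left: "sweedler (\<lambda>(a, b). antipode \<H> a * b) (\<gamma>\<^sub>L \<H> h) = s\<^sub>R \<H> (\<pi>\<^sub>R \<H> h)"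
    and antipode_right: "sweedler (\<lambda>(a, b). a * antipode \<H> b) (\<gamma>\<^sub>R \<H> h) = s\<^sub>L \<H> (\<pi>\<^sub>L \<H> h)"

section \<open>Comodules of a Hopf algebroid\<close>

text \<open>\<open>actR\<close> and \<open>actL\<close> are the \<^emph>\<open>right\<close> actions of \<open>R\<close> and of \<open>L\<close>, respectively.\<close>

record ('m, 'h, 'l, 'r) comodule_data =
  carrier :: "'m set"
  actR :: "'m \<Rightarrow> 'r \<Rightarrow> 'm"
  actL :: "'m \<Rightarrow> 'l \<Rightarrow> 'm"
  \<rho>\<^sub>R :: "'m \<Rightarrow> ('m, 'h) tensor"
  \<rho>\<^sub>L :: "'m \<Rightarrow> ('m, 'h) tensor"

definition right_module_on ::
  "'m::ab_group_add set \<Rightarrow> ('m \<Rightarrow> 'q::{ring,monoid_mult} \<Rightarrow> 'm) \<Rightarrow> bool" where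
  "right_module_on M act \<longleftrightarrow>
     0 \<in> M \<and> (\<forall>m\<in>M. \<forall>m'\<in>M. m - m' \<in> M) \<and> (\<forall>m\<in>M. \<forall>q. act m q \<in> M) \<and>
     (\<forall>m\<in>M. \<forall>m'\<in>M. \<forall>q. act (m + m') q = act m q + act m' q) \<and>
     (\<forall>m\<in>M. \<forall>q q'. act m (q + q') = act m q + act m q') \<and>
     (\<forall>m\<in>M. \<forall>q q'. act m (q * q') = act (act m q) q') \<and>
     (\<forall>m\<in>M. act m 1 = m)"

definition MH_R_null ::
  "('k, 'h::{ring,monoid_mult}, 'l, 'r) hopf_algebroid_data \<Rightarrow> ('m::plus, 'h, 'l, 'r) comodule_data
    \<Rightarrow> ('m \<times> 'h \<Rightarrow>\<^sub>0 int) set" where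
  "MH_R_null \<H> \<M> = tensor_null (carrier \<M>) UNIV (actR \<M>) (\<lambda>r h. h * t\<^sub>R \<H> r)"

definition MH_R_tensor ::
  "('k, 'h::{ring,monoid_mult}, 'l, 'r) hopf_algebroid_data \<Rightarrow> ('m::plus, 'h, 'l, 'r) comodule_data
    \<Rightarrow> ('m, 'h) tensor set" where
  "MH_R_tensor \<H> \<M> = tensor_carrier (carrier \<M>) UNIV (actR \<M>) (\<lambda>r h. h * t\<^sub>R \<H> r)"

definition MH_L_null ::
  "('k, 'h::{ring,monoid_mult}, 'l, 'r) hopf_algebroid_data \<Rightarrow> ('m::plus, 'h, 'l, 'r) comodule_data
    \<Rightarrow> ('m \<times> 'h \<Rightarrow>\<^sub>0 int) set" where
  "MH_L_null \<H> \<M> = tensor_null (carrier \<M>) UNIV (actL \<M>) (\<lambda>l h. s\<^sub>L \<H> l * h)"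

definition MH_L_tensor ::
  "('k, 'h::{ring,monoid_mult}, 'l, 'r) hopf_algebroid_data \<Rightarrow> ('m::plus, 'h, 'l, 'r) comodule_data
    \<Rightarrow> ('m, 'h) tensor set" where
  "MH_L_tensor \<H> \<M> = tensor_carrier (carrier \<M>) UNIV (actL \<M>) (\<lambda>l h. s\<^sub>L \<H> l * h)"

definition MHH_RR_null ::
  "('k, 'h::{ring,monoid_mult}, 'l, 'r) hopf_algebroid_data \<Rightarrow> ('m::plus, 'h, 'l, 'r) comodule_data
    \<Rightarrow> ('m \<times> 'h \<times> 'h \<Rightarrow>\<^sub>0 int) set" where
  "MHH_RR_null \<H> \<M> = tensor3_null (carrier \<M>) (actR \<M>) (\<lambda>r h. h * t\<^sub>R \<H> r)
     (\<lambda>h r. h * s\<^sub>R \<H> r) (\<lambda>r h. h * t\<^sub>R \<H> r)"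

definition MHH_LL_null ::
  "('k, 'h::{ring,monoid_mult}, 'l, 'r) hopf_algebroid_data \<Rightarrow> ('m::plus, 'h, 'l, 'r) comodule_data
    \<Rightarrow> ('m \<times> 'h \<times> 'h \<Rightarrow>\<^sub>0 int) set" where
  "MHH_LL_null \<H> \<M> = tensor3_null (carrier \<M>) (actL \<M>) (\<lambda>l h. s\<^sub>L \<H> l * h)
     (\<lambda>h l. t\<^sub>L \<H> l * h) (\<lambda>l h. s\<^sub>L \<H> l * h)"

definition MHH_RL_null ::
  "('k, 'h::{ring,monoid_mult}, 'l, 'r) hopf_algebroid_data \<Rightarrow> ('m::plus, 'h, 'l, 'r) comodule_data
    \<Rightarrow> ('m \<times> 'h \<times> 'h \<Rightarrow>\<^sub>0 int) set" where
  "MHH_RL_null \<H> \<M> = tensor3_null (carrier \<M>) (actR \<M>) (\<lambda>r h. h * t\<^sub>R \<H> r)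
     (\<lambda>h l. t\<^sub>L \<H> l * h) (\<lambda>l h. s\<^sub>L \<H> l * h)"

definition MHH_LR_null ::
  "('k, 'h::{ring,monoid_mult}, 'l, 'r) hopf_algebroid_data \<Rightarrow> ('m::plus, 'h, 'l, 'r) comodule_data
    \<Rightarrow> ('m \<times> 'h \<times> 'h \<Rightarrow>\<^sub>0 int) set" where
  "MHH_LR_null \<H> \<M> = tensor3_null (carrier \<M>) (actL \<M>) (\<lambda>l h. s\<^sub>L \<H> l * h)
     (\<lambda>h r. h * s\<^sub>R \<H> r) (\<lambda>r h. h * t\<^sub>R \<H> r)"

locale right_HR_comodule =
  fixes \<H> :: "('k, 'h::{ring,monoid_mult}, 'l, 'r::{ring,monoid_mult}) hopf_algebroid_data"
    and \<M> :: "('m::ab_group_add, 'h, 'l, 'r) comodule_data"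
  assumes module_R: "right_module_on (carrier \<M>) (actR \<M>)"
    and coactR_closed: "m \<in> carrier \<M> \<Longrightarrow> \<rho>\<^sub>R \<M> m \<in> MH_R_tensor \<H> \<M>"
    and coactR_add: "\<lbrakk>m \<in> carrier \<M>; m' \<in> carrier \<M>\<rbrakk> \<Longrightarrow> \<rho>\<^sub>R \<M> (m + m') = \<rho>\<^sub>R \<M> m + \<rho>\<^sub>R \<M> m'"
    and coactR_linear: "m \<in> carrier \<M> \<Longrightarrow>
      \<rho>\<^sub>R \<M> (actR \<M> m r) = tens_map (MH_R_null \<H> \<M>) (\<lambda>(x, h). (x, h * s\<^sub>R \<H> r)) (\<rho>\<^sub>R \<M> m)"
    and coactR_coassoc: "m \<in> carrier \<M> \<Longrightarrow>
      tens_fst (MHH_RR_null \<H> \<M>) (\<rho>\<^sub>R \<M>) (\<rho>\<^sub>R \<M> m) = tens_snd (MHH_RR_null \<H> \<M>) (\<gamma>\<^sub>R \<H>) (\<rho>\<^sub>R \<M> m)"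
    and coactR_counit: "m \<in> carrier \<M> \<Longrightarrow> sweedler (\<lambda>(x, h). actR \<M> x (\<pi>\<^sub>R \<H> h)) (\<rho>\<^sub>R \<M> m) = m"

locale right_HL_comodule =
  fixes \<H> :: "('k, 'h::{ring,monoid_mult}, 'l::{ring,monoid_mult}, 'r) hopf_algebroid_data"
    and \<M> :: "('m::ab_group_add, 'h, 'l, 'r) comodule_data"
  assumes module_L: "right_module_on (carrier \<M>) (actL \<M>)"
    and coactL_closed: "m \<in> carrier \<M> \<Longrightarrow> \<rho>\<^sub>L \<M> m \<in> MH_L_tensor \<H> \<M>"
    and coactL_add: "\<lbrakk>m \<in> carrier \<M>; m' \<in> carrier \<M>\<rbrakk> \<Longrightarrow> \<rho>\<^sub>L \<M> (m + m') = \<rho>\<^sub>L \<M> m + \<rho>\<^sub>L \<M> m'"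
    and coactL_linear: "m \<in> carrier \<M> \<Longrightarrow>
      \<rho>\<^sub>L \<M> (actL \<M> m l) = tens_map (MH_L_null \<H> \<M>) (\<lambda>(x, h). (x, t\<^sub>L \<H> l * h)) (\<rho>\<^sub>L \<M> m)"
    and coactL_coassoc: "m \<in> carrier \<M> \<Longrightarrow>
      tens_fst (MHH_LL_null \<H> \<M>) (\<rho>\<^sub>L \<M>) (\<rho>\<^sub>L \<M> m) = tens_snd (MHH_LL_null \<H> \<M>) (\<gamma>\<^sub>L \<H>) (\<rho>\<^sub>L \<M> m)"
    and coactL_counit: "m \<in> carrier \<M> \<Longrightarrow> sweedler (\<lambda>(x, h). actL \<M> x (\<pi>\<^sub>L \<H> h)) (\<rho>\<^sub>L \<M> m) = m"

locale right_H_comodule = right_HR_comodule \<H> \<M> + right_HL_comodule \<H> \<M>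
  for \<H> :: "('k, 'h::{ring,monoid_mult}, 'l::{ring,monoid_mult}, 'r::{ring,monoid_mult}) hopf_algebroid_data"
    and \<M> :: "('m::ab_group_add, 'h, 'l, 'r) comodule_data" +
  assumes coactR_L_linear: "m \<in> carrier \<M> \<Longrightarrow>
      \<rho>\<^sub>R \<M> (actL \<M> m l) = tens_map (MH_R_null \<H> \<M>) (\<lambda>(x, h). (x, t\<^sub>L \<H> l * h)) (\<rho>\<^sub>R \<M> m)"
    and coactL_R_linear: "m \<in> carrier \<M> \<Longrightarrow>
      \<rho>\<^sub>L \<M> (actR \<M> m r) = tens_map (MH_L_null \<H> \<M>) (\<lambda>(x, h). (x, h * s\<^sub>R \<H> r)) (\<rho>\<^sub>L \<M> m)"
    and coact_mixed_RL: "m \<in> carrier \<M> \<Longrightarrow>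
      tens_snd (MHH_RL_null \<H> \<M>) (\<gamma>\<^sub>L \<H>) (\<rho>\<^sub>R \<M> m) = tens_fst (MHH_RL_null \<H> \<M>) (\<rho>\<^sub>R \<M>) (\<rho>\<^sub>L \<M> m)"
    and coact_mixed_LR: "m \<in> carrier \<M> \<Longrightarrow>
      tens_snd (MHH_LR_null \<H> \<M>) (\<gamma>\<^sub>R \<H>) (\<rho>\<^sub>L \<M> m) = tens_fst (MHH_LR_null \<H> \<M>) (\<rho>\<^sub>L \<M>) (\<rho>\<^sub>R \<M> m)"

text \<open>
  Module maps for both bases that are colinear for both coactions.  (A bijective one is an
  isomorphism: its inverse is again a comodule map.)  The carriers are only required to live in types
  with an addition, so that the carrier may consist of cosets, with addition of sets.
\<close>

definition comodule_map ::
  "('k, 'h::{ring,monoid_mult}, 'l, 'r) hopf_algebroid_data \<Rightarrow> ('m::plus, 'h, 'l, 'r) comodule_data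
    \<Rightarrow> ('n::plus, 'h, 'l, 'r) comodule_data \<Rightarrow> ('m \<Rightarrow> 'n) \<Rightarrow> bool" where
  "comodule_map \<H> \<M> \<N> f \<longleftrightarrow>
     f ` carrier \<M> \<subseteq> carrier \<N> \<and>
     (\<forall>m\<in>carrier \<M>. \<forall>m'\<in>carrier \<M>. f (m + m') = f m + f m') \<and>
     (\<forall>m\<in>carrier \<M>. \<forall>r. f (actR \<M> m r) = actR \<N> (f m) r) \<and>
     (\<forall>m\<in>carrier \<M>. \<forall>l. f (actL \<M> m l) = actL \<N> (f m) l) \<and>
     (\<forall>m\<in>carrier \<M>. \<rho>\<^sub>R \<N> (f m) = tens_map (MH_R_null \<H> \<N>) (map_prod f id) (\<rho>\<^sub>R \<M> m)) \<and>
     (\<forall>m\<in>carrier \<M>. \<rho>\<^sub>L \<N> (f m) = tens_map (MH_L_null \<H> \<N>) (map_prod f id) (\<rho>\<^sub>L \<M> m))"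

definition regular_comodule ::
  "('k, 'h::{ring,monoid_mult}, 'l, 'r) hopf_algebroid_data \<Rightarrow> ('h, 'h, 'l, 'r) comodule_data" where
  "regular_comodule \<H> = \<lparr>carrier = UNIV, actR = (\<lambda>h r. h * s\<^sub>R \<H> r), actL = (\<lambda>h l. t\<^sub>L \<H> l * h),
     \<rho>\<^sub>R = \<gamma>\<^sub>R \<H>, \<rho>\<^sub>L = \<gamma>\<^sub>L \<H>\<rparr>"

section \<open>Comodule algebras and extensions\<close>

record ('k, 'a, 'h, 'r) comodule_algebra_data =
  scale\<^sub>A :: "'k \<Rightarrow> 'a \<Rightarrow> 'a"
  \<eta>\<^sub>R :: "'r \<Rightarrow> 'a"
  coact\<^sub>R :: "'a \<Rightarrow> ('a, 'h) tensor"
  coact\<^sub>L :: "'a \<Rightarrow> ('a, 'h) tensor"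

definition alg_comodule ::
  "('k, 'h, 'l, 'r) hopf_algebroid_data \<Rightarrow> ('k, 'a::{ring,monoid_mult}, 'h, 'r) comodule_algebra_data
    \<Rightarrow> ('a, 'h, 'l, 'r) comodule_data" where
  "alg_comodule \<H> \<A> = \<lparr>carrier = UNIV, actR = (\<lambda>a r. a * \<eta>\<^sub>R \<A> r),
     actL = (\<lambda>a l. \<eta>\<^sub>R \<A> (\<pi>\<^sub>R \<H> (t\<^sub>L \<H> l)) * a), \<rho>\<^sub>R = coact\<^sub>R \<A>, \<rho>\<^sub>L = coact\<^sub>L \<A>\<rparr>"

text \<open>
  The left \<open>R\<close>-action of an \<open>\<H>\<^sub>R\<close>-comodule is determined by the coaction; \<open>left_action\<close> says that it
  is left multiplication by \<open>\<eta>\<^sub>R\<close>.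
\<close>

locale right_H_comodule_algebra =
  A: k_algebra "scale\<^sub>A \<A>" + right_H_comodule \<H> "alg_comodule \<H> \<A>"
  for \<H> :: "('k::{comm_ring,comm_monoid_mult}, 'h::{ring,monoid_mult}, 'l::{ring,monoid_mult},
      'r::{ring,monoid_mult}) hopf_algebroid_data"
    and \<A> :: "('k, 'a::{ring,monoid_mult}, 'h, 'r) comodule_algebra_data" +
  assumes unit_map: "algebra_map (scale\<^sub>R \<H>) (scale\<^sub>A \<A>) (\<eta>\<^sub>R \<A>)"
    and left_action:
      "\<eta>\<^sub>R \<A> r * a = sweedler (\<lambda>(x, h). x * \<eta>\<^sub>R \<A> (\<pi>\<^sub>R \<H> (s\<^sub>R \<H> r * h))) (coact\<^sub>R \<A> a)"
    and coactR_one: "coact\<^sub>R \<A> 1 = frag_of (1, 1) +o MH_R_null \<H> (alg_comodule \<H> \<A>)"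
    and coactR_mult:
      "coact\<^sub>R \<A> (a * a') = tens_mult (MH_R_null \<H> (alg_comodule \<H> \<A>)) (coact\<^sub>R \<A> a) (coact\<^sub>R \<A> a')"
    and coactL_one: "coact\<^sub>L \<A> 1 = frag_of (1, 1) +o MH_L_null \<H> (alg_comodule \<H> \<A>)"
    and coactL_mult:
      "coact\<^sub>L \<A> (a * a') = tens_mult (MH_L_null \<H> (alg_comodule \<H> \<A>)) (coact\<^sub>L \<A> a) (coact\<^sub>L \<A> a')"

definition coinvariants ::
  "('k, 'h::{ring,monoid_mult}, 'l, 'r) hopf_algebroid_data
    \<Rightarrow> ('k, 'a::{ring,monoid_mult}, 'h, 'r) comodule_algebra_data \<Rightarrow> 'a set" where
  "coinvariants \<H> \<A> = {b. coact\<^sub>R \<A> b = frag_of (b, 1) +o MH_R_null \<H> (alg_comodule \<H> \<A>)}"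

definition right_H_extension ::
  "('k::{comm_ring,comm_monoid_mult}, 'h::{ring,monoid_mult}, 'l::{ring,monoid_mult},
      'r::{ring,monoid_mult}) hopf_algebroid_data
    \<Rightarrow> ('k, 'a::{ring,monoid_mult}, 'h, 'r) comodule_algebra_data \<Rightarrow> 'a set \<Rightarrow> bool" where
  "right_H_extension \<H> \<A> B \<longleftrightarrow> right_H_comodule_algebra \<H> \<A> \<and> B = coinvariants \<H> \<A>"

text \<open>
  \<open>\<eta>\<^sub>L\<close> makes \<open>A\<close> an \<open>L\<close>-ring with \<open>L\<close>-subring \<open>B\<close>; since \<open>B\<close> is a subalgebra of \<open>A\<close>, this is the
  same as making \<open>B\<close> an \<open>L\<close>-ring with unit map \<open>\<eta>\<^sub>L\<close>.
\<close>

definition L_ring_unit ::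
  "('k, 'h, 'l::{ring,monoid_mult}, 'r) hopf_algebroid_data
    \<Rightarrow> ('k, 'a::{ring,monoid_mult}, 'h, 'r) comodule_algebra_data \<Rightarrow> 'a set \<Rightarrow> ('l \<Rightarrow> 'a) \<Rightarrow> bool" where
  "L_ring_unit \<H> \<A> B \<eta>\<^sub>L \<longleftrightarrow> algebra_map (scale\<^sub>L \<H>) (scale\<^sub>A \<A>) \<eta>\<^sub>L \<and> range \<eta>\<^sub>L \<subseteq> B"

definition convolution_inverse ::
  "('k, 'h::{ring,monoid_mult}, 'l, 'r) hopf_algebroid_data
    \<Rightarrow> ('k, 'a::{ring,monoid_mult}, 'h, 'r) comodule_algebra_data
    \<Rightarrow> ('l \<Rightarrow> 'a) \<Rightarrow> ('h \<Rightarrow> 'a) \<Rightarrow> ('h \<Rightarrow> 'a) \<Rightarrow> bool" where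
  "convolution_inverse \<H> \<A> \<eta>\<^sub>L j j\<^sub>c \<longleftrightarrow>
     k_linear (scale\<^sub>H \<H>) (scale\<^sub>A \<A>) j\<^sub>c \<and>
     (\<forall>l h r. j\<^sub>c (t\<^sub>L \<H> l * h * t\<^sub>R \<H> r) = \<eta>\<^sub>R \<A> r * j\<^sub>c h * \<eta>\<^sub>L l) \<and>
     (\<forall>h. sweedler (\<lambda>(a, b). j a * j\<^sub>c b) (\<gamma>\<^sub>R \<H> h) = \<eta>\<^sub>L (\<pi>\<^sub>L \<H> h)) \<and>
     (\<forall>h. sweedler (\<lambda>(a, b). j\<^sub>c a * j b) (\<gamma>\<^sub>L \<H> h) = \<eta>\<^sub>R \<A> (\<pi>\<^sub>R \<H> h))"

definition cleaving_map ::
  "('k, 'h::{ring,monoid_mult}, 'l, 'r) hopf_algebroid_data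
    \<Rightarrow> ('k, 'a::{ring,monoid_mult}, 'h, 'r) comodule_algebra_data
    \<Rightarrow> ('l \<Rightarrow> 'a) \<Rightarrow> ('h \<Rightarrow> 'a) \<Rightarrow> bool" where
  "cleaving_map \<H> \<A> \<eta>\<^sub>L j \<longleftrightarrow>
     (\<forall>l h. j (s\<^sub>L \<H> l * h) = \<eta>\<^sub>L l * j h) \<and>
     comodule_map \<H> (regular_comodule \<H>) (alg_comodule \<H> \<A>) j \<and>
     (\<exists>j\<^sub>c. convolution_inverse \<H> \<A> \<eta>\<^sub>L j j\<^sub>c)"

definition cleft_extension ::
  "('k, 'h::{ring,monoid_mult}, 'l::{ring,monoid_mult}, 'r) hopf_algebroid_data
    \<Rightarrow> ('k, 'a::{ring,monoid_mult}, 'h, 'r) comodule_algebra_data \<Rightarrow> 'a set \<Rightarrow> bool" where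
  "cleft_extension \<H> \<A> B \<longleftrightarrow> (\<exists>\<eta>\<^sub>L j. L_ring_unit \<H> \<A> B \<eta>\<^sub>L \<and> cleaving_map \<H> \<A> \<eta>\<^sub>L j)"

definition can\<^sub>R ::
  "('k, 'h::{ring,monoid_mult}, 'l, 'r) hopf_algebroid_data
    \<Rightarrow> ('k, 'a::{ring,monoid_mult}, 'h, 'r) comodule_algebra_data \<Rightarrow> ('a, 'a) tensor \<Rightarrow> ('a, 'h) tensor" where
  "can\<^sub>R \<H> \<A> = induced (MH_R_null \<H> (alg_comodule \<H> \<A>))
     (\<lambda>(a, a'). frag_map (\<lambda>(x, h). (a * x, h)) (rep (coact\<^sub>R \<A> a')))"

definition galois\<^sub>R ::
  "('k, 'h::{ring,monoid_mult}, 'l, 'r) hopf_algebroid_data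
    \<Rightarrow> ('k, 'a::{ring,monoid_mult}, 'h, 'r) comodule_algebra_data \<Rightarrow> 'a set \<Rightarrow> bool" where
  "galois\<^sub>R \<H> \<A> B \<longleftrightarrow>
     bij_betw (can\<^sub>R \<H> \<A>) (tensor_carrier UNIV B (*) (*)) (MH_R_tensor \<H> (alg_comodule \<H> \<A>))"

section \<open>The left \<open>B\<close>-module and right comodule \<open>B \<otimes>\<^sub>L H\<close>\<close>

definition BH_null ::
  "('k, 'h::{ring,monoid_mult}, 'l, 'r) hopf_algebroid_data
    \<Rightarrow> 'a::{ring,monoid_mult} set \<Rightarrow> ('l \<Rightarrow> 'a) \<Rightarrow> ('a \<times> 'h \<Rightarrow>\<^sub>0 int) set" where
  "BH_null \<H> B \<eta>\<^sub>L = tensor_null B UNIV (\<lambda>b l. b * \<eta>\<^sub>L l) (\<lambda>l h. s\<^sub>L \<H> l * h)"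

definition BH_tensor ::
  "('k, 'h::{ring,monoid_mult}, 'l, 'r) hopf_algebroid_data
    \<Rightarrow> 'a::{ring,monoid_mult} set \<Rightarrow> ('l \<Rightarrow> 'a) \<Rightarrow> ('a, 'h) tensor set" where
  "BH_tensor \<H> B \<eta>\<^sub>L = tensor_carrier B UNIV (\<lambda>b l. b * \<eta>\<^sub>L l) (\<lambda>l h. s\<^sub>L \<H> l * h)"

definition BH_left_mult ::
  "('k, 'h::{ring,monoid_mult}, 'l, 'r) hopf_algebroid_data
    \<Rightarrow> 'a::{ring,monoid_mult} set \<Rightarrow> ('l \<Rightarrow> 'a) \<Rightarrow> 'a \<Rightarrow> ('a, 'h) tensor \<Rightarrow> ('a, 'h) tensor" where
  "BH_left_mult \<H> B \<eta>\<^sub>L b = tens_map (BH_null \<H> B \<eta>\<^sub>L) (\<lambda>(b', h). (b * b', h))"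

definition BH_actR ::
  "('k, 'h::{ring,monoid_mult}, 'l, 'r) hopf_algebroid_data
    \<Rightarrow> 'a::{ring,monoid_mult} set \<Rightarrow> ('l \<Rightarrow> 'a) \<Rightarrow> ('a, 'h) tensor \<Rightarrow> 'r \<Rightarrow> ('a, 'h) tensor" where
  "BH_actR \<H> B \<eta>\<^sub>L x r = tens_map (BH_null \<H> B \<eta>\<^sub>L) (\<lambda>(b, h). (b, h * s\<^sub>R \<H> r)) x"

definition BH_actL ::
  "('k, 'h::{ring,monoid_mult}, 'l, 'r) hopf_algebroid_data
    \<Rightarrow> 'a::{ring,monoid_mult} set \<Rightarrow> ('l \<Rightarrow> 'a) \<Rightarrow> ('a, 'h) tensor \<Rightarrow> 'l \<Rightarrow> ('a, 'h) tensor" where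
  "BH_actL \<H> B \<eta>\<^sub>L x l = tens_map (BH_null \<H> B \<eta>\<^sub>L) (\<lambda>(b, h). (b, t\<^sub>L \<H> l * h)) x"

text \<open>
  \<open>b \<otimes> h \<mapsto> (b \<otimes> h') \<otimes> h''\<close>, where \<open>h' \<otimes> h''\<close> is the coproduct \<open>\<gamma> h\<close> and \<open>N\<close> is the null subgroup
  of the outer tensor product.
\<close>

definition BH_coact ::
  "('k, 'h::{ring,monoid_mult}, 'l, 'r) hopf_algebroid_data
    \<Rightarrow> 'a::{ring,monoid_mult} set \<Rightarrow> ('l \<Rightarrow> 'a)
    \<Rightarrow> (('a, 'h) tensor \<times> 'h \<Rightarrow>\<^sub>0 int) set \<Rightarrow> ('h \<Rightarrow> ('h, 'h) tensor)
    \<Rightarrow> ('a, 'h) tensor \<Rightarrow> (('a, 'h) tensor, 'h) tensor" where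
  "BH_coact \<H> B \<eta>\<^sub>L N \<gamma> = induced N
     (\<lambda>(b, h). frag_map (\<lambda>(h', h''). (frag_of (b, h') +o BH_null \<H> B \<eta>\<^sub>L, h'')) (rep (\<gamma> h)))"

definition BH_comodule ::
  "('k, 'h::{ring,monoid_mult}, 'l, 'r) hopf_algebroid_data
    \<Rightarrow> 'a::{ring,monoid_mult} set \<Rightarrow> ('l \<Rightarrow> 'a) \<Rightarrow> (('a, 'h) tensor, 'h, 'l, 'r) comodule_data" where
  "BH_comodule \<H> B \<eta>\<^sub>L = \<lparr>carrier = BH_tensor \<H> B \<eta>\<^sub>L,
     actR = BH_actR \<H> B \<eta>\<^sub>L,
     actL = BH_actL \<H> B \<eta>\<^sub>L,
     \<rho>\<^sub>R = BH_coact \<H> B \<eta>\<^sub>L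
       (tensor_null (BH_tensor \<H> B \<eta>\<^sub>L) UNIV (BH_actR \<H> B \<eta>\<^sub>L) (\<lambda>r h. h * t\<^sub>R \<H> r)) (\<gamma>\<^sub>R \<H>),
     \<rho>\<^sub>L = BH_coact \<H> B \<eta>\<^sub>L
       (tensor_null (BH_tensor \<H> B \<eta>\<^sub>L) UNIV (BH_actL \<H> B \<eta>\<^sub>L) (\<lambda>l h. s\<^sub>L \<H> l * h)) (\<gamma>\<^sub>L \<H>)\<rparr>"

definition BH_iso ::
  "('k, 'h::{ring,monoid_mult}, 'l, 'r) hopf_algebroid_data
    \<Rightarrow> ('k, 'a::{ring,monoid_mult}, 'h, 'r) comodule_algebra_data
    \<Rightarrow> 'a set \<Rightarrow> ('l \<Rightarrow> 'a) \<Rightarrow> (('a, 'h) tensor \<Rightarrow> 'a) \<Rightarrow> bool" where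
  "BH_iso \<H> \<A> B \<eta>\<^sub>L \<phi> \<longleftrightarrow>
     comodule_map \<H> (BH_comodule \<H> B \<eta>\<^sub>L) (alg_comodule \<H> \<A>) \<phi> \<and>
     (\<forall>b\<in>B. \<forall>x\<in>BH_tensor \<H> B \<eta>\<^sub>L. \<phi> (BH_left_mult \<H> B \<eta>\<^sub>L b x) = b * \<phi> x) \<and>
     bij_betw \<phi> (BH_tensor \<H> B \<eta>\<^sub>L) UNIV"

end

theory Submission
  imports Defs
begin

text \<open>
  If \<open>j\<close> is a cleaving map with convolution inverse \<open>j\<^sub>c\<close>, then the coaction on \<open>j\<^sub>c\<close> is
  \<open>\<rho>\<^sub>R (j\<^sub>c h) = j\<^sub>c h\<^sub>2 \<otimes> S h\<^sub>1\<close>, so that \<open>proj a = a\<^sup>0 j\<^sub>c a\<^sup>1\<close> is coinvariant.  Hence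
  \<open>a \<otimes> h \<mapsto> a j\<^sub>c h\<^sub>1 \<otimes> j h\<^sub>2\<close> inverts the canonical map, and \<open>a \<mapsto> proj a\<^sub>0 \<otimes> a\<^sub>1\<close> inverts
  \<open>b \<otimes> h \<mapsto> b j h\<close>.  Conversely, an isomorphism \<open>\<phi>\<close> from \<open>B \<otimes>\<^sub>L H\<close> gives \<open>j h = \<phi> (1 \<otimes> h)\<close> and
  the left \<open>B\<close>-linear map \<open>E\<close> with \<open>E (\<phi> (b \<otimes> h)) = b \<eta>\<^sub>L (\<pi>\<^sub>L h)\<close>; then \<open>j\<^sub>c h\<close> is the image of
  \<open>can\<^sub>R\<inverse> (1 \<otimes> h)\<close> under \<open>a \<otimes> a' \<mapsto> a E a'\<close>.

  Identities between elements of tensor products are stated for representatives in free abelian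
  groups, modulo the null subgroup \<open>K\<close> of the target; \<open>K = {}\<close> gives plain equality.
\<close>

section \<open>Linear extension and congruence\<close>

text \<open>Componentwise products in \<open>A \<otimes>\<^sub>R H\<close> respect the balancing
  only if the right factor satisfies a Takeuchi condition. This shapes the first direction: the
  condition is proved for the coaction (\<open>rR_takeuchi\<close>) and for the candidate coaction
  on \<open>jc\<close> (\<open>jc_S_takeuchi\<close>) before either serves as a right factor. The
  candidate itself is well defined because of \<open>jc_tR\<close>, a rule that is absent from the
  definition of a convolution inverse and is extracted from uniqueness of inverses. The formula for
  the coaction on \<open>jc\<close> has the same origin: both sides are convolution inverse to the
  coaction composed with \<open>j\<close>. The antipode enters in two places, in the candidate and
  in \<open>rL_coinv\<close>, which makes coinvariants of the right coaction coinvariant for the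
  left one. In the second direction the relation with \<open>j\<close> on the left is immediate from
  \<open>E (j h)\<close>; the relation with \<open>j\<close> on the right is tested on a preimage of
  \<open>1 \<otimes> h\<close> under the canonical map, where both of its sides evaluate to the
  product of the two tensor factors.\<close>

definition lext :: "('x \<Rightarrow> 'g::ab_group_add) \<Rightarrow> ('x \<Rightarrow>\<^sub>0 int) \<Rightarrow> 'g" where
  "lext f x = (\<Sum>p\<in>Poly_Mapping.keys x. int_mult (Poly_Mapping.lookup x p) (f p))"

lemma int_mult_succ: "int_mult (i + 1) x = int_mult i x + x"
proof (cases "i \<ge> 0")
  case True
  then have "nat (i + 1) = Suc (nat i)" "nat (- i) = 0" "nat (- (i + 1)) = 0" by auto
  then show ?thesis by (simp add: int_mult_def add.commute)
next
  case False
  then have "nat (- i) = Suc (nat (- (i + 1)))" "nat i = 0" "nat (i + 1) = 0" by auto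
  then show ?thesis unfolding int_mult_def by simp
qed

lemma int_mult_0 [simp]: "int_mult 0 x = 0"
  by (simp add: int_mult_def)

lemma int_mult_add: "int_mult (i + j) x = int_mult i x + int_mult j x"
proof (induction j rule: int_induct[where k=0])
  case base
  then show ?case by simp
next
  case (step1 j)
  then show ?case using int_mult_succ[of "i + j" x] int_mult_succ[of j x] by (simp add: algebra_simps)
next
  case (step2 j)
  then show ?case
    using int_mult_succ[of "i + (j - 1)" x] int_mult_succ[of "j - 1" x]
    by (simp add: algebra_simps)
qed

lemma int_mult_1 [simp]: "int_mult 1 x = x"
  using int_mult_succ[of 0 x] by simp

lemma int_mult_frag_cmul: "int_mult i x = frag_cmul i x"
proof (induction i rule: int_induct[where k=0])
  case base
  then show ?case by simp
next
  case (step1 i)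
  then show ?case by (simp add: int_mult_succ frag_cmul_distrib)
next
  case (step2 i)
  then show ?case
    using int_mult_succ[of "i - 1" x] frag_cmul_distrib[of "i - 1" 1 x] by simp
qed

text \<open>Together with the next two lemmas this brings \<open>sweedler\<close>,
  \<open>frag_extend\<close> and \<open>frag_map\<close> to one form with values in any abelian
  group, so that a single calculus covers sums in \<open>A\<close> and sums of free
  generators.\<close>

lemma sweedler_eq_lext: "sweedler f t = lext f (rep t)"
  by (simp add: sweedler_def lext_def)

lemma frag_extend_eq_lext: "frag_extend f x = lext f x"
  by (simp add: frag_extend_def lext_def int_mult_frag_cmul)

lemma frag_map_eq_lext: "frag_map g x = lext (\<lambda>p. frag_of (g p)) x"
  by (simp add: frag_map_def frag_extend_eq_lext)

lemma lext_superset: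
  assumes "finite S" "Poly_Mapping.keys x \<subseteq> S"
  shows "lext f x = (\<Sum>p\<in>S. int_mult (Poly_Mapping.lookup x p) (f p))"
  unfolding lext_def using assms by (intro sum.mono_neutral_left) (auto simp: in_keys_iff)

lemma lext_0 [simp]: "lext f 0 = 0"
  by (simp add: lext_def)

lemma lext_frag_of [simp]: "lext f (frag_of p) = f p"
  by (simp add: lext_def)

lemma lext_add: "lext f (x + y) = lext f x + lext f y"
proof -
  let ?S = "Poly_Mapping.keys x \<union> Poly_Mapping.keys y"
  have "finite ?S" "Poly_Mapping.keys (x + y) \<subseteq> ?S" by (auto dest: subsetD[OF keys_add])
  then have "lext f (x + y) = (\<Sum>p\<in>?S. int_mult (Poly_Mapping.lookup (x + y) p) (f p))"
    by (rule lext_superset)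
  also have "\<dots> = lext f x + lext f y"
    by (simp add: lext_superset[of ?S] lookup_add int_mult_add sum.distrib)
  finally show ?thesis .
qed

lemma lext_minus: "lext f (- x) = - lext f x"
  using lext_add[of f x "- x"] by (simp add: eq_neg_iff_add_eq_0 add.commute)

lemma lext_diff: "lext f (x - y) = lext f x - lext f y"
  using lext_add[of f x "- y"] by (simp add: lext_minus)

text \<open>Additivity suffices because all coefficients are integers. This is how a map is moved
  through a Sweedler sum.\<close>

lemma lext_hom:
  assumes "\<And>x y. f (x + y) = f x + f y"
  shows "f (lext F x) = lext (\<lambda>p. f (F p)) x"
proof -
  have 0: "f 0 = 0" using assms[of 0 0] by simp
  have d: "f (x - y) = f x - f y" for x y
    using assms[of "x - y" y] by (simp add: eq_diff_eq)
  show ?thesis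
    using subset_UNIV by (induction x rule: frag_induction) (auto simp: lext_diff 0 d)
qed

lemma lext_lext: "lext F (lext G x) = lext (\<lambda>p. lext F (G p)) x"
  by (rule lext_hom) (rule lext_add)

lemma lext_cong: "(\<And>p. p \<in> Poly_Mapping.keys x \<Longrightarrow> F p = G p) \<Longrightarrow> lext F x = lext G x"
  by (simp add: lext_def)

lemma lext_frag: "lext frag_of x = x"
  using subset_UNIV by (induction x rule: frag_induction) (auto simp: lext_diff)

lemma lext_sum: "lext (\<lambda>p. F p + G p) x = lext F x + lext G x"
  using subset_UNIV by (induction x rule: frag_induction) (auto simp: lext_diff)

lemma lext_subtract: "lext (\<lambda>p. F p - G p) x = lext F x - lext G x"
  using subset_UNIV by (induction x rule: frag_induction) (auto simp: lext_diff)

lemma lext_const_0 [simp]: "lext (\<lambda>p. 0) x = 0"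
  using subset_UNIV by (induction x rule: frag_induction) (auto simp: lext_diff)

lemma lext_swap: "lext (\<lambda>p. lext (\<lambda>q. F p q) y) x = lext (\<lambda>q. lext (\<lambda>p. F p q) x) y"
  using subset_UNIV by (induction x rule: frag_induction) (auto simp: lext_diff lext_subtract)

lemma lext_mult_left: "(a::'a::ring) * lext F x = lext (\<lambda>p. a * F p) x"
  by (rule lext_hom) (rule distrib_left)

lemma lext_mult_right: "lext F x * (a::'a::ring) = lext (\<lambda>p. F p * a) x"
  by (rule lext_hom[of "\<lambda>y. y * a"]) (rule distrib_right)

section \<open>Congruence modulo the subgroup generated by a set\<close>

inductive_set subgroup_hull :: "'g::ab_group_add set \<Rightarrow> 'g set" for K where
  incl: "x \<in> K \<Longrightarrow> x \<in> subgroup_hull K"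
| zero: "0 \<in> subgroup_hull K"
| diff: "x \<in> subgroup_hull K \<Longrightarrow> y \<in> subgroup_hull K \<Longrightarrow> x - y \<in> subgroup_hull K"

text \<open>Passing to the hull gives a congruence for every \<open>K\<close>, so no subgroup
  assumption travels with it; null subgroups are their own hulls
  (\<open>subgroup_tensor_null\<close>).\<close>

definition eqmod :: "'g \<Rightarrow> 'g::ab_group_add set \<Rightarrow> 'g \<Rightarrow> bool"
    (\<open>(_/ \<approx>\<^bsub>_\<^esub> _)\<close> [51, 0, 51] 50) where
  "x \<approx>\<^bsub>K\<^esub> y \<longleftrightarrow> x - y \<in> subgroup_hull K"

lemma subgroup_hull_minus: "x \<in> subgroup_hull K \<Longrightarrow> - x \<in> subgroup_hull K"
  using subgroup_hull.diff[OF subgroup_hull.zero, of x K] by simp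

lemma subgroup_hull_add: "x \<in> subgroup_hull K \<Longrightarrow> y \<in> subgroup_hull K \<Longrightarrow> x + y \<in> subgroup_hull K"
  using subgroup_hull.diff[of x K "- y"] subgroup_hull_minus[of y K] by simp

lemma eqmod_refl [simp, intro]: "x \<approx>\<^bsub>K\<^esub> x"
  by (simp add: eqmod_def subgroup_hull.zero)

lemma eqmod_sym: "x \<approx>\<^bsub>K\<^esub> y \<Longrightarrow> y \<approx>\<^bsub>K\<^esub> x"
  using subgroup_hull_minus[of "x - y" K] by (simp add: eqmod_def)

lemma eqmod_trans [trans]: "x \<approx>\<^bsub>K\<^esub> y \<Longrightarrow> y \<approx>\<^bsub>K\<^esub> z \<Longrightarrow> x \<approx>\<^bsub>K\<^esub> z"
  using subgroup_hull_add[of "x - y" K "y - z"] by (simp add: eqmod_def)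

lemma eqmod_add: "x \<approx>\<^bsub>K\<^esub> y \<Longrightarrow> x' \<approx>\<^bsub>K\<^esub> y' \<Longrightarrow> x + x' \<approx>\<^bsub>K\<^esub> y + y'"
  using subgroup_hull_add[of "x - y" K "x' - y'"] by (simp add: eqmod_def algebra_simps)

lemma eqmod_diff: "x \<approx>\<^bsub>K\<^esub> y \<Longrightarrow> x' \<approx>\<^bsub>K\<^esub> y' \<Longrightarrow> x - x' \<approx>\<^bsub>K\<^esub> y - y'"
  using subgroup_hull.diff[of "x - y" K "x' - y'"] by (simp add: eqmod_def algebra_simps)

lemma subgroup_hull_empty: "x \<in> subgroup_hull {} \<Longrightarrow> x = 0"
  by (induction rule: subgroup_hull.induct) auto

lemma eqmod_empty [simp]: "x \<approx>\<^bsub>{}\<^esub> y \<longleftrightarrow> x = y"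
  using subgroup_hull_empty[of "x - y"] by (auto simp: eqmod_def subgroup_hull.zero)

lemma eqmodI: "x - y \<in> K \<Longrightarrow> x \<approx>\<^bsub>K\<^esub> y"
  by (simp add: eqmod_def subgroup_hull.incl)

lemma eqmod_diffI: "x - y - z \<in> K \<Longrightarrow> x \<approx>\<^bsub>K\<^esub> y + z"
  by (rule eqmodI) (simp add: diff_diff_eq)

text \<open>For tensors over \<open>B\<close> the termwise congruences are known only when the first
  component lies in \<open>B\<close>, hence the restriction to the keys.\<close>

lemma lext_eqmod_keys:
  assumes "\<And>p. p \<in> Poly_Mapping.keys x \<Longrightarrow> F p \<approx>\<^bsub>K\<^esub> G p"
  shows "lext F x \<approx>\<^bsub>K\<^esub> lext G x"
proof -
  \<comment> \<open>The difference is cut off outside the keys, so that all its values lie in the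
    hull and the induction can run over the whole free group.\<close>
  define D where "D p = (if p \<in> Poly_Mapping.keys x then F p - G p else 0)" for p
  have "lext F x = lext (\<lambda>p. G p + D p) x"
    by (rule lext_cong) (simp add: D_def)
  moreover have "lext D x \<in> subgroup_hull K"
  proof -
    have D: "D p \<in> subgroup_hull K" for p
      using assms[of p] by (auto simp: D_def eqmod_def subgroup_hull.zero)
    show ?thesis
      using subset_UNIV
      by (induction x rule: frag_induction) (auto simp: lext_diff D subgroup_hull.intros)
  qed
  ultimately show ?thesis by (simp add: lext_sum eqmod_def)
qed

lemma lext_eqmod: "(\<And>p. F p \<approx>\<^bsub>K\<^esub> G p) \<Longrightarrow> lext F x \<approx>\<^bsub>K\<^esub> lext G x"
  by (rule lext_eqmod_keys)

lemma lext2_eqmod: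
  "(\<And>a b. F a b \<approx>\<^bsub>K\<^esub> G a b) \<Longrightarrow> lext (\<lambda>(a, b). F a b) x \<approx>\<^bsub>K\<^esub> lext (\<lambda>(a, b). G a b) x"
  by (rule lext_eqmod) auto

lemma sweedler_eqmod:
  "(\<And>a b. F a b \<approx>\<^bsub>K\<^esub> G a b) \<Longrightarrow> sweedler (\<lambda>(a, b). F a b) t \<approx>\<^bsub>K\<^esub> sweedler (\<lambda>(a, b). G a b) t"
  unfolding sweedler_eq_lext by (rule lext2_eqmod)

lemma sweedler_add: "sweedler (\<lambda>(a, b). F a b + G a b) t = sweedler (\<lambda>(a, b). F a b) t + sweedler (\<lambda>(a, b). G a b) t"
  unfolding sweedler_eq_lext by (simp add: lext_sum[symmetric] case_prod_unfold)

lemma sweedler_mult_left: "(a::'a::ring) * sweedler (\<lambda>(x, y). F x y) t = sweedler (\<lambda>(x, y). a * F x y) t"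
  unfolding sweedler_eq_lext by (simp add: lext_mult_left case_prod_unfold)

lemma sweedler_mult_right: "sweedler (\<lambda>(x, y). F x y) t * (a::'a::ring) = sweedler (\<lambda>(x, y). F x y * a) t"
  unfolding sweedler_eq_lext by (simp add: lext_mult_right case_prod_unfold)

lemma sweedler_hom:
  "(\<And>x y. f (x + y) = f x + f y) \<Longrightarrow> f (sweedler (\<lambda>(x, y). F x y) t) = sweedler (\<lambda>(x, y). f (F x y)) t"
  unfolding sweedler_eq_lext using lext_hom[of f "\<lambda>(x, y). F x y" "rep t"] by (simp add: case_prod_unfold)

lemma lext_sweedler:
  "lext F (sweedler (\<lambda>(x, y). G x y) t) = sweedler (\<lambda>(x, y). lext F (G x y)) t"
  by (rule sweedler_hom) (rule lext_add)

lemma sweedler_swap: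
  "sweedler (\<lambda>(a, b). sweedler (\<lambda>(c, d). F a b c d) u) t =
   sweedler (\<lambda>(c, d). sweedler (\<lambda>(a, b). F a b c d) t) u"
  unfolding sweedler_eq_lext using lext_swap[of "\<lambda>p q. F (fst p) (snd p) (fst q) (snd q)" "rep u" "rep t"]
  by (simp add: case_prod_unfold)

text \<open>Evaluation of a balanced map on a coaction or coproduct is additive only up to
  congruence (\<open>rR_add\<close>, \<open>gL_add\<close>); this version of \<open>lext_hom\<close>
  is made for it.\<close>

lemma lext_hom_eqmod:
  assumes "\<And>x y. f (x + y) \<approx>\<^bsub>K\<^esub> f x + f y"
  shows "f (lext F x) \<approx>\<^bsub>K\<^esub> lext (\<lambda>p. f (F p)) x"
proof -
  have 0: "f 0 \<approx>\<^bsub>K\<^esub> 0" using eqmod_sym[OF assms[of 0 0]] by (simp add: eqmod_def)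
  have d: "f (x - y) \<approx>\<^bsub>K\<^esub> f x - f y" for x y
    using eqmod_sym[OF assms[of "x - y" y]] by (auto simp: eqmod_def algebra_simps dest: subgroup_hull_minus)
  show ?thesis
    using subset_UNIV
    by (induction x rule: frag_induction) (auto simp: lext_diff 0 intro: eqmod_trans[OF d eqmod_diff])
qed

lemma sweedler_hom_eqmod:
  "(\<And>x y. f (x + y) \<approx>\<^bsub>K\<^esub> f x + f y) \<Longrightarrow>
   f (sweedler (\<lambda>(x, y). F x y) t) \<approx>\<^bsub>K\<^esub> sweedler (\<lambda>(x, y). f (F x y)) t"
  unfolding sweedler_eq_lext using lext_hom_eqmod[of f K "\<lambda>(x, y). F x y" "rep t"]
  by (simp add: case_prod_unfold)

section \<open>Balanced maps\<close>

text \<open>The conditions for \<open>F\<close> to factor through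
  \<open>M \<otimes>\<^sub>Q N\<close> into the quotient by the hull of \<open>K\<close>. With a
  quotient as target, \<open>F\<close> may take values in representatives of another tensor
  product.\<close>

definition balanced ::
  "'m::plus set \<Rightarrow> 'q set \<Rightarrow> ('m \<Rightarrow> 'q \<Rightarrow> 'm) \<Rightarrow> ('q \<Rightarrow> 'n::plus \<Rightarrow> 'n) \<Rightarrow> 'g::ab_group_add set
    \<Rightarrow> ('m \<Rightarrow> 'n \<Rightarrow> 'g) \<Rightarrow> bool" where
  "balanced M Q ra la K F \<longleftrightarrow>
     (\<forall>m\<in>M. \<forall>m'\<in>M. \<forall>n. F (m + m') n \<approx>\<^bsub>K\<^esub> F m n + F m' n) \<and>
     (\<forall>m\<in>M. \<forall>n n'. F m (n + n') \<approx>\<^bsub>K\<^esub> F m n + F m n') \<and>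
     (\<forall>m\<in>M. \<forall>q\<in>Q. \<forall>n. F (ra m q) n \<approx>\<^bsub>K\<^esub> F m (la q n))"

lemma balancedI:
  assumes "\<And>m m' n. m \<in> M \<Longrightarrow> m' \<in> M \<Longrightarrow> F (m + m') n \<approx>\<^bsub>K\<^esub> F m n + F m' n"
    and "\<And>m n n'. m \<in> M \<Longrightarrow> F m (n + n') \<approx>\<^bsub>K\<^esub> F m n + F m n'"
    and "\<And>m q n. m \<in> M \<Longrightarrow> q \<in> Q \<Longrightarrow> F (ra m q) n \<approx>\<^bsub>K\<^esub> F m (la q n)"
  shows "balanced M Q ra la K F"
  using assms by (auto simp: balanced_def)

lemma balanced_add:
  assumes "balanced UNIV Q ra la K F"
  shows "F (x + x') y \<approx>\<^bsub>K\<^esub> F x y + F x' y" "F x (y + y') \<approx>\<^bsub>K\<^esub> F x y + F x y'"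
  using assms by (auto simp: balanced_def)

lemma balanced_bal:
  assumes "balanced UNIV UNIV ra la K F"
  shows "F (ra x q) y \<approx>\<^bsub>K\<^esub> F x (la q y)"
  using assms by (auto simp: balanced_def)

definition balanced3 ::
  "'m::plus set \<Rightarrow> ('m \<Rightarrow> 'p \<Rightarrow> 'm) \<Rightarrow> ('p \<Rightarrow> 'n::plus \<Rightarrow> 'n) \<Rightarrow> ('n \<Rightarrow> 'q \<Rightarrow> 'n) \<Rightarrow> ('q \<Rightarrow> 'c::plus \<Rightarrow> 'c)
    \<Rightarrow> 'g::ab_group_add set \<Rightarrow> ('m \<Rightarrow> 'n \<Rightarrow> 'c \<Rightarrow> 'g) \<Rightarrow> bool" where
  "balanced3 M ra la ra' la' K F \<longleftrightarrow>
     (\<forall>m\<in>M. \<forall>m'\<in>M. \<forall>n c. F (m + m') n c \<approx>\<^bsub>K\<^esub> F m n c + F m' n c) \<and>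
     (\<forall>m\<in>M. \<forall>n n' c. F m (n + n') c \<approx>\<^bsub>K\<^esub> F m n c + F m n' c) \<and>
     (\<forall>m\<in>M. \<forall>n c c'. F m n (c + c') \<approx>\<^bsub>K\<^esub> F m n c + F m n c') \<and>
     (\<forall>m\<in>M. \<forall>p n c. F (ra m p) n c \<approx>\<^bsub>K\<^esub> F m (la p n) c) \<and>
     (\<forall>m\<in>M. \<forall>n q c. F m (ra' n q) c \<approx>\<^bsub>K\<^esub> F m n (la' q c))"

lemma balanced3I:
  assumes "\<And>m m' n c. m \<in> M \<Longrightarrow> m' \<in> M \<Longrightarrow> F (m + m') n c \<approx>\<^bsub>K\<^esub> F m n c + F m' n c"
    and "\<And>m n n' c. m \<in> M \<Longrightarrow> F m (n + n') c \<approx>\<^bsub>K\<^esub> F m n c + F m n' c"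
    and "\<And>m n c c'. m \<in> M \<Longrightarrow> F m n (c + c') \<approx>\<^bsub>K\<^esub> F m n c + F m n c'"
    and "\<And>m p n c. m \<in> M \<Longrightarrow> F (ra m p) n c \<approx>\<^bsub>K\<^esub> F m (la p n) c"
    and "\<And>m n q c. m \<in> M \<Longrightarrow> F m (ra' n q) c \<approx>\<^bsub>K\<^esub> F m n (la' q c)"
  shows "balanced3 M ra la ra' la' K F"
  using assms by (auto simp: balanced3_def)

lemma lext_tensor_null:
  assumes "balanced M Q ra la K F" "x \<in> tensor_null M Q ra la"
  shows "lext (\<lambda>(a, b). F a b) x \<in> subgroup_hull K"
  using assms(2) assms(1)
  by induction (auto simp: lext_diff lext_add balanced_def eqmod_def diff_diff_eq subgroup_hull.intros)

text \<open>The universal property of the tensor product: each generator of the null subgroup is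
  sent into the hull of \<open>K\<close>.\<close>

lemma lext_balanced:
  assumes "balanced M Q ra la K F" "x \<approx>\<^bsub>tensor_null M Q ra la\<^esub> y"
  shows "lext (\<lambda>(a, b). F a b) x \<approx>\<^bsub>K\<^esub> lext (\<lambda>(a, b). F a b) y"
proof -
  have "lext (\<lambda>(a, b). F a b) z \<in> subgroup_hull K" if "z \<in> subgroup_hull (tensor_null M Q ra la)" for z
    using that by induction (auto simp: lext_diff subgroup_hull.intros lext_tensor_null[OF assms(1)])
  from this[of "x - y"] assms(2) show ?thesis by (simp add: eqmod_def lext_diff)
qed

lemma lext_tensor3_null:
  assumes "balanced3 M ra la ra' la' K F" "x \<in> tensor3_null M ra la ra' la'"
  shows "lext (\<lambda>(a, b, c). F a b c) x \<in> subgroup_hull K"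
  using assms(2) assms(1)
  by induction (auto simp: lext_diff lext_add balanced3_def eqmod_def diff_diff_eq subgroup_hull.intros)

lemma lext_balanced3:
  assumes "balanced3 M ra la ra' la' K F" "x \<approx>\<^bsub>tensor3_null M ra la ra' la'\<^esub> y"
  shows "lext (\<lambda>(a, b, c). F a b c) x \<approx>\<^bsub>K\<^esub> lext (\<lambda>(a, b, c). F a b c) y"
proof -
  have "lext (\<lambda>(a, b, c). F a b c) z \<in> subgroup_hull K"
    if "z \<in> subgroup_hull (tensor3_null M ra la ra' la')" for z
    using that by induction (auto simp: lext_diff subgroup_hull.intros lext_tensor3_null[OF assms(1)])
  from this[of "x - y"] assms(2) show ?thesis by (simp add: eqmod_def lext_diff)
qed

lemma balanced_swe:
  assumes "\<And>a b. balanced M Q ra la K (F a b)"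
  shows "balanced M Q ra la K (\<lambda>m n. sweedler (\<lambda>(a, b). F a b m n) t)"
  using assms
  by (intro balancedI; simp add: sweedler_add[symmetric]; intro sweedler_eqmod)
     (auto simp: balanced_def)

section \<open>Cosets\<close>

lemma subgroup_tensor_null: "subgroup_hull (tensor_null M Q ra la) = tensor_null M Q ra la"
proof
  show "subgroup_hull (tensor_null M Q ra la) \<subseteq> tensor_null M Q ra la"
  proof
    fix x assume "x \<in> subgroup_hull (tensor_null M Q ra la)"
    then show "x \<in> tensor_null M Q ra la" by induction (auto intro: tensor_null.intros)
  qed
qed (auto intro: subgroup_hull.incl)

lemma subgroup_tensor3_null: "subgroup_hull (tensor3_null M ra la ra' la') = tensor3_null M ra la ra' la'"
proof
  show "subgroup_hull (tensor3_null M ra la ra' la') \<subseteq> tensor3_null M ra la ra' la'"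
  proof
    fix x assume "x \<in> subgroup_hull (tensor3_null M ra la ra' la')"
    then show "x \<in> tensor3_null M ra la ra' la'" by induction (auto intro: tensor3_null.intros)
  qed
qed (auto intro: subgroup_hull.incl)

lemma coset_eqmod:
  assumes "x +o K = y +o K" "subgroup_hull K = K"
  shows "x \<approx>\<^bsub>K\<^esub> y"
proof -
  have "0 \<in> K" using subgroup_hull.zero assms(2) by metis
  then have "x \<in> y +o K" using assms(1) set_plus_intro2[of 0 K x] by simp
  then show ?thesis by (intro eqmodI) (simp add: set_plus_imp_minus)
qed

lemma coset_eqI:
  assumes "x \<approx>\<^bsub>K\<^esub> y" "subgroup_hull K = K"
  shows "x +o K = y +o K"
proof -
  have "a \<in> y +o K" if "a \<in> x +o K" "x \<approx>\<^bsub>K\<^esub> y" for a x y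
  proof -
    have "a \<approx>\<^bsub>K\<^esub> x" using that(1) by (intro eqmodI) (simp add: set_plus_imp_minus)
    then have "a \<approx>\<^bsub>K\<^esub> y" using that(2) by (rule eqmod_trans)
    then show ?thesis using assms(2) by (simp add: eqmod_def set_minus_plus)
  qed
  then show ?thesis using assms(1) eqmod_sym by blast
qed

lemma coset_eq_iff: "subgroup_hull K = K \<Longrightarrow> x +o K = y +o K \<longleftrightarrow> x \<approx>\<^bsub>K\<^esub> y"
  using coset_eqI coset_eqmod by blast

lemma rep_coset:
  assumes "subgroup_hull K = K"
  shows "rep (x +o K) \<approx>\<^bsub>K\<^esub> x"
proof -
  have "0 \<in> K" using subgroup_hull.zero assms by metis
  then have "x \<in> x +o K" using set_plus_intro2[of 0 K x] by simp
  then have "rep (x +o K) \<in> x +o K" unfolding rep_def by (rule someI)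
  then show ?thesis by (intro eqmodI) (simp add: set_plus_imp_minus)
qed

lemma coset_rep:
  assumes "subgroup_hull K = K" "t = x +o K"
  shows "rep t +o K = t"
  using assms rep_coset coset_eqI by metis

lemma coset_add:
  assumes "subgroup_hull K = K"
  shows "(x +o K) + (y +o K) = (x + y) +o K"
proof -
  have "K + K = K"
  proof
    show "K + K \<subseteq> K" using subgroup_hull_add[of _ K] assms by (auto elim!: set_plus_elim)
    show "K \<subseteq> K + K" using subgroup_hull.zero[of K] assms by (simp add: set_zero_plus2)
  qed
  then show ?thesis by (simp add: set_plus_rearrange)
qed

lemmas tensor_coset_eq_iff = coset_eq_iff[OF subgroup_tensor_null]
lemmas tensor3_coset_eqmod = coset_eqmod[OF _ subgroup_tensor3_null]
lemmas rep_tensor = rep_coset[OF subgroup_tensor_null]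
lemmas tensor_add = coset_add[OF subgroup_tensor_null]

lemma tensor_carrier_rep:
  "t \<in> tensor_carrier M Q ra la \<Longrightarrow> t = rep t +o tensor_null M Q ra la"
  unfolding tensor_carrier_def using coset_rep[OF subgroup_tensor_null] by fastforce

lemma keys_eqmod:
  assumes "x \<approx>\<^bsub>tensor_null M Q ra la\<^esub> y" "Poly_Mapping.keys y \<subseteq> M \<times> UNIV"
    and M: "\<And>m m'. m \<in> M \<Longrightarrow> m' \<in> M \<Longrightarrow> m + m' \<in> M" "\<And>m q. m \<in> M \<Longrightarrow> q \<in> Q \<Longrightarrow> ra m q \<in> M"
  shows "Poly_Mapping.keys x \<subseteq> M \<times> UNIV"
proof -
  have d: "Poly_Mapping.keys (u - v) \<subseteq> M \<times> UNIV"
    if "Poly_Mapping.keys u \<subseteq> M \<times> UNIV" "Poly_Mapping.keys v \<subseteq> M \<times> UNIV" for u v :: "'a \<times> 'b \<Rightarrow>\<^sub>0 int"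
    using that keys_diff[of u v] by blast
  have s: "Poly_Mapping.keys (frag_of p) \<subseteq> M \<times> UNIV" if "fst p \<in> M" for p :: "'a \<times> 'b"
    using that by (cases p) (auto simp: keys_frag_of)
  have "Poly_Mapping.keys z \<subseteq> M \<times> UNIV" if "z \<in> tensor_null M Q ra la" for z
    using that
  proof induction
    case zero
    then show ?case by simp
  next
    case (diff x y)
    then show ?case by (intro d)
  next
    case (add1 m m' n)
    then show ?case by (intro d s) (simp_all add: M)
  next
    case (add2 m n n')
    then show ?case by (intro d s) simp_all
  next
    case (balanced m q n)
    then show ?case by (intro d s) (simp_all add: M)
  qed
  then have "Poly_Mapping.keys (y - x) \<subseteq> M \<times> UNIV"
    using eqmod_sym[OF assms(1)] by (simp add: eqmod_def subgroup_tensor_null)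
  then have "Poly_Mapping.keys (y - (y - x)) \<subseteq> M \<times> UNIV" by (rule d[OF assms(2)])
  moreover have "y - (y - x) = x" by (rule diff_diff_eq2[THEN trans]) (simp add: add.commute)
  ultimately show ?thesis by metis
qed

lemma rep_keys:
  assumes "t \<in> tensor_carrier M Q ra la"
    and M: "\<And>m m'. m \<in> M \<Longrightarrow> m' \<in> M \<Longrightarrow> m + m' \<in> M" "\<And>m q. m \<in> M \<Longrightarrow> q \<in> Q \<Longrightarrow> ra m q \<in> M"
  shows "Poly_Mapping.keys (rep t) \<subseteq> M \<times> UNIV"
proof -
  obtain x where x: "t = x +o tensor_null M Q ra la" "Poly_Mapping.keys x \<subseteq> M \<times> UNIV"
    using assms(1) by (auto simp: tensor_carrier_def)
  have "rep t \<approx>\<^bsub>tensor_null M Q ra la\<^esub> x" unfolding x(1) by (rule rep_tensor)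
  then show ?thesis by (rule keys_eqmod) (use x M in simp_all)
qed

lemma frag_tensor_add1:
  "m \<in> M \<Longrightarrow> m' \<in> M \<Longrightarrow> frag_of (m + m', n) \<approx>\<^bsub>tensor_null M Q ra la\<^esub> frag_of (m, n) + frag_of (m', n)"
  by (intro eqmod_diffI tensor_null.add1)

lemma frag_tensor_add2:
  "m \<in> M \<Longrightarrow> frag_of (m, n + n') \<approx>\<^bsub>tensor_null M Q ra la\<^esub> frag_of (m, n) + frag_of (m, n')"
  by (intro eqmod_diffI tensor_null.add2)

lemma frag_tensor_balanced:
  "m \<in> M \<Longrightarrow> q \<in> Q \<Longrightarrow> frag_of (ra m q, n) \<approx>\<^bsub>tensor_null M Q ra la\<^esub> frag_of (m, la q n)"
  by (intro eqmodI tensor_null.balanced)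

text \<open>Independence of the representative that \<open>sweedler\<close> chooses.\<close>

lemma sweedler_coset:
  assumes "balanced M Q ra la K F" "t = x +o tensor_null M Q ra la"
  shows "sweedler (\<lambda>(a, b). F a b) t \<approx>\<^bsub>K\<^esub> lext (\<lambda>(a, b). F a b) x"
  unfolding sweedler_eq_lext by (rule lext_balanced[OF assms(1)]) (simp add: assms(2) rep_tensor)

lemma sweedler_frag:
  assumes "balanced M Q ra la K F" "t = frag_of (a, b) +o tensor_null M Q ra la"
  shows "sweedler (\<lambda>(a, b). F a b) t \<approx>\<^bsub>K\<^esub> F a b"
  using sweedler_coset[OF assms] by simp

lemma sweedler_tens_map:
  assumes "balanced M Q ra la K F" "t' = tens_map (tensor_null M Q ra la) g t"
  shows "sweedler (\<lambda>(a, b). F a b) t' \<approx>\<^bsub>K\<^esub> sweedler (\<lambda>p. case g p of (a, b) \<Rightarrow> F a b) t"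
  using sweedler_coset[OF assms(1) assms(2)[unfolded tens_map_def]]
  by (simp add: frag_map_eq_lext lext_lext sweedler_eq_lext)

lemma sweedler_tens_mult:
  assumes "balanced M Q ra la K F" "t' = tens_mult (tensor_null M Q ra la) t u"
  shows "sweedler (\<lambda>(a, b). F a b) t' \<approx>\<^bsub>K\<^esub>
    sweedler (\<lambda>(c, d). sweedler (\<lambda>(a, b). F (a * c) (b * d)) t) u"
  using sweedler_coset[OF assms(1) assms(2)[unfolded tens_mult_def induced_def]]
  by (simp add: frag_map_eq_lext frag_extend_eq_lext lext_lext sweedler_eq_lext case_prod_unfold)

lemma sweedler_plus:
  assumes "balanced M Q ra la K F" "t = t1 + t2"
    and "t1 \<in> tensor_carrier M Q ra la" "t2 \<in> tensor_carrier M Q ra la"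
  shows "sweedler (\<lambda>(a, b). F a b) t \<approx>\<^bsub>K\<^esub> sweedler (\<lambda>(a, b). F a b) t1 + sweedler (\<lambda>(a, b). F a b) t2"
proof -
  have "t = (rep t1 + rep t2) +o tensor_null M Q ra la"
    using tensor_carrier_rep[OF assms(3)] tensor_carrier_rep[OF assms(4)] assms(2) tensor_add by metis
  from sweedler_coset[OF assms(1) this] show ?thesis by (simp add: lext_add sweedler_eq_lext)
qed

text \<open>Turns an equality of threefold cosets, the form of every coassociativity axiom, into an
  exchange rule for nested Sweedler sums.\<close>

lemma sweedler_tens_fst_snd:
  assumes "balanced3 M ra la ra' la' K F"
    and "tens_fst (tensor3_null M ra la ra' la') f t = tens_snd (tensor3_null M ra la ra' la') g u"
  shows "sweedler (\<lambda>(m, n). sweedler (\<lambda>(a, b). F a b n) (f m)) t \<approx>\<^bsub>K\<^esub>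
    sweedler (\<lambda>(m, n). sweedler (\<lambda>(a, b). F m a b) (g n)) u"
  using lext_balanced3[OF assms(1) tensor3_coset_eqmod[OF assms(2)[unfolded tens_fst_def tens_snd_def induced_def]]]
  by (simp add: frag_map_eq_lext frag_extend_eq_lext lext_lext sweedler_eq_lext case_prod_unfold)

section \<open>Sweedler calculus in a Hopf algebroid\<close>

context hopf_algebroid
begin

sublocale lb: left_bialgebroid "scale\<^sub>H \<H>" "scale\<^sub>L \<H>" "s\<^sub>L \<H>" "t\<^sub>L \<H>" "\<gamma>\<^sub>L \<H>" "\<pi>\<^sub>L \<H>"
  by (rule left)

sublocale rb: right_bialgebroid "scale\<^sub>H \<H>" "scale\<^sub>R \<H>" "s\<^sub>R \<H>" "t\<^sub>R \<H>" "\<gamma>\<^sub>R \<H>" "\<pi>\<^sub>R \<H>"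
  by (rule right)

abbreviation sL where "sL \<equiv> s\<^sub>L \<H>"
abbreviation tL where "tL \<equiv> t\<^sub>L \<H>"
abbreviation sR where "sR \<equiv> s\<^sub>R \<H>"
abbreviation tR where "tR \<equiv> t\<^sub>R \<H>"
abbreviation gL where "gL \<equiv> \<gamma>\<^sub>L \<H>"
abbreviation gR where "gR \<equiv> \<gamma>\<^sub>R \<H>"
abbreviation piL where "piL \<equiv> \<pi>\<^sub>L \<H>"
abbreviation piR where "piR \<equiv> \<pi>\<^sub>R \<H>"
abbreviation S where "S \<equiv> antipode \<H>"

abbreviation "balL K F \<equiv> balanced UNIV UNIV (\<lambda>h l. tL l * h) (\<lambda>l h. sL l * h) K F"
abbreviation "balR K F \<equiv> balanced UNIV UNIV (\<lambda>h r. h * sR r) (\<lambda>r h. h * tR r) K F"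

lemma sL_one [simp]: "sL 1 = 1"
  using lb.source by (auto simp: algebra_map_def k_linear_def)

lemma tL_one [simp]: "tL 1 = 1"
  using lb.target by (auto simp: algebra_antimap_def k_linear_def)

lemma sR_one [simp]: "sR 1 = 1"
  using rb.source by (auto simp: algebra_map_def k_linear_def)

lemma tR_one [simp]: "tR 1 = 1" and tR_mult: "tR (l * l') = tR l' * tR l" and tR_add: "tR (l + l') = tR l + tR l'"
  using rb.target by (auto simp: algebra_antimap_def k_linear_def)

lemma S_add: "S (x + y) = S x + S y"
  using antipode_linear by (auto simp: k_linear_def)

lemma S_tL: "S (tL l * h) = S h * sL l" and S_tR_right: "S (h * tR r) = sR r * S h"
  and S_tL_right: "S (h * tL l) = sL l * S h"
  using antipode_twist1[of l h 1] antipode_twist1[of 1 h r] antipode_twist2[of 1 h l] by simp_all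

text \<open>\<open>tR r\<close> lies in the image of \<open>sL\<close>, which commutes with the
  image of \<open>tL\<close>.\<close>

lemma tR_tL_commute: "tR r * tL l = tL l * tR r"
  using lb.commute[of "piL (tR r)" l] by (simp add: sL_piL_tR)

lemma piL_lin: "piL (sL l * h) = l * piL h" "piL (tL l * h) = piL h * l"
  using lb.counit_bimodule[of l 1 h] lb.counit_bimodule[of 1 l h] by simp_all

lemma piR_lin: "piR (h * sR r) = piR h * r" "piR (h * tR r) = r * piR h"
  using rb.counit_bimodule[of h r 1] rb.counit_bimodule[of h 1 r] by simp_all

lemma piR_sR [simp]: "piR (sR r) = r" and piR_tR [simp]: "piR (tR r) = r"
  using piR_lin[of 1 r] by (simp_all add: rb.counit_one)

text \<open>The axiom \<open>counit_mult_t\<close> at the element \<open>sR r\<close>, whose counit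
  is \<open>r\<close>.\<close>

lemma piR_tR_left: "piR (tR r * h) = piR (sR r * h)"
  using rb.counit_mult_s[of "sR r" h] rb.counit_mult_t[of "sR r" h] by simp

lemma gL_add: "balL K F \<Longrightarrow> sweedler (\<lambda>(a, b). F a b) (gL (h + h')) \<approx>\<^bsub>K\<^esub>
    sweedler (\<lambda>(a, b). F a b) (gL h) + sweedler (\<lambda>(a, b). F a b) (gL h')"
  by (erule sweedler_plus) (rule lb.comult_add lb.comult_closed)+

lemma gR_add: "balR K F \<Longrightarrow> sweedler (\<lambda>(a, b). F a b) (gR (h + h')) \<approx>\<^bsub>K\<^esub>
    sweedler (\<lambda>(a, b). F a b) (gR h) + sweedler (\<lambda>(a, b). F a b) (gR h')"
  by (erule sweedler_plus) (rule rb.comult_add rb.comult_closed)+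

lemma gL_lin:
  assumes "balL K F"
  shows "sweedler (\<lambda>(a, b). F a b) (gL (sL l * h)) \<approx>\<^bsub>K\<^esub> sweedler (\<lambda>(a, b). F (sL l * a) b) (gL h)"
    and "sweedler (\<lambda>(a, b). F a b) (gL (tL l * h)) \<approx>\<^bsub>K\<^esub> sweedler (\<lambda>(a, b). F a (tL l * b)) (gL h)"
  using sweedler_tens_map[OF assms lb.comult_bimodule[of l 1 h, unfolded HH_L_null_def]]
    sweedler_tens_map[OF assms lb.comult_bimodule[of 1 l h, unfolded HH_L_null_def]]
  by (simp_all add: case_prod_unfold)

lemma gR_lin:
  assumes "balR K F"
  shows "sweedler (\<lambda>(a, b). F a b) (gR (h * sR r)) \<approx>\<^bsub>K\<^esub> sweedler (\<lambda>(a, b). F a (b * sR r)) (gR h)"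
    and "sweedler (\<lambda>(a, b). F a b) (gR (h * tR r)) \<approx>\<^bsub>K\<^esub> sweedler (\<lambda>(a, b). F (a * tR r) b) (gR h)"
  using sweedler_tens_map[OF assms rb.comult_bimodule[of h r 1, unfolded HH_R_null_def]]
    sweedler_tens_map[OF assms rb.comult_bimodule[of h 1 r, unfolded HH_R_null_def]]
  by (simp_all add: case_prod_unfold)

lemma gL_takeuchi:
  assumes "balL K F"
  shows "sweedler (\<lambda>(a, b). F (a * tL l) b) (gL h) \<approx>\<^bsub>K\<^esub> sweedler (\<lambda>(a, b). F a (b * sL l)) (gL h)"
proof -
  have "sweedler (\<lambda>(a, b). F (a * tL l) b) (gL h) \<approx>\<^bsub>K\<^esub>
    sweedler (\<lambda>(a, b). F a b) (tens_map (HH_L_null sL tL) (\<lambda>(a, b). (a * tL l, b)) (gL h))"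
    using sweedler_tens_map[OF assms refl, of "\<lambda>(a, b). (a * tL l, b)" "gL h"]
    by (simp add: case_prod_unfold HH_L_null_def eqmod_sym)
  also have "tens_map (HH_L_null sL tL) (\<lambda>(a, b). (a * tL l, b)) (gL h) =
      tens_map (HH_L_null sL tL) (\<lambda>(a, b). (a, b * sL l)) (gL h)"
    by (rule lb.takeuchi)
  also have "sweedler (\<lambda>(a, b). F a b) \<dots> \<approx>\<^bsub>K\<^esub> sweedler (\<lambda>(a, b). F a (b * sL l)) (gL h)"
    using sweedler_tens_map[OF assms refl, of "\<lambda>(a, b). (a, b * sL l)" "gL h"]
    by (simp add: case_prod_unfold HH_L_null_def)
  finally show ?thesis .
qed

lemma gR_takeuchi:
  assumes "balR K F"
  shows "sweedler (\<lambda>(a, b). F (sR r * a) b) (gR h) \<approx>\<^bsub>K\<^esub> sweedler (\<lambda>(a, b). F a (tR r * b)) (gR h)"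
proof -
  have "sweedler (\<lambda>(a, b). F (sR r * a) b) (gR h) \<approx>\<^bsub>K\<^esub>
    sweedler (\<lambda>(a, b). F a b) (tens_map (HH_R_null sR tR) (\<lambda>(a, b). (sR r * a, b)) (gR h))"
    using sweedler_tens_map[OF assms refl, of "\<lambda>(a, b). (sR r * a, b)" "gR h"]
    by (simp add: case_prod_unfold HH_R_null_def eqmod_sym)
  also have "tens_map (HH_R_null sR tR) (\<lambda>(a, b). (sR r * a, b)) (gR h) =
      tens_map (HH_R_null sR tR) (\<lambda>(a, b). (a, tR r * b)) (gR h)"
    by (rule rb.takeuchi)
  also have "sweedler (\<lambda>(a, b). F a b) \<dots> \<approx>\<^bsub>K\<^esub> sweedler (\<lambda>(a, b). F a (tR r * b)) (gR h)"
    using sweedler_tens_map[OF assms refl, of "\<lambda>(a, b). (a, tR r * b)" "gR h"]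
    by (simp add: case_prod_unfold HH_R_null_def)
  finally show ?thesis .
qed

lemma balL_shift: "balL K F \<Longrightarrow> balL K (\<lambda>a b. F (a * c) (b * d))"
  by (auto simp: balanced_def distrib_right mult.assoc)

lemma balR_shift: "balR K F \<Longrightarrow> balR K (\<lambda>a b. F (c * a) (d * b))"
  by (auto simp: balanced_def distrib_left mult.assoc[symmetric])

lemma sL_tL_left: "sL l * (tL l' * h) = tL l' * (sL l * h)"
  by (simp add: mult.assoc[symmetric] lb.commute)

lemma sR_tR_right: "h * sR r * tR r' = h * tR r' * sR r"
  by (simp add: mult.assoc rb.commute)

lemma balL_sL: "balL K F \<Longrightarrow> balL K (\<lambda>a b. F (sL l * a) b)"
  by (simp add: balanced_def distrib_left sL_tL_left)

lemma balR_tR: "balR K F \<Longrightarrow> balR K (\<lambda>a b. F (a * tR r) b)"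
  by (simp add: balanced_def distrib_right sR_tR_right)

text \<open>Compatibility of the left coproduct with the other base. Since
  \<open>tR r = sL l\<close>, multiplicativity gives the product of \<open>gL h\<close> with
  \<open>sL l \<otimes> 1\<close>.\<close>

lemma gL_tR:
  assumes F: "balL K F"
  shows "sweedler (\<lambda>(a, b). F a b) (gL (h * tR r)) \<approx>\<^bsub>K\<^esub> sweedler (\<lambda>(a, b). F (a * tR r) b) (gL h)"
proof -
  define l where "l = piL (tR r)"
  have l: "tR r = sL l" by (simp add: l_def sL_piL_tR)
  let ?G = "\<lambda>c d. sweedler (\<lambda>(a, b). F (a * c) (b * d)) (gL h)"
  \<comment> \<open>The right factor of the product varies here; its balancing is the Takeuchi axiom
    for the left factor \<open>gL h\<close>.\<close>
  have G: "balL K ?G"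
  proof (rule balancedI)
    fix c c' d show "?G (c + c') d \<approx>\<^bsub>K\<^esub> ?G c d + ?G c' d"
      unfolding sweedler_add[symmetric] using F by (intro sweedler_eqmod) (auto simp: distrib_left balanced_def)
  next
    fix c d d' show "?G c (d + d') \<approx>\<^bsub>K\<^esub> ?G c d + ?G c d'"
      unfolding sweedler_add[symmetric] using F by (intro sweedler_eqmod) (auto simp: distrib_left balanced_def)
  next
    fix c l d show "?G (tL l * c) d \<approx>\<^bsub>K\<^esub> ?G c (sL l * d)"
      using gL_takeuchi[OF balL_shift[OF F, of c d], of l h] by (simp add: mult.assoc)
  qed
  have "sweedler (\<lambda>(a, b). F a b) (gL (h * tR r)) \<approx>\<^bsub>K\<^esub> sweedler (\<lambda>(c, d). ?G c d) (gL (sL l * 1))"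
    using sweedler_tens_mult[OF F lb.comult_mult[of h "tR r", unfolded HH_L_null_def]] by (simp add: l)
  also have "\<dots> \<approx>\<^bsub>K\<^esub> sweedler (\<lambda>(c, d). ?G (sL l * c) d) (gL 1)"
    by (rule gL_lin(1)[OF G])
  also have "\<dots> \<approx>\<^bsub>K\<^esub> ?G (sL l * 1) 1"
    by (rule sweedler_frag[OF balL_sL[OF G] lb.comult_one[unfolded HH_L_null_def]])
  finally show ?thesis by (simp add: l)
qed

text \<open>Mirror image of \<open>gL_tR\<close>: \<open>sL l\<close> lies in the image of
  \<open>tR\<close>, and now the left factor of the product varies.\<close>

lemma gR_sL:
  assumes F: "balR K F"
  shows "sweedler (\<lambda>(a, b). F a b) (gR (sL l * h)) \<approx>\<^bsub>K\<^esub> sweedler (\<lambda>(a, b). F (sL l * a) b) (gR h)"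
proof -
  define r where "r = piR (sL l)"
  have r: "sL l = tR r" by (simp add: r_def tR_piR_sL)
  let ?G = "\<lambda>c d. sweedler (\<lambda>(a, b). F (c * a) (d * b)) (gR h)"
  have G: "balR K ?G"
  proof (rule balancedI)
    fix c c' d show "?G (c + c') d \<approx>\<^bsub>K\<^esub> ?G c d + ?G c' d"
      unfolding sweedler_add[symmetric] using F by (intro sweedler_eqmod) (auto simp: distrib_right balanced_def)
  next
    fix c d d' show "?G c (d + d') \<approx>\<^bsub>K\<^esub> ?G c d + ?G c d'"
      unfolding sweedler_add[symmetric] using F by (intro sweedler_eqmod) (auto simp: distrib_right balanced_def)
  next
    fix c l d show "?G (c * sR l) d \<approx>\<^bsub>K\<^esub> ?G c (d * tR l)"
      using gR_takeuchi[OF balR_shift[OF F, of c d], of l h] by (simp add: mult.assoc)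
  qed
  have "sweedler (\<lambda>(a, b). F a b) (gR (sL l * h)) \<approx>\<^bsub>K\<^esub> sweedler (\<lambda>(c, d). ?G c d) (gR (1 * tR r))"
    using sweedler_tens_mult[OF F rb.comult_mult[of "tR r" h, unfolded HH_R_null_def]]
    unfolding r sweedler_swap[of _ "gR h"] by simp
  also have "\<dots> \<approx>\<^bsub>K\<^esub> sweedler (\<lambda>(c, d). ?G (c * tR r) d) (gR 1)"
    by (rule gR_lin(2)[OF G])
  also have "\<dots> \<approx>\<^bsub>K\<^esub> ?G (1 * tR r) 1"
    by (rule sweedler_frag[OF balR_tR[OF G] rb.comult_one[unfolded HH_R_null_def]])
  finally show ?thesis by (simp add: r)
qed

lemma g_coassoc_LR:
  assumes "balanced3 UNIV (\<lambda>h l. tL l * h) (\<lambda>l h. sL l * h) (\<lambda>h r. h * sR r) (\<lambda>r h. h * tR r) K F"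
  shows "sweedler (\<lambda>(m, n). sweedler (\<lambda>(a, b). F a b n) (gL m)) (gR h) \<approx>\<^bsub>K\<^esub>
    sweedler (\<lambda>(m, n). sweedler (\<lambda>(a, b). F m a b) (gR n)) (gL h)"
  by (rule sweedler_tens_fst_snd[OF assms mixed_coassoc_LR[unfolded HHH_LR_null_def]])

lemma g_coassoc_RL:
  assumes "balanced3 UNIV (\<lambda>h r. h * sR r) (\<lambda>r h. h * tR r) (\<lambda>h l. tL l * h) (\<lambda>l h. sL l * h) K F"
  shows "sweedler (\<lambda>(m, n). sweedler (\<lambda>(a, b). F a b n) (gR m)) (gL h) \<approx>\<^bsub>K\<^esub>
    sweedler (\<lambda>(m, n). sweedler (\<lambda>(a, b). F m a b) (gL n)) (gR h)"
  by (rule sweedler_tens_fst_snd[OF assms mixed_coassoc_RL[unfolded HHH_RL_null_def]])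

end

section \<open>Comodule algebras and coinvariants\<close>

locale hopf_extension = hopf_algebroid \<H> + right_H_comodule_algebra \<H> \<A>
  for \<H> :: "('k::{comm_ring,comm_monoid_mult}, 'h::{ring,monoid_mult}, 'l::{ring,monoid_mult},
      'r::{ring,monoid_mult}) hopf_algebroid_data"
    and \<A> :: "('k, 'a::{ring,monoid_mult}, 'h, 'r) comodule_algebra_data"
begin

abbreviation etaR where "etaR \<equiv> \<eta>\<^sub>R \<A>"
text \<open>The right \<open>L\<close>-action of a comodule algebra, induced through
  \<open>R\<close>; distinct from the \<open>L\<close>-ring unit \<open>etaL\<close>. Values of
  \<open>etaL'\<close> commute with coinvariants, values of \<open>etaL\<close> are
  coinvariants.\<close>

abbreviation etaL' where "etaL' l \<equiv> etaR (piR (tL l))"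
abbreviation rR where "rR \<equiv> coact\<^sub>R \<A>"
abbreviation rL where "rL \<equiv> coact\<^sub>L \<A>"
abbreviation B where "B \<equiv> coinvariants \<H> \<A>"

abbreviation "NR \<equiv> tensor_null UNIV UNIV (\<lambda>a r. a * etaR r) (\<lambda>r h. h * tR r)"
abbreviation "NL \<equiv> tensor_null UNIV UNIV (\<lambda>a l. etaL' l * a) (\<lambda>l h. sL l * h)"
abbreviation "balAR K F \<equiv> balanced UNIV UNIV (\<lambda>a r. a * etaR r) (\<lambda>r h. h * tR r) K F"
abbreviation "balAL K F \<equiv> balanced UNIV UNIV (\<lambda>a l. etaL' l * a) (\<lambda>l h. sL l * h) K F"

lemma alg_comodule_simps [simp]:
  "carrier (alg_comodule \<H> \<A>) = UNIV" "actR (alg_comodule \<H> \<A>) = (\<lambda>a r. a * etaR r)"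
  "actL (alg_comodule \<H> \<A>) = (\<lambda>a l. etaL' l * a)"
  "\<rho>\<^sub>R (alg_comodule \<H> \<A>) = rR" "\<rho>\<^sub>L (alg_comodule \<H> \<A>) = rL"
  by (simp_all add: alg_comodule_def)

lemma alg_null_simps [simp]:
  "MH_R_null \<H> (alg_comodule \<H> \<A>) = NR" "MH_L_null \<H> (alg_comodule \<H> \<A>) = NL"
  "MH_R_tensor \<H> (alg_comodule \<H> \<A>) = tensor_carrier UNIV UNIV (\<lambda>a r. a * etaR r) (\<lambda>r h. h * tR r)"
  "MH_L_tensor \<H> (alg_comodule \<H> \<A>) = tensor_carrier UNIV UNIV (\<lambda>a l. etaL' l * a) (\<lambda>l h. sL l * h)"
  by (simp_all add: MH_R_null_def MH_L_null_def MH_R_tensor_def MH_L_tensor_def)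

lemma etaR_one [simp]: "etaR 1 = 1" and etaR_mult: "etaR (r * r') = etaR r * etaR r'"
  and etaR_add: "etaR (r + r') = etaR r + etaR r'" and etaR_scale: "etaR (scale\<^sub>R \<H> c r) = scale\<^sub>A \<A> c (etaR r)"
  using unit_map by (auto simp: algebra_map_def k_linear_def)

lemma rR_add: "balAR K F \<Longrightarrow> sweedler (\<lambda>(a, b). F a b) (rR (x + y)) \<approx>\<^bsub>K\<^esub>
    sweedler (\<lambda>(a, b). F a b) (rR x) + sweedler (\<lambda>(a, b). F a b) (rR y)"
  using coactR_add[of x y] coactR_closed[of x] coactR_closed[of y] by (intro sweedler_plus) auto

lemma rL_add: "balAL K F \<Longrightarrow> sweedler (\<lambda>(a, b). F a b) (rL (x + y)) \<approx>\<^bsub>K\<^esub>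
    sweedler (\<lambda>(a, b). F a b) (rL x) + sweedler (\<lambda>(a, b). F a b) (rL y)"
  using coactL_add[of x y] coactL_closed[of x] coactL_closed[of y] by (intro sweedler_plus) auto

lemma rR_rep: "rR a = rep (rR a) +o NR" and rL_rep: "rL a = rep (rL a) +o NL"
  using tensor_carrier_rep[OF coactR_closed[of a, simplified]]
    tensor_carrier_rep[OF coactL_closed[of a, simplified]] by simp_all

lemma rR_R:
  "balAR K F \<Longrightarrow> sweedler (\<lambda>(a, b). F a b) (rR (x * etaR r)) \<approx>\<^bsub>K\<^esub> sweedler (\<lambda>(a, b). F a (b * sR r)) (rR x)"
  using sweedler_tens_map[OF _ coactR_linear[of x r, simplified]] by (simp add: case_prod_unfold)

lemma rR_L:
  "balAR K F \<Longrightarrow> sweedler (\<lambda>(a, b). F a b) (rR (etaL' l * x)) \<approx>\<^bsub>K\<^esub> sweedler (\<lambda>(a, b). F a (tL l * b)) (rR x)"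
  using sweedler_tens_map[OF _ coactR_L_linear[of x l, simplified]] by (simp add: case_prod_unfold)

lemma rL_R:
  "balAL K F \<Longrightarrow> sweedler (\<lambda>(a, b). F a b) (rL (x * etaR r)) \<approx>\<^bsub>K\<^esub> sweedler (\<lambda>(a, b). F a (b * sR r)) (rL x)"
  using sweedler_tens_map[OF _ coactL_R_linear[of x r, simplified]] by (simp add: case_prod_unfold)

lemma rR_one: "balAR K F \<Longrightarrow> sweedler (\<lambda>(a, b). F a b) (rR 1) \<approx>\<^bsub>K\<^esub> F 1 1"
  using coactR_one by (auto intro: sweedler_frag)

lemma rR_mult: "balAR K F \<Longrightarrow> sweedler (\<lambda>(a, b). F a b) (rR (x * y)) \<approx>\<^bsub>K\<^esub>
    sweedler (\<lambda>(c, d). sweedler (\<lambda>(a, b). F (a * c) (b * d)) (rR x)) (rR y)"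
  using coactR_mult[of x y] by (auto intro: sweedler_tens_mult)

lemma rL_mult: "balAL K F \<Longrightarrow> sweedler (\<lambda>(a, b). F a b) (rL (x * y)) \<approx>\<^bsub>K\<^esub>
    sweedler (\<lambda>(c, d). sweedler (\<lambda>(a, b). F (a * c) (b * d)) (rL x)) (rL y)"
  using coactL_mult[of x y] by (auto intro: sweedler_tens_mult)

lemma rR_counit: "sweedler (\<lambda>(x, h). x * etaR (piR h)) (rR a) = a"
  using coactR_counit[of a] by simp

lemma rL_counit: "sweedler (\<lambda>(x, h). etaL' (piL h) * x) (rL a) = a"
  using coactL_counit[of a] by simp

lemma rR_coassoc:
  assumes "balanced3 UNIV (\<lambda>a r. a * etaR r) (\<lambda>r h. h * tR r) (\<lambda>h r. h * sR r) (\<lambda>r h. h * tR r) K F"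
  shows "sweedler (\<lambda>(m, n). sweedler (\<lambda>(a, b). F a b n) (rR m)) (rR x) \<approx>\<^bsub>K\<^esub>
    sweedler (\<lambda>(m, n). sweedler (\<lambda>(a, b). F m a b) (gR n)) (rR x)"
  using coactR_coassoc[of x] by (intro sweedler_tens_fst_snd[OF assms]) (simp add: MHH_RR_null_def)

lemma r_mixed_RL:
  assumes "balanced3 UNIV (\<lambda>a r. a * etaR r) (\<lambda>r h. h * tR r) (\<lambda>h l. tL l * h) (\<lambda>l h. sL l * h) K F"
  shows "sweedler (\<lambda>(m, n). sweedler (\<lambda>(a, b). F a b n) (rR m)) (rL x) \<approx>\<^bsub>K\<^esub>
    sweedler (\<lambda>(m, n). sweedler (\<lambda>(a, b). F m a b) (gL n)) (rR x)"
  using coact_mixed_RL[of x] by (intro sweedler_tens_fst_snd[OF assms]) (simp add: MHH_RL_null_def)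

lemma r_mixed_LR:
  assumes "balanced3 UNIV (\<lambda>a l. etaL' l * a) (\<lambda>l h. sL l * h) (\<lambda>h r. h * sR r) (\<lambda>r h. h * tR r) K F"
  shows "sweedler (\<lambda>(m, n). sweedler (\<lambda>(a, b). F a b n) (rL m)) (rR x) \<approx>\<^bsub>K\<^esub>
    sweedler (\<lambda>(m, n). sweedler (\<lambda>(a, b). F m a b) (gR n)) (rL x)"
  using coact_mixed_LR[of x] by (intro sweedler_tens_fst_snd[OF assms]) (simp add: MHH_LR_null_def)

text \<open>The left \<open>R\<close>-action is determined by the coaction, which forces the coaction into the
  Takeuchi product.\<close>

lemma rR_takeuchi:
  assumes F: "balAR K F"
  shows "sweedler (\<lambda>(x, h). F (etaR r * x) h) (rR a) \<approx>\<^bsub>K\<^esub> sweedler (\<lambda>(x, h). F x (tR r * h)) (rR a)"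
proof -
  note add = balanced_add[OF F] and bal = balanced_bal[OF F]
  \<comment> \<open>\<open>left_action\<close> expresses \<open>etaR r * x\<close> through the
    coaction of \<open>x\<close>. Coassociativity then moves the second component into a coproduct
    of \<open>H\<close>, where the Takeuchi axiom is available, and the counit removes the extra
    leg.\<close>
  have 1: "F (etaR r * x) h \<approx>\<^bsub>K\<^esub> sweedler (\<lambda>(y, k). F y (h * tR (piR (sR r * k)))) (rR x)" for x h
  proof -
    have "F (etaR r * x) h = F (sweedler (\<lambda>(y, k). y * etaR (piR (sR r * k))) (rR x)) h"
      by (simp add: left_action)
    also have "\<dots> \<approx>\<^bsub>K\<^esub> sweedler (\<lambda>(y, k). F (y * etaR (piR (sR r * k))) h) (rR x)"
      by (rule sweedler_hom_eqmod[of "\<lambda>z. F z h"]) (rule add)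
    also have "\<dots> \<approx>\<^bsub>K\<^esub> sweedler (\<lambda>(y, k). F y (h * tR (piR (sR r * k)))) (rR x)"
      by (rule sweedler_eqmod) (rule bal)
    finally show ?thesis .
  qed
  have 2: "balR K (\<lambda>k h. F y (h * tR (piR k)))" for y
    by (rule balancedI) (simp_all add: rb.counit_add tR_add distrib_left distrib_right add piR_lin tR_mult mult.assoc)
  have "sweedler (\<lambda>(x, h). F (etaR r * x) h) (rR a) \<approx>\<^bsub>K\<^esub>
      sweedler (\<lambda>(x, h). sweedler (\<lambda>(y, k). F y (h * tR (piR (sR r * k)))) (rR x)) (rR a)"
    by (rule sweedler_eqmod) (rule 1)
  also have "\<dots> \<approx>\<^bsub>K\<^esub> sweedler (\<lambda>(y, w). sweedler (\<lambda>(k, h). F y (h * tR (piR (sR r * k)))) (gR w)) (rR a)"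
  proof (rule rR_coassoc, rule balanced3I)
    fix m p n c
    show "F (m * etaR p) (c * tR (piR (sR r * n))) \<approx>\<^bsub>K\<^esub> F m (c * tR (piR (sR r * (n * tR p))))"
      using bal[of m p "c * tR (piR (sR r * n))"] by (simp add: mult.assoc[symmetric] piR_lin tR_mult)
  next
    fix m n q c
    show "F m (c * tR (piR (sR r * (n * sR q)))) \<approx>\<^bsub>K\<^esub> F m (c * tR q * tR (piR (sR r * n)))"
      by (simp add: mult.assoc[symmetric] piR_lin tR_mult)
  qed (simp_all add: rb.counit_add tR_add distrib_left distrib_right add)
  also have "\<dots> \<approx>\<^bsub>K\<^esub> sweedler (\<lambda>(y, w). sweedler (\<lambda>(k, h). F y (tR r * (h * tR (piR k)))) (gR w)) (rR a)"
    by (rule sweedler_eqmod) (use gR_takeuchi[OF 2] in \<open>simp add: mult.assoc\<close>)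
  also have "\<dots> \<approx>\<^bsub>K\<^esub> sweedler (\<lambda>(y, w). F y (tR r * w)) (rR a)"
  proof (rule sweedler_eqmod)
    fix y w
    have "F y (tR r * sweedler (\<lambda>(k, h). h * tR (piR k)) (gR w)) \<approx>\<^bsub>K\<^esub>
        sweedler (\<lambda>(k, h). F y (tR r * (h * tR (piR k)))) (gR w)"
      by (rule sweedler_hom_eqmod[of "\<lambda>z. F y (tR r * z)"]) (simp add: distrib_left add)
    then show "sweedler (\<lambda>(k, h). F y (tR r * (h * tR (piR k)))) (gR w) \<approx>\<^bsub>K\<^esub> F y (tR r * w)"
      by (simp add: rb.counit_left eqmod_sym)
  qed
  finally show ?thesis .
qed

section \<open>Coinvariants and linearity of both coactions over them\<close>

lemma rR_coinv: "b \<in> B \<Longrightarrow> balAR K F \<Longrightarrow> sweedler (\<lambda>(x, h). F x h) (rR b) \<approx>\<^bsub>K\<^esub> F b 1"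
  by (erule sweedler_frag) (simp add: coinvariants_def)

lemma coinvI:
  assumes "sweedler (\<lambda>(x, h). frag_of (x, h)) (rR b) \<approx>\<^bsub>NR\<^esub> frag_of (b, 1)"
  shows "b \<in> B"
proof -
  have "rep (rR b) +o NR = frag_of (b, 1) +o NR"
    using assms by (simp add: tensor_coset_eq_iff sweedler_eq_lext lext_frag case_prod_unfold)
  then show ?thesis using rR_rep[of b] by (simp add: coinvariants_def)
qed

text \<open>\<open>left_action\<close> evaluated on \<open>b \<otimes> 1\<close> gives
  \<open>b * etaR (piR (sR r))\<close>.\<close>

lemma coinv_etaR_commute:
  assumes "b \<in> B"
  shows "etaR r * b = b * etaR r"
proof -
  have "balAR {} (\<lambda>x h. x * etaR (piR (sR r * h)))"
    by (rule balancedI) (simp_all add: rb.counit_add etaR_add distrib_left distrib_right piR_lin etaR_mult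
      mult.assoc[symmetric])
  from rR_coinv[OF assms this] show ?thesis by (simp add: left_action[symmetric])
qed

lemma S_one: "S 1 = 1"
proof -
  have "balL {} (\<lambda>a b. S a * b)"
    by (rule balancedI) (simp_all add: S_add distrib_left distrib_right S_tL mult.assoc)
  from sweedler_frag[OF this lb.comult_one[unfolded HH_L_null_def]] antipode_left[of 1]
  show ?thesis by (simp add: rb.counit_one)
qed

text \<open>Coinvariance for the \<open>R\<close>-coaction implies coinvariance for the \<open>L\<close>-coaction, since the latter
  is recovered from the former through \<open>h\<^sup>1 S(h\<^sup>2) = s\<^sub>L (\<pi>\<^sub>L h)\<close>.\<close>

lemma rL_coinv:
  assumes b: "b \<in> B" and F: "balAL K F"
  shows "sweedler (\<lambda>(x, h). F x h) (rL b) \<approx>\<^bsub>K\<^esub> F b 1"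
proof -
  note add = balanced_add[OF F] and bal = balanced_bal[OF F]
  have FS: "balAL K (\<lambda>x h. F x (h * S n))" for n
    by (rule balancedI) (simp_all add: add distrib_right bal mult.assoc)
  \<comment> \<open>\<open>?G m n\<close> is \<open>F\<close> applied to \<open>rL m\<close> with
    \<open>S n\<close> multiplied onto the second component. Evaluated on \<open>rR b\<close>, that
    is on \<open>b \<otimes> 1\<close>, it yields the left-hand side; mixed coassociativity and the
    antipode axiom yield the right-hand side.\<close>
  let ?G = "\<lambda>m n. sweedler (\<lambda>(x, h). F x (h * S n)) (rL m)"
  have G: "balAR K ?G"
  proof (rule balancedI)
    fix m m' n show "?G (m + m') n \<approx>\<^bsub>K\<^esub> ?G m n + ?G m' n" by (rule rL_add[OF FS])
  next
    fix m n n' show "?G m (n + n') \<approx>\<^bsub>K\<^esub> ?G m n + ?G m n'"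
      unfolding sweedler_add[symmetric] by (rule sweedler_eqmod) (simp add: S_add distrib_left add)
  next
    fix m q n show "?G (m * etaR q) n \<approx>\<^bsub>K\<^esub> ?G m (n * tR q)"
      using rL_R[OF FS] by (simp add: S_tR_right mult.assoc)
  qed
  have "sweedler (\<lambda>(x, h). F x h) (rL b) = ?G b 1"
    by (simp add: S_one)
  also have "\<dots> \<approx>\<^bsub>K\<^esub> sweedler (\<lambda>(m, n). ?G m n) (rR b)"
    by (rule eqmod_sym[OF rR_coinv[OF b G]])
  also have "\<dots> \<approx>\<^bsub>K\<^esub> sweedler (\<lambda>(x, w). sweedler (\<lambda>(h, k). F x (h * S k)) (gR w)) (rL b)"
    by (rule r_mixed_LR, rule balanced3I)
      (simp_all add: add distrib_left distrib_right bal S_add mult.assoc S_tR_right)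
  also have "\<dots> \<approx>\<^bsub>K\<^esub> sweedler (\<lambda>(x, w). F (etaL' (piL w) * x) 1) (rL b)"
  proof (rule sweedler_eqmod)
    fix x w
    have "F x (sweedler (\<lambda>(h, k). h * S k) (gR w)) \<approx>\<^bsub>K\<^esub> sweedler (\<lambda>(h, k). F x (h * S k)) (gR w)"
      by (rule sweedler_hom_eqmod) (rule add)
    then have "sweedler (\<lambda>(h, k). F x (h * S k)) (gR w) \<approx>\<^bsub>K\<^esub> F x (sL (piL w) * 1)"
      by (simp add: antipode_right eqmod_sym)
    also have "\<dots> \<approx>\<^bsub>K\<^esub> F (etaL' (piL w) * x) 1" by (rule eqmod_sym[OF bal])
    finally show "sweedler (\<lambda>(h, k). F x (h * S k)) (gR w) \<approx>\<^bsub>K\<^esub> F (etaL' (piL w) * x) 1" .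
  qed
  also have "\<dots> \<approx>\<^bsub>K\<^esub> F (sweedler (\<lambda>(x, w). etaL' (piL w) * x) (rL b)) 1"
    by (rule eqmod_sym, rule sweedler_hom_eqmod[of "\<lambda>z. F z 1"]) (rule add)
  finally show ?thesis by (simp add: rL_counit)
qed

text \<open>Replacing \<open>rR b\<close> by \<open>b \<otimes> 1\<close> inside the product
  requires balancing in the left factor, which is \<open>rR_takeuchi\<close> for the right factor
  \<open>rR a\<close>.\<close>

lemma rR_mult_coinv:
  assumes b: "b \<in> B" and F: "balAR K F"
  shows "sweedler (\<lambda>(x, h). F x h) (rR (b * a)) \<approx>\<^bsub>K\<^esub> sweedler (\<lambda>(x, h). F (b * x) h) (rR a)"
proof -
  note add = balanced_add[OF F] and bal = balanced_bal[OF F]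
  have F': "balAR K (\<lambda>c d. F (u * c) (v * d))" for u v
    by (rule balancedI) (simp_all add: add distrib_left bal mult.assoc[symmetric])
  let ?G = "\<lambda>u v. sweedler (\<lambda>(c, d). F (u * c) (v * d)) (rR a)"
  have G: "balAR K ?G"
  proof (rule balancedI)
    fix m m' n show "?G (m + m') n \<approx>\<^bsub>K\<^esub> ?G m n + ?G m' n"
      unfolding sweedler_add[symmetric] by (rule sweedler_eqmod) (simp add: distrib_right add)
  next
    fix m n n' show "?G m (n + n') \<approx>\<^bsub>K\<^esub> ?G m n + ?G m n'"
      unfolding sweedler_add[symmetric] by (rule sweedler_eqmod) (simp add: distrib_right add)
  next
    fix m q n show "?G (m * etaR q) n \<approx>\<^bsub>K\<^esub> ?G m (n * tR q)"
      using rR_takeuchi[OF F'[of m n], of q a] by (simp add: mult.assoc)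
  qed
  have "sweedler (\<lambda>(x, h). F x h) (rR (b * a)) \<approx>\<^bsub>K\<^esub> sweedler (\<lambda>(u, v). ?G u v) (rR b)"
    using rR_mult[OF F, of b a] by (simp add: sweedler_swap[of _ "rR b"])
  also have "\<dots> \<approx>\<^bsub>K\<^esub> ?G b 1" by (rule rR_coinv[OF b G])
  finally show ?thesis by simp
qed

text \<open>Both balancings of \<open>NL\<close> multiply from the left, so right translates of a
  balanced map stay balanced and \<open>rL_coinv\<close> applies inside the sum over
  \<open>rL a\<close>.\<close>

lemma rL_mult_coinv:
  assumes b: "b \<in> B" and F: "balAL K F"
  shows "sweedler (\<lambda>(x, h). F x h) (rL (b * a)) \<approx>\<^bsub>K\<^esub> sweedler (\<lambda>(x, h). F (b * x) h) (rL a)"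
proof -
  note add = balanced_add[OF F] and bal = balanced_bal[OF F]
  have F': "balAL K (\<lambda>u v. F (u * c) (v * d))" for c d
    by (rule balancedI) (simp_all add: add distrib_right bal mult.assoc)
  note rL_mult[OF F, of b a]
  also have "sweedler (\<lambda>(c, d). sweedler (\<lambda>(u, v). F (u * c) (v * d)) (rL b)) (rL a) \<approx>\<^bsub>K\<^esub>
      sweedler (\<lambda>(x, h). F (b * x) h) (rL a)"
    using rL_coinv[OF b F'] by (intro sweedler_eqmod) simp
  finally show ?thesis .
qed

lemma NR_add: "frag_of (x + y, h) \<approx>\<^bsub>NR\<^esub> frag_of (x, h) + frag_of (y, h)"
    "frag_of (x, h + k) \<approx>\<^bsub>NR\<^esub> frag_of (x, h) + frag_of (x, k)"
  and NR_bal: "frag_of (x * etaR r, h) \<approx>\<^bsub>NR\<^esub> frag_of (x, h * tR r)"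
  by (intro frag_tensor_add1 frag_tensor_add2 frag_tensor_balanced; simp)+

lemma NL_add: "frag_of (x + y, h) \<approx>\<^bsub>NL\<^esub> frag_of (x, h) + frag_of (y, h)"
    "frag_of (x, h + k) \<approx>\<^bsub>NL\<^esub> frag_of (x, h) + frag_of (x, k)"
  and NL_bal: "frag_of (etaL' l * x, h) \<approx>\<^bsub>NL\<^esub> frag_of (x, sL l * h)"
  by (intro frag_tensor_add1 frag_tensor_add2; simp)+
    (rule frag_tensor_balanced[where ra = "\<lambda>x l. etaL' l * x"]; simp)

text \<open>Evaluating with \<open>frag_of\<close> into \<open>NR\<close> itself turns Sweedler
  identities back into congruences of representatives; \<open>a\<close> and \<open>k\<close> provide
  for left multiplication.\<close>

lemma balAR_frag: "balAR NR (\<lambda>x h. frag_of (a * x, k * h))"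
  by (rule balancedI) (simp_all add: NR_add NR_bal distrib_left mult.assoc[symmetric])

lemma balAL_frag: "balAL NL (\<lambda>x h. frag_of (x, h))"
  by (rule balancedI) (simp_all add: NL_add NL_bal)

lemma B_one: "1 \<in> B"
  using coactR_one by (simp add: coinvariants_def)

lemma B_add:
  assumes "b \<in> B" "b' \<in> B"
  shows "b + b' \<in> B"
proof (rule coinvI)
  note F = balAR_frag[of 1 1, simplified]
  note rR_add[OF F, of b b']
  also have "sweedler (\<lambda>(x, h). frag_of (x, h)) (rR b) + sweedler (\<lambda>(x, h). frag_of (x, h)) (rR b')
    \<approx>\<^bsub>NR\<^esub> frag_of (b, 1) + frag_of (b', 1)"
    by (intro eqmod_add rR_coinv assms F)
  also have "\<dots> \<approx>\<^bsub>NR\<^esub> frag_of (b + b', 1)" by (rule eqmod_sym[OF NR_add(1)])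
  finally show "sweedler (\<lambda>(x, h). frag_of (x, h)) (rR (b + b')) \<approx>\<^bsub>NR\<^esub> frag_of (b + b', 1)" .
qed

lemma B_mult:
  assumes "b \<in> B" "b' \<in> B"
  shows "b * b' \<in> B"
proof (rule coinvI)
  note rR_mult_coinv[OF assms(1) balAR_frag[of 1 1, simplified], of b']
  also have "sweedler (\<lambda>(x, h). frag_of (b * x, h)) (rR b') \<approx>\<^bsub>NR\<^esub> frag_of (b * b', 1)"
    by (rule rR_coinv[OF assms(2) balAR_frag[of b 1, simplified]])
  finally show "sweedler (\<lambda>(x, h). frag_of (x, h)) (rR (b * b')) \<approx>\<^bsub>NR\<^esub> frag_of (b * b', 1)" .
qed

end

context hopf_extension
begin

lemma balAR_left: "balAR K F \<Longrightarrow> balAR K (\<lambda>c d. F (x * c) (y * d))"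
  by (simp add: balanced_def distrib_left mult.assoc[symmetric])

end

section \<open>Cleaving maps\<close>

locale L_ring_extension = hopf_extension \<H> \<A>
  for \<H> :: "('k::{comm_ring,comm_monoid_mult}, 'h::{ring,monoid_mult}, 'l::{ring,monoid_mult},
      'r::{ring,monoid_mult}) hopf_algebroid_data"
    and \<A> :: "('k, 'a::{ring,monoid_mult}, 'h, 'r) comodule_algebra_data" +
  fixes etaL :: "'l \<Rightarrow> 'a"
  assumes L_ring: "L_ring_unit \<H> \<A> B etaL"
begin

lemma etaL_one [simp]: "etaL 1 = 1" and etaL_mult: "etaL (x * y) = etaL x * etaL y"
  and etaL_add: "etaL (x + y) = etaL x + etaL y" and etaL_B: "etaL x \<in> B"
  using L_ring by (auto simp: L_ring_unit_def algebra_map_def k_linear_def)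

lemma etaR_etaL_commute: "etaR r * etaL l = etaL l * etaR r"
  by (rule coinv_etaR_commute[OF etaL_B])

end

text \<open>A cleaving map without its inverse, the common ground of both directions: the inverse is
  given in \<open>cleft_datum\<close> and constructed in \<open>galois_BH_datum\<close>.\<close>

locale colinear_datum = L_ring_extension \<H> \<A> etaL
  for \<H> :: "('k::{comm_ring,comm_monoid_mult}, 'h::{ring,monoid_mult}, 'l::{ring,monoid_mult},
      'r::{ring,monoid_mult}) hopf_algebroid_data"
    and \<A> :: "('k, 'a::{ring,monoid_mult}, 'h, 'r) comodule_algebra_data" and etaL +
  fixes j :: "'h \<Rightarrow> 'a"
  assumes j_sL: "j (sL l * h) = etaL l * j h"
    and j_comodule_map: "comodule_map \<H> (regular_comodule \<H>) (alg_comodule \<H> \<A>) j"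
begin

lemma j_add: "j (x + y) = j x + j y" and j_sR: "j (h * sR r) = j h * etaR r"
  and j_tL: "j (tL l * h) = etaL' l * j h"
  and j_coact: "rR (j h) = tens_map NR (map_prod j id) (gR h)" "rL (j h) = tens_map NL (map_prod j id) (gL h)"
  using j_comodule_map by (simp_all add: comodule_map_def regular_comodule_def)

lemma rR_j: "balAR K F \<Longrightarrow> sweedler (\<lambda>(x, h). F x h) (rR (j h)) \<approx>\<^bsub>K\<^esub> sweedler (\<lambda>(x, h). F (j x) h) (gR h)"
  using sweedler_tens_map[OF _ j_coact(1)] by (simp add: case_prod_unfold)

lemma rL_j: "balAL K F \<Longrightarrow> sweedler (\<lambda>(x, h). F x h) (rL (j h)) \<approx>\<^bsub>K\<^esub> sweedler (\<lambda>(x, h). F (j x) h) (gL h)"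
  using sweedler_tens_map[OF _ j_coact(2)] by (simp add: case_prod_unfold)

text \<open>\<open>sR r\<close> equals \<open>tL (piL (sR r))\<close>, so this is an instance of the
  right \<open>L\<close>-linearity of \<open>j\<close>.\<close>

lemma j_etaR: "etaR r * j h = j (sR r * h)"
  using j_tL[of "piL (sR r)" h] by (simp add: tL_piL_sR)

end

locale cleft_datum = colinear_datum \<H> \<A> etaL j
  for \<H> :: "('k::{comm_ring,comm_monoid_mult}, 'h::{ring,monoid_mult}, 'l::{ring,monoid_mult},
      'r::{ring,monoid_mult}) hopf_algebroid_data"
    and \<A> :: "('k, 'a::{ring,monoid_mult}, 'h, 'r) comodule_algebra_data" and etaL j +
  fixes jc :: "'h \<Rightarrow> 'a"
  assumes jc_inverse: "convolution_inverse \<H> \<A> etaL j jc"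
begin

lemma jc_add: "jc (x + y) = jc x + jc y"
  and j_jc: "sweedler (\<lambda>(a, b). j a * jc b) (gR h) = etaL (piL h)"
  and jc_j: "sweedler (\<lambda>(a, b). jc a * j b) (gL h) = etaR (piR h)"
  using jc_inverse by (auto simp: convolution_inverse_def k_linear_def)

lemma jc_tL: "jc (tL l * h) = jc h * etaL l" and jc_tR_right: "jc (h * tR r) = etaR r * jc h"
proof -
  have *: "jc (tL l * h * tR r) = etaR r * jc h * etaL l" for l h r
    using jc_inverse by (auto simp: convolution_inverse_def)
  show "jc (tL l * h) = jc h * etaL l" "jc (h * tR r) = etaR r * jc h"
    using *[of l h 1] *[of 1 h r] by simp_all
qed

lemma sum_etaL_piL:
  assumes "\<And>x y. g (x + y) = g x + g y" "\<And>l h. g (tL l * h) = g h * etaL l"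
  shows "g h = sweedler (\<lambda>(a, b). g a * etaL (piL b)) (gL h)"
proof -
  have "g h = g (sweedler (\<lambda>(a, b). tL (piL b) * a) (gL h))" by (simp add: lb.counit_right)
  also have "\<dots> = sweedler (\<lambda>(a, b). g (tL (piL b) * a)) (gL h)"
    by (rule sweedler_hom) (rule assms)
  finally show ?thesis by (simp add: assms)
qed

text \<open>Associativity of convolution: \<open>g\<close> convolved with \<open>j\<close> and then
  with \<open>jc\<close> is \<open>g\<close> again, because \<open>j\<close> convolved with
  \<open>jc\<close> is the counit. So \<open>g\<close> is determined by its convolution with
  \<open>j\<close>.\<close>

lemma convolution_cancel:
  assumes g: "\<And>x y. g (x + y) = g x + g y" "\<And>l h. g (tL l * h) = g h * etaL l"
  shows "g h = sweedler (\<lambda>(m, n). sweedler (\<lambda>(a, b). g a * j b) (gL m) * jc n) (gR h)"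
proof -
  have "g h = sweedler (\<lambda>(a, b). sweedler (\<lambda>(c, d). g a * j c * jc d) (gR b)) (gL h)"
    by (subst sum_etaL_piL[of g, OF g]) (simp add: j_jc[symmetric] sweedler_mult_left mult.assoc)
  also have "\<dots> = sweedler (\<lambda>(m, n). sweedler (\<lambda>(a, b). g a * j b * jc n) (gL m)) (gR h)"
    using g_coassoc_LR[of "{}" "\<lambda>a b c. g a * j b * jc c" h]
    by (simp add: balanced3_def g jc_add j_add distrib_left distrib_right j_sL j_sR jc_tR_right mult.assoc)
  finally show ?thesis by (simp add: sweedler_mult_right)
qed

lemma balL_jc_j: "balL {} (\<lambda>a b. jc a * j b)"
  by (rule balancedI) (simp_all add: jc_add j_add distrib_left distrib_right jc_tL j_sL mult.assoc)

text \<open>As functions of \<open>h\<close>, both sides have the same convolution with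
  \<open>j\<close>, namely \<open>etaR (piR (tR r * h))\<close>, so
  \<open>convolution_cancel\<close> identifies them. The rule is what makes
  \<open>jc b \<otimes> S a\<close> balanced over \<open>L\<close>.\<close>

lemma jc_tR: "jc (tR r * h) = jc h * etaR r"
proof -
  define l l' where "l = piL (tR r)" and "l' = piL (sR r)"
  have l: "tR r = sL l" and l': "sR r = tL l'" by (simp_all add: l_def l'_def sL_piL_tR tL_piL_sR)
  have 1: "sweedler (\<lambda>(a, b). jc (tR r * a) * j b) (gL m) = etaR (piR (tR r * m))" for m
    using gL_lin(1)[OF balL_jc_j, of l m] by (simp add: l jc_j)
  \<comment> \<open>Here \<open>etaR r\<close> is absorbed by \<open>j\<close> as a left factor
    \<open>sR r = tL l'\<close>; \<open>piR\<close> does not distinguish left factors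
    \<open>sR r\<close> and \<open>tR r\<close>.\<close>
  have 2: "sweedler (\<lambda>(a, b). jc a * etaR r * j b) (gL m) = etaR (piR (tR r * m))" for m
    using gL_lin(2)[OF balL_jc_j, of l' m] by (simp add: piR_tR_left mult.assoc j_etaR jc_j l')
  have "jc (tR r * h) = sweedler (\<lambda>(m, n). sweedler (\<lambda>(a, b). jc (tR r * a) * j b) (gL m) * jc n) (gR h)"
    by (rule convolution_cancel[of "\<lambda>h. jc (tR r * h)"])
      (simp_all add: distrib_left jc_add mult.assoc[symmetric] tR_tL_commute, simp add: jc_tL mult.assoc)
  also have "\<dots> = sweedler (\<lambda>(m, n). sweedler (\<lambda>(a, b). jc a * etaR r * j b) (gL m) * jc n) (gR h)"
    by (simp add: 1 2)
  also have "\<dots> = jc h * etaR r"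
    by (rule convolution_cancel[of "\<lambda>h. jc h * etaR r", symmetric])
      (simp_all add: distrib_right jc_add jc_tL mult.assoc etaR_etaL_commute)
  finally show ?thesis .
qed

lemma jc_sL: "jc (sL l * h) = jc h * etaR (piR (sL l))"
  using jc_tR[of "piR (sL l)" h] by (simp add: tR_piR_sL)

text \<open>The right coaction on \<open>j\<^sub>c\<close> will turn out to be \<open>h \<mapsto> j\<^sub>c(h\<^sub>2) \<otimes> S(h\<^sub>1)\<close>;
  \<open>conv F m z\<close> below is \<open>F\<close> applied to \<open>\<rho>\<^sub>R(m) \<cdot> (j\<^sub>c(z\<^sub>2) \<otimes> S(z\<^sub>1))\<close>.\<close>

lemma balL_jc_S:
  assumes F: "balAR K F"
  shows "balL K (\<lambda>a b. F (jc b) (S a))"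
proof -
  note add = balanced_add[OF F] and bal = balanced_bal[OF F]
  have "F (jc n * etaR (piR (sL q))) (S m) \<approx>\<^bsub>K\<^esub> F (jc n) (S m * sL q)" for m q n
    using bal[of "jc n" "piR (sL q)" "S m"] by (simp add: tR_piR_sL)
  then show ?thesis
    by (intro balancedI) (simp_all add: add S_add jc_add S_tL jc_sL eqmod_sym)
qed

text \<open>The Takeuchi axiom of \<open>gL\<close> for \<open>tR r = sL l\<close>: \<open>S\<close>
  turns a right factor \<open>tL l\<close> into a left factor \<open>sL l\<close>, and
  \<open>jc\<close> turns a right factor \<open>tR r\<close> into a left factor
  \<open>etaR r\<close>. The candidate coaction may thus be a right factor.\<close>

lemma jc_S_takeuchi:
  assumes F: "balAR K F"
  shows "sweedler (\<lambda>(a, b). F (etaR r * jc b) (S a)) (gL z) \<approx>\<^bsub>K\<^esub>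
    sweedler (\<lambda>(a, b). F (jc b) (tR r * S a)) (gL z)"
proof -
  define l where "l = piL (tR r)"
  have l: "tR r = sL l" by (simp add: l_def sL_piL_tR)
  show ?thesis
    using eqmod_sym[OF gL_takeuchi[OF balL_jc_S[OF F], of l z]]
    by (simp add: S_tL_right flip: l) (simp add: jc_tR_right)
qed

definition conv :: "('a \<Rightarrow> 'h \<Rightarrow> 'g::ab_group_add) \<Rightarrow> 'a \<Rightarrow> 'h \<Rightarrow> 'g" where
  "conv F m z = sweedler (\<lambda>(u, v). sweedler (\<lambda>(a, b). F (u * jc b) (v * S a)) (gL z)) (rR m)"

lemma balAR_inner:
  assumes F: "balAR K F"
  shows "balAR K (\<lambda>u v. sweedler (\<lambda>(a, b). F (u * jc b) (v * S a)) (gL z))" (is "balAR K ?G")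
proof -
  note add = balanced_add[OF F]
  show ?thesis
  proof (rule balancedI)
    fix m m' n show "?G (m + m') n \<approx>\<^bsub>K\<^esub> ?G m n + ?G m' n"
      unfolding sweedler_add[symmetric] by (rule sweedler_eqmod) (simp add: distrib_right add)
  next
    fix m n n' show "?G m (n + n') \<approx>\<^bsub>K\<^esub> ?G m n + ?G m n'"
      unfolding sweedler_add[symmetric] by (rule sweedler_eqmod) (simp add: distrib_right add)
  next
    fix m q n show "?G (m * etaR q) n \<approx>\<^bsub>K\<^esub> ?G m (n * tR q)"
      using jc_S_takeuchi[OF balAR_left[OF F, of m n], of q z] by (simp add: mult.assoc)
  qed
qed

lemma balL_inner: "balAR K F \<Longrightarrow> balL K (\<lambda>a b. F (u * jc b) (v * S a))"
  by (rule balL_jc_S[OF balAR_left])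

text \<open>\<open>tR r\<close> enters the first leg of the coproduct and \<open>S\<close> converts
  it to a left factor \<open>sR r\<close>. This matches the \<open>R\<close>-linearity of
  \<open>rR\<close> and makes \<open>conv\<close> balanced.\<close>

lemma inner_tR:
  assumes F: "balAR K F"
  shows "sweedler (\<lambda>(a, b). F (u * jc b) (v * S a)) (gL (z * tR r)) \<approx>\<^bsub>K\<^esub>
    sweedler (\<lambda>(a, b). F (u * jc b) (v * sR r * S a)) (gL z)"
  using gL_tR[OF balL_inner[OF F]] by (simp add: S_tR_right mult.assoc)

lemma balAR_conv:
  assumes F: "balAR K F"
  shows "balAR K (conv F)"
  unfolding conv_def
proof (rule balancedI)
  fix m m' n
  show "sweedler (\<lambda>(u, v). sweedler (\<lambda>(a, b). F (u * jc b) (v * S a)) (gL n)) (rR (m + m')) \<approx>\<^bsub>K\<^esub>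
    sweedler (\<lambda>(u, v). sweedler (\<lambda>(a, b). F (u * jc b) (v * S a)) (gL n)) (rR m) +
    sweedler (\<lambda>(u, v). sweedler (\<lambda>(a, b). F (u * jc b) (v * S a)) (gL n)) (rR m')"
    by (rule rR_add[OF balAR_inner[OF F]])
next
  fix m n n'
  show "sweedler (\<lambda>(u, v). sweedler (\<lambda>(a, b). F (u * jc b) (v * S a)) (gL (n + n'))) (rR m) \<approx>\<^bsub>K\<^esub>
    sweedler (\<lambda>(u, v). sweedler (\<lambda>(a, b). F (u * jc b) (v * S a)) (gL n)) (rR m) +
    sweedler (\<lambda>(u, v). sweedler (\<lambda>(a, b). F (u * jc b) (v * S a)) (gL n')) (rR m)"
    unfolding sweedler_add[symmetric, where t = "rR m"]
    by (rule sweedler_eqmod) (rule gL_add[OF balL_inner[OF F]])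
next
  fix m q n
  have "sweedler (\<lambda>(u, v). sweedler (\<lambda>(a, b). F (u * jc b) (v * S a)) (gL n)) (rR (m * etaR q)) \<approx>\<^bsub>K\<^esub>
      sweedler (\<lambda>(u, v). sweedler (\<lambda>(a, b). F (u * jc b) (v * sR q * S a)) (gL n)) (rR m)"
    by (rule rR_R[OF balAR_inner[OF F]])
  also have "\<dots> \<approx>\<^bsub>K\<^esub> sweedler (\<lambda>(u, v). sweedler (\<lambda>(a, b). F (u * jc b) (v * S a)) (gL (n * tR q))) (rR m)"
    by (rule sweedler_eqmod) (rule eqmod_sym[OF inner_tR[OF F]])
  finally show "sweedler (\<lambda>(u, v). sweedler (\<lambda>(a, b). F (u * jc b) (v * S a)) (gL n)) (rR (m * etaR q)) \<approx>\<^bsub>K\<^esub>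
      sweedler (\<lambda>(u, v). sweedler (\<lambda>(a, b). F (u * jc b) (v * S a)) (gL (n * tR q))) (rR m)" .
qed

section \<open>The projection onto the coinvariants and the coaction on \<open>jc\<close>\<close>

definition proj :: "'a \<Rightarrow> 'a" where
  "proj a = sweedler (\<lambda>(x, z). x * jc z) (rR a)"

text \<open>This is coinvariance of \<open>proj a\<close> with the candidate in place of the
  coaction on \<open>jc\<close>.\<close>

lemma conv_rR:
  assumes F: "balAR K F"
  shows "sweedler (\<lambda>(m, z). conv F m z) (rR a) \<approx>\<^bsub>K\<^esub> F (proj a) 1"
proof -
  note add = balanced_add[OF F] and bal = balanced_bal[OF F]
  have 1: "sweedler (\<lambda>(m, z). conv F m z) (rR a) \<approx>\<^bsub>K\<^esub>
      sweedler (\<lambda>(x, w). sweedler (\<lambda>(y, z). sweedler (\<lambda>(a, b). F (x * jc b) (y * S a)) (gL z)) (gR w)) (rR a)"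
    unfolding conv_def
  proof (rule rR_coassoc, rule balanced3I)
    fix m n q c
    show "sweedler (\<lambda>(a, b). F (m * jc b) (n * sR q * S a)) (gL c) \<approx>\<^bsub>K\<^esub>
      sweedler (\<lambda>(a, b). F (m * jc b) (n * S a)) (gL (c * tR q))"
      by (rule eqmod_sym[OF inner_tR[OF F]])
  qed (use balAR_inner[OF F] gL_add[OF balL_inner[OF F]] in \<open>auto simp: balanced_def\<close>)
  have 2: "sweedler (\<lambda>(y, z). sweedler (\<lambda>(a, b). F (x * jc b) (y * S a)) (gL z)) (gR w) \<approx>\<^bsub>K\<^esub> F (x * jc w) 1"
    for x w
  proof -
    have "F (x * jc c) (m * (S n * sL q)) \<approx>\<^bsub>K\<^esub> F (x * (jc c * etaR (piR (sL q)))) (m * S n)" for m n q c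
      using eqmod_sym[OF bal[of "x * jc c" "piR (sL q)" "m * S n"]] by (simp add: mult.assoc tR_piR_sL)
    \<comment> \<open>Mixed coassociativity regroups the three legs so that \<open>p * S q\<close>
      comes from a single right coproduct. Its value lies in the image of \<open>sL\<close> and is
      absorbed into \<open>jc\<close> by the balancing over \<open>R\<close>.\<close>
    then have "sweedler (\<lambda>(y, z). sweedler (\<lambda>(a, b). F (x * jc b) (y * S a)) (gL z)) (gR w) \<approx>\<^bsub>K\<^esub>
        sweedler (\<lambda>(m, n). sweedler (\<lambda>(p, q). F (x * jc n) (p * S q)) (gR m)) (gL w)"
      by (intro eqmod_sym[OF g_coassoc_RL] balanced3I)
        (simp_all add: add distrib_left distrib_right S_add jc_add S_tR_right S_tL jc_sL mult.assoc)
    also have "\<dots> \<approx>\<^bsub>K\<^esub> sweedler (\<lambda>(m, n). F (x * jc (sL (piL m) * n)) 1) (gL w)"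
    proof (rule sweedler_eqmod)
      fix m n
      have "sweedler (\<lambda>(p, q). F (x * jc n) (p * S q)) (gR m) \<approx>\<^bsub>K\<^esub>
          F (x * jc n) (sweedler (\<lambda>(p, q). p * S q) (gR m))"
        by (rule eqmod_sym[OF sweedler_hom_eqmod]) (rule add)
      also have "\<dots> = F (x * jc n) (1 * tR (piR (sL (piL m))))"
        by (simp add: antipode_right tR_piR_sL)
      also have "\<dots> \<approx>\<^bsub>K\<^esub> F (x * jc n * etaR (piR (sL (piL m)))) 1"
        by (rule eqmod_sym[OF bal])
      finally show "sweedler (\<lambda>(p, q). F (x * jc n) (p * S q)) (gR m) \<approx>\<^bsub>K\<^esub> F (x * jc (sL (piL m) * n)) 1"
        by (simp add: jc_sL mult.assoc)
    qed
    also have "\<dots> \<approx>\<^bsub>K\<^esub> F (x * jc (sweedler (\<lambda>(m, n). sL (piL m) * n) (gL w))) 1"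
      by (rule eqmod_sym, rule sweedler_hom_eqmod[of "\<lambda>z. F (x * jc z) 1"]) (simp add: jc_add distrib_left add)
    finally show ?thesis by (simp add: lb.counit_left)
  qed
  note 1
  also have "sweedler (\<lambda>(x, w). sweedler (\<lambda>(y, z). sweedler (\<lambda>(a, b). F (x * jc b) (y * S a)) (gL z)) (gR w)) (rR a)
      \<approx>\<^bsub>K\<^esub> sweedler (\<lambda>(x, w). F (x * jc w) 1) (rR a)"
    by (rule sweedler_eqmod) (rule 2)
  also have "\<dots> \<approx>\<^bsub>K\<^esub> F (proj a) 1"
    unfolding proj_def by (rule eqmod_sym, rule sweedler_hom_eqmod[of "\<lambda>z. F z 1"]) (rule add)
  finally show ?thesis .
qed

lemma balAR_jc: "balAR {} (\<lambda>x z. x * jc z)"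
  by (rule balancedI) (simp_all add: jc_add distrib_left distrib_right jc_tR_right mult.assoc)

lemma proj_add: "proj (x + y) = proj x + proj y"
  using rR_add[OF balAR_jc] by (simp add: proj_def)

lemma proj_etaL': "proj (etaL' l * x) = proj x * etaL l"
  using rR_L[OF balAR_jc] by (simp add: proj_def jc_tL sweedler_mult_right mult.assoc)

lemma proj_coinv_mult: "b \<in> B \<Longrightarrow> proj (b * x) = b * proj x"
  using rR_mult_coinv[OF _ balAR_jc] by (simp add: proj_def sweedler_mult_left mult.assoc)

lemma proj_j: "proj (j h) = etaL (piL h)"
  using rR_j[OF balAR_jc] by (simp add: proj_def j_jc)

text \<open>Uniqueness of inverses under convolution. By \<open>conv_rR\<close> at
  \<open>j b\<close> and \<open>proj_j\<close>, the candidate is a right inverse of the coaction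
  composed with \<open>j\<close>; the coaction composed with \<open>jc\<close> is a left inverse by
  \<open>jc_j\<close>. Hence the two agree.\<close>

lemma rR_jc:
  assumes F: "balAR K F"
  shows "sweedler (\<lambda>(x, h). F x h) (rR (jc h)) \<approx>\<^bsub>K\<^esub> sweedler (\<lambda>(a, b). F (jc b) (S a)) (gL h)"
proof -
  note add = balanced_add[OF F] and bal = balanced_bal[OF F]
  note conv = balAR_conv[OF F]
  have 1: "sweedler (\<lambda>(x, h). F x h) (rR (jc a * etaL (piL b))) \<approx>\<^bsub>K\<^esub>
      sweedler (\<lambda>(m, z). conv F (jc a * j m) z) (gR b)" for a b
  proof -
    have "sweedler (\<lambda>(x, h). F x h) (rR (jc a * etaL (piL b))) \<approx>\<^bsub>K\<^esub>
      sweedler (\<lambda>(c, d). sweedler (\<lambda>(x, y). F (x * c) (y * d)) (rR (jc a))) (rR (etaL (piL b)))"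
      by (rule rR_mult[OF F])
    also have "\<dots> \<approx>\<^bsub>K\<^esub> sweedler (\<lambda>(x, y). F (x * etaL (piL b)) (y * 1)) (rR (jc a))"
      by (rule rR_coinv[OF etaL_B balanced_swe[OF balAR_left[OF F]]])
    also have "\<dots> \<approx>\<^bsub>K\<^esub> sweedler (\<lambda>(x, y). sweedler (\<lambda>(m, z). conv (\<lambda>c d. F (x * c) (y * d)) (j m) z) (gR b)) (rR (jc a))"
    proof (rule sweedler_eqmod)
      fix x y
      note F' = balAR_left[OF F, of x y]
      have "sweedler (\<lambda>(m, z). conv (\<lambda>c d. F (x * c) (y * d)) (j m) z) (gR b) \<approx>\<^bsub>K\<^esub>
          sweedler (\<lambda>(m, z). conv (\<lambda>c d. F (x * c) (y * d)) m z) (rR (j b))"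
        by (rule eqmod_sym[OF rR_j[OF balAR_conv[OF F']]])
      also have "\<dots> \<approx>\<^bsub>K\<^esub> F (x * proj (j b)) (y * 1)" by (rule conv_rR[OF F'])
      finally show "F (x * etaL (piL b)) (y * 1) \<approx>\<^bsub>K\<^esub>
          sweedler (\<lambda>(m, z). conv (\<lambda>c d. F (x * c) (y * d)) (j m) z) (gR b)"
        by (simp add: proj_j eqmod_sym)
    qed
    also have "\<dots> = sweedler (\<lambda>(m, z). sweedler (\<lambda>(x, y). conv (\<lambda>c d. F (x * c) (y * d)) (j m) z) (rR (jc a))) (gR b)"
      by (rule sweedler_swap)
    also have "\<dots> \<approx>\<^bsub>K\<^esub> sweedler (\<lambda>(m, z). conv F (jc a * j m) z) (gR b)"
    proof (rule sweedler_eqmod)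
      fix m z
      show "sweedler (\<lambda>(x, y). conv (\<lambda>c d. F (x * c) (y * d)) (j m) z) (rR (jc a)) \<approx>\<^bsub>K\<^esub> conv F (jc a * j m) z"
        using eqmod_sym[OF rR_mult[OF balAR_inner[OF F, of z], of "jc a" "j m"]]
        by (simp add: conv_def mult.assoc sweedler_swap[of _ "rR (j m)"])
    qed
    finally show ?thesis .
  qed
  have "sweedler (\<lambda>(x, h). F x h) (rR (jc h)) \<approx>\<^bsub>K\<^esub>
      sweedler (\<lambda>(a, b). sweedler (\<lambda>(x, h). F x h) (rR (jc a * etaL (piL b)))) (gL h)"
    by (subst sum_etaL_piL[of jc h, OF jc_add jc_tL])
      (rule sweedler_hom_eqmod[of "\<lambda>a. sweedler (\<lambda>(x, h). F x h) (rR a)"], rule rR_add[OF F])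
  also have "\<dots> \<approx>\<^bsub>K\<^esub> sweedler (\<lambda>(a, b). sweedler (\<lambda>(m, z). conv F (jc a * j m) z) (gR b)) (gL h)"
    by (rule sweedler_eqmod) (rule 1)
  also have "\<dots> \<approx>\<^bsub>K\<^esub> sweedler (\<lambda>(p, z). sweedler (\<lambda>(a, m). conv F (jc a * j m) z) (gL p)) (gR h)"
    using conv
    by (intro eqmod_sym[OF g_coassoc_LR] balanced3I)
      (simp_all add: balanced_def distrib_left distrib_right jc_add j_add jc_tL j_sL j_sR mult.assoc[symmetric])
  \<comment> \<open>The convolution of \<open>jc\<close> with \<open>j\<close> collapses to
    \<open>etaR (piR p)\<close>, which crosses to \<open>z\<close>; the counit restores
    \<open>h\<close>, and \<open>rR 1\<close> is \<open>1 \<otimes> 1\<close>, which leaves the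
    candidate alone.\<close>
  also have "\<dots> \<approx>\<^bsub>K\<^esub> sweedler (\<lambda>(p, z). conv F 1 (z * tR (piR p))) (gR h)"
  proof (rule sweedler_eqmod)
    fix p z
    have "sweedler (\<lambda>(a, m). conv F (jc a * j m) z) (gL p) \<approx>\<^bsub>K\<^esub> conv F (sweedler (\<lambda>(a, m). jc a * j m) (gL p)) z"
      by (rule eqmod_sym, rule sweedler_hom_eqmod[of "\<lambda>y. conv F y z"]) (rule balanced_add[OF conv])
    also have "\<dots> = conv F (1 * etaR (piR p)) z" by (simp add: jc_j)
    also have "\<dots> \<approx>\<^bsub>K\<^esub> conv F 1 (z * tR (piR p))" by (rule balanced_bal[OF conv])
    finally show "sweedler (\<lambda>(a, m). conv F (jc a * j m) z) (gL p) \<approx>\<^bsub>K\<^esub> conv F 1 (z * tR (piR p))" .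
  qed
  also have "\<dots> \<approx>\<^bsub>K\<^esub> conv F 1 (sweedler (\<lambda>(p, z). z * tR (piR p)) (gR h))"
    by (rule eqmod_sym, rule sweedler_hom_eqmod[of "conv F 1"]) (rule balanced_add[OF conv])
  also have "\<dots> = conv F 1 h" by (simp add: rb.counit_left)
  also have "\<dots> \<approx>\<^bsub>K\<^esub> sweedler (\<lambda>(a, b). F (1 * jc b) (1 * S a)) (gL h)"
    unfolding conv_def by (rule rR_one[OF balAR_inner[OF F]])
  finally show ?thesis by simp
qed

text \<open>Multiplicativity of the coaction and \<open>rR_jc\<close> produce \<open>conv\<close>,
  which \<open>conv_rR\<close> evaluates.\<close>

lemma proj_B: "proj a \<in> B"
proof (rule coinvI)
  note F = balAR_frag[of 1 1, simplified]
  have "sweedler (\<lambda>(x, h). frag_of (x, h)) (rR (proj a)) \<approx>\<^bsub>NR\<^esub>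
      sweedler (\<lambda>(x, w). sweedler (\<lambda>(x, h). frag_of (x, h)) (rR (x * jc w))) (rR a)"
    unfolding proj_def
    by (rule sweedler_hom_eqmod[of "\<lambda>a. sweedler (\<lambda>(x, h). frag_of (x, h)) (rR a)"]) (rule rR_add[OF F])
  also have "\<dots> \<approx>\<^bsub>NR\<^esub> sweedler (\<lambda>(x, w). conv (\<lambda>x h. frag_of (x, h)) x w) (rR a)"
  proof (rule sweedler_eqmod)
    fix x w
    note rR_mult[OF F, of x "jc w"]
    also have "sweedler (\<lambda>(c, d). sweedler (\<lambda>(u, v). frag_of (u * c, v * d)) (rR x)) (rR (jc w)) \<approx>\<^bsub>NR\<^esub>
        sweedler (\<lambda>(a, b). sweedler (\<lambda>(u, v). frag_of (u * jc b, v * S a)) (rR x)) (gL w)"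
      by (rule rR_jc[OF balanced_swe[OF balAR_frag]])
    finally show "sweedler (\<lambda>(x, h). frag_of (x, h)) (rR (x * jc w)) \<approx>\<^bsub>NR\<^esub> conv (\<lambda>x h. frag_of (x, h)) x w"
      by (simp add: conv_def sweedler_swap[of _ "gL w"])
  qed
  also have "\<dots> \<approx>\<^bsub>NR\<^esub> frag_of (proj a, 1)" by (rule conv_rR[OF F])
  finally show "sweedler (\<lambda>(x, h). frag_of (x, h)) (rR (proj a)) \<approx>\<^bsub>NR\<^esub> frag_of (proj a, 1)" .
qed

text \<open>Mixed coassociativity puts \<open>jc\<close> next to \<open>j\<close>, so that
  \<open>jc_j\<close> and the counit apply.\<close>

lemma sum_proj_j: "sweedler (\<lambda>(x, h). proj x * j h) (rL a) = a"
proof -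
  have "sweedler (\<lambda>(x, h). proj x * j h) (rL a) = sweedler (\<lambda>(m, n). sweedler (\<lambda>(x, y). x * jc y * j n) (rR m)) (rL a)"
    by (simp add: proj_def sweedler_mult_right)
  also have "\<dots> = sweedler (\<lambda>(x, w). sweedler (\<lambda>(y, z). x * jc y * j z) (gL w)) (rR a)"
    using r_mixed_RL[of "{}" "\<lambda>x y z. x * jc y * j z" a]
    by (simp add: balanced3_def jc_add j_add distrib_left distrib_right jc_tR_right jc_tL j_sL mult.assoc)
  also have "\<dots> = sweedler (\<lambda>(x, w). x * sweedler (\<lambda>(y, z). jc y * j z) (gL w)) (rR a)"
    by (simp add: sweedler_mult_left mult.assoc)
  finally show ?thesis by (simp add: jc_j rR_counit)
qed

end

section \<open>The canonical map\<close>

context hopf_extension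
begin

abbreviation "NB \<equiv> tensor_null UNIV B (*) (*)"
abbreviation "can \<equiv> can\<^sub>R \<H> \<A>"

text \<open>A lift of \<open>can\<close> to free abelian groups; \<open>galois_iff\<close> expresses
  bijectivity through it, as statements about congruences.\<close>

definition can_free :: "('a \<times> 'a \<Rightarrow>\<^sub>0 int) \<Rightarrow> ('a \<times> 'h \<Rightarrow>\<^sub>0 int)" where
  "can_free = lext (\<lambda>(a, a'). sweedler (\<lambda>(x, h). frag_of (a * x, h)) (rR a'))"

lemma lext_can_free:
  "lext (\<lambda>(x, h). F x h) (can_free x) = lext (\<lambda>(a, a'). sweedler (\<lambda>(u, k). F (a * u) k) (rR a')) x"
  by (simp add: can_free_def lext_lext lext_sweedler case_prod_unfold sweedler_eq_lext)

lemma NB_add: "frag_of (x + y, z) \<approx>\<^bsub>NB\<^esub> frag_of (x, z) + frag_of (y, z)"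
    "frag_of (x, y + z) \<approx>\<^bsub>NB\<^esub> frag_of (x, y) + frag_of (x, z)"
  and NB_bal: "b \<in> B \<Longrightarrow> frag_of (x * b, z) \<approx>\<^bsub>NB\<^esub> frag_of (x, b * z)"
  by (intro frag_tensor_add1 frag_tensor_add2 frag_tensor_balanced; simp)+

text \<open>Balancing over \<open>B\<close> is the left \<open>B\<close>-linearity of the coaction,
  \<open>rR_mult_coinv\<close>.\<close>

lemma can_free_cong: "x \<approx>\<^bsub>NB\<^esub> y \<Longrightarrow> can_free x \<approx>\<^bsub>NR\<^esub> can_free y"
  unfolding can_free_def
proof (erule lext_balanced[rotated], rule balancedI)
  fix m m' n
  show "sweedler (\<lambda>(x, h). frag_of ((m + m') * x, h)) (rR n) \<approx>\<^bsub>NR\<^esub>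
    sweedler (\<lambda>(x, h). frag_of (m * x, h)) (rR n) + sweedler (\<lambda>(x, h). frag_of (m' * x, h)) (rR n)"
    unfolding sweedler_add[symmetric] by (rule sweedler_eqmod) (simp add: distrib_right NR_add)
next
  fix m n n'
  show "sweedler (\<lambda>(x, h). frag_of (m * x, h)) (rR (n + n')) \<approx>\<^bsub>NR\<^esub>
    sweedler (\<lambda>(x, h). frag_of (m * x, h)) (rR n) + sweedler (\<lambda>(x, h). frag_of (m * x, h)) (rR n')"
    by (rule rR_add[OF balAR_frag[of m 1, simplified]])
next
  fix m q n assume "q \<in> B"
  from rR_mult_coinv[OF this balAR_frag[of m 1, simplified], of n]
  show "sweedler (\<lambda>(x, h). frag_of (m * q * x, h)) (rR n) \<approx>\<^bsub>NR\<^esub>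
    sweedler (\<lambda>(x, h). frag_of (m * x, h)) (rR (q * n))"
    by (simp add: mult.assoc eqmod_sym)
qed

lemma can_coset: "can (x +o NB) = can_free x +o NR"
proof -
  have "can_free (rep (x +o NB)) \<approx>\<^bsub>NR\<^esub> can_free x"
    by (rule can_free_cong[OF rep_tensor])
  then show ?thesis
    by (simp add: can\<^sub>R_def induced_def frag_extend_eq_lext frag_map_eq_lext tensor_coset_eq_iff
        can_free_def sweedler_eq_lext case_prod_unfold)
qed

lemma tensor_carrier_UNIV: "tensor_carrier UNIV Q ra la = range (\<lambda>x. x +o tensor_null UNIV Q ra la)"
  by (auto simp: tensor_carrier_def)

lemma can_inj_iff:
  "inj_on can (tensor_carrier UNIV B (*) (*)) \<longleftrightarrow>
    (\<forall>x y. can_free x \<approx>\<^bsub>NR\<^esub> can_free y \<longrightarrow> x \<approx>\<^bsub>NB\<^esub> y)"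
  by (auto simp: inj_on_def tensor_carrier_UNIV can_coset tensor_coset_eq_iff)

lemma can_image_iff:
  "can ` tensor_carrier UNIV B (*) (*) = MH_R_tensor \<H> (alg_comodule \<H> \<A>) \<longleftrightarrow>
    (\<forall>v. \<exists>x. can_free x \<approx>\<^bsub>NR\<^esub> v)"
proof -
  have *: "range (\<lambda>x. G (F x)) = range G \<longleftrightarrow> (\<forall>v. \<exists>x. G (F x) = G v)"
    for F :: "'x \<Rightarrow> 'y" and G :: "'y \<Rightarrow> 'z"
    by (auto simp: image_iff set_eq_iff) metis+
  have "can ` tensor_carrier UNIV B (*) (*) = MH_R_tensor \<H> (alg_comodule \<H> \<A>) \<longleftrightarrow>
      (\<forall>v. \<exists>x. can_free x +o NR = v +o NR)"
    unfolding alg_null_simps tensor_carrier_UNIV image_image can_coset using * .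
  then show ?thesis by (simp add: tensor_coset_eq_iff)
qed

lemma galois_iff:
  "galois\<^sub>R \<H> \<A> B \<longleftrightarrow> (\<forall>x y. can_free x \<approx>\<^bsub>NR\<^esub> can_free y \<longrightarrow> x \<approx>\<^bsub>NB\<^esub> y) \<and>
    (\<forall>v. \<exists>x. can_free x \<approx>\<^bsub>NR\<^esub> v)"
  unfolding galois\<^sub>R_def bij_betw_def can_inj_iff can_image_iff ..

end

context cleft_datum
begin

section \<open>The inverse of the canonical map of a cleft extension\<close>

definition can_inv :: "('a \<times> 'h \<Rightarrow>\<^sub>0 int) \<Rightarrow> ('a \<times> 'a \<Rightarrow>\<^sub>0 int)" where
  "can_inv = lext (\<lambda>(x, h). sweedler (\<lambda>(a, b). frag_of (x * jc a, j b)) (gL h))"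

lemma NB_jc_j: "frag_of (x * (jc a * etaL l), j b) \<approx>\<^bsub>NB\<^esub> frag_of (x * jc a, j (sL l * b))"
  using NB_bal[OF etaL_B, of "x * jc a" l "j b"] by (simp add: j_sL mult.assoc)

lemma balL_jc_j_frag: "balL NB (\<lambda>a b. frag_of (x * jc a, j b))"
  by (rule balancedI) (simp_all add: jc_add j_add distrib_left NB_add jc_tL NB_jc_j)

lemma balAR_can_inv: "balAR NB (\<lambda>x h. sweedler (\<lambda>(a, b). frag_of (x * jc a, j b)) (gL h))"
proof (rule balancedI)
  fix m m' n
  show "sweedler (\<lambda>(a, b). frag_of ((m + m') * jc a, j b)) (gL n) \<approx>\<^bsub>NB\<^esub>
    sweedler (\<lambda>(a, b). frag_of (m * jc a, j b)) (gL n) + sweedler (\<lambda>(a, b). frag_of (m' * jc a, j b)) (gL n)"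
    unfolding sweedler_add[symmetric] by (rule sweedler_eqmod) (simp add: distrib_right NB_add)
next
  fix m n n'
  show "sweedler (\<lambda>(a, b). frag_of (m * jc a, j b)) (gL (n + n')) \<approx>\<^bsub>NB\<^esub>
    sweedler (\<lambda>(a, b). frag_of (m * jc a, j b)) (gL n) + sweedler (\<lambda>(a, b). frag_of (m * jc a, j b)) (gL n')"
    by (rule gL_add[OF balL_jc_j_frag])
next
  fix m q n
  from eqmod_sym[OF gL_tR[OF balL_jc_j_frag, of m n q]]
  show "sweedler (\<lambda>(a, b). frag_of (m * etaR q * jc a, j b)) (gL n) \<approx>\<^bsub>NB\<^esub>
    sweedler (\<lambda>(a, b). frag_of (m * jc a, j b)) (gL (n * tR q))"
    by (simp add: jc_tR_right mult.assoc)
qed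

text \<open>Mixed coassociativity gathers \<open>x * jc p\<close> into \<open>proj m\<close>, which
  as a coinvariant crosses the tensor sign over \<open>B\<close>; \<open>sum_proj_j\<close> then
  reassembles \<open>a'\<close>.\<close>

lemma can_inv_can: "can_inv (can_free x) \<approx>\<^bsub>NB\<^esub> x"
proof -
  have "sweedler (\<lambda>(x, h). sweedler (\<lambda>(p, q). frag_of (a * x * jc p, j q)) (gL h)) (rR a') \<approx>\<^bsub>NB\<^esub> frag_of (a, a')"
    for a a'
  proof -
    have "sweedler (\<lambda>(x, h). sweedler (\<lambda>(p, q). frag_of (a * x * jc p, j q)) (gL h)) (rR a') \<approx>\<^bsub>NB\<^esub>
        sweedler (\<lambda>(m, n). sweedler (\<lambda>(x, p). frag_of (a * x * jc p, j n)) (rR m)) (rL a')"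
      by (rule eqmod_sym[OF r_mixed_RL], rule balanced3I)
        (use NB_jc_j in \<open>simp_all add: jc_add j_add distrib_left distrib_right NB_add jc_tR_right jc_tL mult.assoc\<close>,
          simp add: NB_jc_j flip: mult.assoc)
    also have "\<dots> \<approx>\<^bsub>NB\<^esub> sweedler (\<lambda>(m, n). frag_of (a, proj m * j n)) (rL a')"
    proof (rule sweedler_eqmod)
      fix m n
      have "frag_of (a * proj m, j n) \<approx>\<^bsub>NB\<^esub> sweedler (\<lambda>(x, p). frag_of (a * (x * jc p), j n)) (rR m)"
        unfolding proj_def by (rule sweedler_hom_eqmod[of "\<lambda>y. frag_of (a * y, j n)"]) (simp add: distrib_left NB_add)
      from eqmod_trans[OF eqmod_sym[OF this] NB_bal[OF proj_B]]
      show "sweedler (\<lambda>(x, p). frag_of (a * x * jc p, j n)) (rR m) \<approx>\<^bsub>NB\<^esub> frag_of (a, proj m * j n)"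
        by (simp add: mult.assoc)
    qed
    also have "\<dots> \<approx>\<^bsub>NB\<^esub> frag_of (a, sweedler (\<lambda>(m, n). proj m * j n) (rL a'))"
      by (rule eqmod_sym, rule sweedler_hom_eqmod[of "\<lambda>y. frag_of (a, y)"]) (rule NB_add)
    finally show ?thesis by (simp add: sum_proj_j)
  qed
  then have "lext (\<lambda>(a, a'). sweedler (\<lambda>(x, h). sweedler (\<lambda>(p, q). frag_of (a * x * jc p, j q)) (gL h)) (rR a')) x
      \<approx>\<^bsub>NB\<^esub> lext (\<lambda>(a, a'). frag_of (a, a')) x"
    by (rule lext2_eqmod)
  then show ?thesis
    by (simp add: can_inv_def can_free_def lext_lext lext_sweedler lext_frag case_prod_unfold sweedler_eq_lext)
qed

text \<open>Colinearity of \<open>j\<close> exposes a coproduct, mixed coassociativity brings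
  \<open>jc\<close> and \<open>j\<close> together, and \<open>jc_j\<close> leaves a base element
  that the counit of \<open>gR\<close> absorbs.\<close>

lemma can_can_inv: "can_free (can_inv v) \<approx>\<^bsub>NR\<^esub> v"
proof -
  have "sweedler (\<lambda>(a, b). sweedler (\<lambda>(y, k). frag_of (x * jc a * y, k)) (rR (j b))) (gL h) \<approx>\<^bsub>NR\<^esub> frag_of (x, h)"
    for x h
  proof -
    have "sweedler (\<lambda>(a, b). sweedler (\<lambda>(y, k). frag_of (x * jc a * y, k)) (rR (j b))) (gL h) \<approx>\<^bsub>NR\<^esub>
        sweedler (\<lambda>(a, b). sweedler (\<lambda>(y, k). frag_of (x * jc a * j y, k)) (gR b)) (gL h)"
      by (rule sweedler_eqmod) (rule rR_j[OF balAR_frag[of _ 1, simplified]])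
    also have "\<dots> \<approx>\<^bsub>NR\<^esub> sweedler (\<lambda>(m, n). sweedler (\<lambda>(a, b). frag_of (x * jc a * j b, n)) (gL m)) (gR h)"
    proof (rule eqmod_sym[OF g_coassoc_LR], rule balanced3I)
      fix m n q c show "frag_of (x * jc m * j (n * sR q), c) \<approx>\<^bsub>NR\<^esub> frag_of (x * jc m * j n, c * tR q)"
        using NR_bal[of "x * jc m * j n" q c] by (simp add: j_sR mult.assoc)
    qed (simp_all add: jc_add j_add distrib_left distrib_right NR_add jc_tL j_sL mult.assoc)
    also have "\<dots> \<approx>\<^bsub>NR\<^esub> sweedler (\<lambda>(m, n). frag_of (x, n * tR (piR m))) (gR h)"
    proof (rule sweedler_eqmod)
      fix m n
      have "frag_of (x * sweedler (\<lambda>(a, b). jc a * j b) (gL m), n) \<approx>\<^bsub>NR\<^esub>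
          sweedler (\<lambda>(a, b). frag_of (x * (jc a * j b), n)) (gL m)"
        by (rule sweedler_hom_eqmod[of "\<lambda>y. frag_of (x * y, n)"]) (simp add: distrib_left NR_add)
      from eqmod_trans[OF eqmod_sym[OF this, unfolded jc_j] NR_bal]
      show "sweedler (\<lambda>(a, b). frag_of (x * jc a * j b, n)) (gL m) \<approx>\<^bsub>NR\<^esub> frag_of (x, n * tR (piR m))"
        by (simp add: mult.assoc)
    qed
    also have "\<dots> \<approx>\<^bsub>NR\<^esub> frag_of (x, sweedler (\<lambda>(m, n). n * tR (piR m)) (gR h))"
      by (rule eqmod_sym, rule sweedler_hom_eqmod[of "\<lambda>y. frag_of (x, y)"]) (rule NR_add)
    finally show ?thesis by (simp add: rb.counit_left)
  qed
  then have "lext (\<lambda>(x, h). sweedler (\<lambda>(a, b). sweedler (\<lambda>(y, k). frag_of (x * jc a * y, k)) (rR (j b))) (gL h)) v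
      \<approx>\<^bsub>NR\<^esub> lext (\<lambda>(x, h). frag_of (x, h)) v"
    by (rule lext2_eqmod)
  then show ?thesis
    by (simp add: can_inv_def can_free_def lext_lext lext_sweedler lext_frag case_prod_unfold sweedler_eq_lext)
qed

lemma can_inv_cong: "v \<approx>\<^bsub>NR\<^esub> w \<Longrightarrow> can_inv v \<approx>\<^bsub>NB\<^esub> can_inv w"
  unfolding can_inv_def by (rule lext_balanced[OF balAR_can_inv])

lemma galois: "galois\<^sub>R \<H> \<A> B"
  unfolding galois_iff
proof (intro conjI allI impI)
  fix x y assume "can_free x \<approx>\<^bsub>NR\<^esub> can_free y"
  from can_inv_cong[OF this] show "x \<approx>\<^bsub>NB\<^esub> y"
    using can_inv_can[of y] eqmod_trans[OF eqmod_sym[OF can_inv_can[of x]]] by (blast intro: eqmod_trans)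
next
  fix v show "\<exists>x. can_free x \<approx>\<^bsub>NR\<^esub> v"
    using can_can_inv by (rule exI)
qed

end

section \<open>The comodule of tensors over the subalgebra of coinvariants\<close>

context L_ring_extension
begin

abbreviation "NBH \<equiv> tensor_null B UNIV (\<lambda>b l. b * etaL l) (\<lambda>l h. sL l * h)"
abbreviation "BHT \<equiv> tensor_carrier B UNIV (\<lambda>b l. b * etaL l) (\<lambda>l h. sL l * h)"
abbreviation "balBH K F \<equiv> balanced B UNIV (\<lambda>b l. b * etaL l) (\<lambda>l h. sL l * h) K F"

lemma BH_simps [simp]: "BH_null \<H> B etaL = NBH" "BH_tensor \<H> B etaL = BHT"
  by (simp_all add: BH_null_def BH_tensor_def)

lemma NBH_add: "b \<in> B \<Longrightarrow> b' \<in> B \<Longrightarrow> frag_of (b + b', h) \<approx>\<^bsub>NBH\<^esub> frag_of (b, h) + frag_of (b', h)"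
    "b \<in> B \<Longrightarrow> frag_of (b, h + k) \<approx>\<^bsub>NBH\<^esub> frag_of (b, h) + frag_of (b, k)"
  and NBH_bal: "b \<in> B \<Longrightarrow> frag_of (b * etaL l, h) \<approx>\<^bsub>NBH\<^esub> frag_of (b, sL l * h)"
  by (intro frag_tensor_add1 frag_tensor_add2 frag_tensor_balanced; simp)+

lemma BHT_rep: "t \<in> BHT \<Longrightarrow> t = rep t +o NBH" "t \<in> BHT \<Longrightarrow> Poly_Mapping.keys (rep t) \<subseteq> B \<times> UNIV"
  by (erule tensor_carrier_rep) (erule rep_keys; intro B_add B_mult etaL_B)

lemma BHT_I: "Poly_Mapping.keys x \<subseteq> B \<times> UNIV \<Longrightarrow> x +o NBH \<in> BHT"
  by (auto simp: tensor_carrier_def)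

lemma BHT_frag: "b \<in> B \<Longrightarrow> frag_of (b, h) +o NBH \<in> BHT"
  by (rule BHT_I) (simp add: keys_frag_of)

lemma BH_tens_map:
  assumes "balBH NBH (\<lambda>b h. frag_of (g b h))"
  shows "tens_map NBH (\<lambda>(b, h). g b h) (x +o NBH) = lext (\<lambda>(b, h). frag_of (g b h)) x +o NBH"
  using lext_balanced[OF assms rep_tensor[of x]]
  by (simp add: tens_map_def frag_map_eq_lext tensor_coset_eq_iff case_prod_unfold)

lemma BH_actR: "BH_actR \<H> B etaL (x +o NBH) r = lext (\<lambda>(b, h). frag_of (b, h * sR r)) x +o NBH"
  unfolding BH_actR_def BH_simps
  by (rule BH_tens_map, rule balancedI) (simp_all add: NBH_add NBH_bal distrib_right mult.assoc)

lemma BH_actL: "BH_actL \<H> B etaL (x +o NBH) l = lext (\<lambda>(b, h). frag_of (b, tL l * h)) x +o NBH"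
  unfolding BH_actL_def BH_simps
  by (rule BH_tens_map, rule balancedI) (simp_all add: NBH_add NBH_bal distrib_left flip: sL_tL_left)

lemma BH_left_mult:
  assumes "b \<in> B"
  shows "BH_left_mult \<H> B etaL b (x +o NBH) = lext (\<lambda>(b', h). frag_of (b * b', h)) x +o NBH"
  unfolding BH_left_mult_def BH_simps
  by (rule BH_tens_map, rule balancedI)
    (use assms in \<open>simp_all add: NBH_add NBH_bal B_mult distrib_left flip: mult.assoc\<close>)

end

text \<open>Serves both directions: either \<open>jj\<close> is the cleaving map and
  \<open>\<phi>\<close> is built from it, or \<open>\<phi>\<close> is the given isomorphism and
  \<open>jj h\<close> its value at \<open>1 \<otimes> h\<close>.\<close>

locale BH_datum = L_ring_extension \<H> \<A> etaL
  for \<H> :: "('k::{comm_ring,comm_monoid_mult}, 'h::{ring,monoid_mult}, 'l::{ring,monoid_mult},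
      'r::{ring,monoid_mult}) hopf_algebroid_data"
    and \<A> :: "('k, 'a::{ring,monoid_mult}, 'h, 'r) comodule_algebra_data" and etaL +
  fixes jj :: "'h \<Rightarrow> 'a" and \<phi> :: "('a, 'h) tensor \<Rightarrow> 'a"
  assumes jj_add: "jj (x + y) = jj x + jj y" and jj_sL: "jj (sL l * h) = etaL l * jj h"
    and jj_sR: "jj (h * sR r) = jj h * etaR r" and jj_tL: "jj (tL l * h) = etaL' l * jj h"
    and \<phi>_coset: "Poly_Mapping.keys w \<subseteq> B \<times> UNIV \<Longrightarrow> \<phi> (w +o NBH) = lext (\<lambda>(b, h). b * jj h) w"
begin

lemma \<phi>_eq: "t \<in> BHT \<Longrightarrow> \<phi> t = lext (\<lambda>(b, h). b * jj h) (rep t)"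
  using BHT_rep[of t] \<phi>_coset[of "rep t"] by simp

lemma \<phi>_frag: "b \<in> B \<Longrightarrow> \<phi> (frag_of (b, h) +o NBH) = b * jj h"
  using \<phi>_coset[of "frag_of (b, h)"] by (simp add: keys_frag_of)

lemma keys_lext_frag:
  assumes "Poly_Mapping.keys x \<subseteq> B \<times> UNIV" "\<And>b h. b \<in> B \<Longrightarrow> fst (g b h) \<in> B"
  shows "Poly_Mapping.keys (lext (\<lambda>(b, h). frag_of (g b h)) x) \<subseteq> B \<times> UNIV"
proof -
  have "Poly_Mapping.keys (frag_extend (\<lambda>(b, h). frag_of (g b h)) x) \<subseteq> B \<times> UNIV"
  proof (rule order_trans[OF keys_frag_extend], rule UN_least)
    fix p assume "p \<in> Poly_Mapping.keys x"
    then have "fst p \<in> B" using assms(1) by auto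
    then show "Poly_Mapping.keys (case p of (b, h) \<Rightarrow> frag_of (g b h)) \<subseteq> B \<times> UNIV"
      using assms(2)[of "fst p" "snd p"] by (simp add: case_prod_unfold mem_Times_iff)
  qed
  then show ?thesis by (simp add: frag_extend_eq_lext)
qed

lemma \<phi>_lext:
  assumes "t \<in> BHT" "\<And>b h. b \<in> B \<Longrightarrow> fst (g b h) \<in> B"
  shows "\<phi> (lext (\<lambda>(b, h). frag_of (g b h)) (rep t) +o NBH) =
    lext (\<lambda>(b, h). case g b h of (b', h') \<Rightarrow> b' * jj h') (rep t)"
  using \<phi>_coset[OF keys_lext_frag[OF BHT_rep(2)[OF assms(1)] assms(2)]]
  by (simp add: lext_lext case_prod_unfold)

lemma \<phi>_add:
  assumes "t \<in> BHT" "t' \<in> BHT"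
  shows "\<phi> (t + t') = \<phi> t + \<phi> t'"
proof -
  have "t + t' = (rep t + rep t') +o NBH"
    by (simp add: BHT_rep(1)[OF assms(1), symmetric] BHT_rep(1)[OF assms(2), symmetric] flip: tensor_add)
  moreover have "Poly_Mapping.keys (rep t + rep t') \<subseteq> B \<times> UNIV"
    by (rule order_trans[OF keys_add Un_least]) (rule BHT_rep(2) assms)+
  ultimately show ?thesis by (simp add: \<phi>_coset \<phi>_eq assms lext_add)
qed

lemma \<phi>_actR: "t \<in> BHT \<Longrightarrow> \<phi> (BH_actR \<H> B etaL t r) = \<phi> t * etaR r"
  using BH_actR[of "rep t" r] BHT_rep(1)[of t] \<phi>_lext[of t "\<lambda>b h. (b, h * sR r)"]
  by (simp add: \<phi>_eq lext_mult_right jj_sR case_prod_unfold mult.assoc)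

text \<open>The action appears next to \<open>jj h\<close> and has to pass \<open>b\<close>, which
  commutes with \<open>etaL' l\<close> because it is coinvariant.\<close>

lemma \<phi>_actL:
  assumes "t \<in> BHT"
  shows "\<phi> (BH_actL \<H> B etaL t l) = etaL' l * \<phi> t"
proof -
  have "lext (\<lambda>(b, h). b * (etaL' l * jj h)) (rep t) = lext (\<lambda>(b, h). etaL' l * (b * jj h)) (rep t)"
  proof (rule lext_cong)
    fix p assume "p \<in> Poly_Mapping.keys (rep t)"
    then have "fst p \<in> B" using BHT_rep(2)[OF assms] by auto
    then show "(case p of (b, h) \<Rightarrow> b * (etaL' l * jj h)) = (case p of (b, h) \<Rightarrow> etaL' l * (b * jj h))"
      by (simp add: case_prod_unfold coinv_etaR_commute flip: mult.assoc)
  qed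
  then show ?thesis
    using BH_actL[of "rep t" l] BHT_rep(1)[OF assms] assms \<phi>_lext[of t "\<lambda>b h. (b, tL l * h)"]
    by (simp add: \<phi>_eq lext_mult_left jj_tL case_prod_unfold)
qed

lemma \<phi>_left_mult: "b \<in> B \<Longrightarrow> t \<in> BHT \<Longrightarrow> \<phi> (BH_left_mult \<H> B etaL b t) = b * \<phi> t"
  using BH_left_mult[of b "rep t"] BHT_rep(1)[of t] \<phi>_lext[of t "\<lambda>b' h. (b * b', h)"]
  by (simp add: \<phi>_eq lext_mult_left B_mult case_prod_unfold mult.assoc)

text \<open>The actions and the coproduct are parameters so that one argument covers both coactions.
  Generators of the intermediate free group have cosets as first components, which
  \<open>\<phi>_frag\<close> evaluates.\<close>

lemma \<phi>_coact:
  assumes act: "\<And>t q. t \<in> BHT \<Longrightarrow> \<phi> (act t q) = actA (\<phi> t) q" and t: "t \<in> BHT"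
  shows "tens_map (tensor_null UNIV UNIV actA la) (map_prod \<phi> id)
      (BH_coact \<H> B etaL (tensor_null BHT UNIV act la) \<gamma> t) =
    lext (\<lambda>(b, h). sweedler (\<lambda>(h', h''). frag_of (b * jj h', h'')) (\<gamma> h)) (rep t) +o tensor_null UNIV UNIV actA la"
    (is "?l = ?r +o ?N")
proof -
  let ?x = "lext (\<lambda>(b, h). sweedler (\<lambda>(h', h''). frag_of (frag_of (b, h') +o NBH, h'')) (\<gamma> h)) (rep t)"
  have "balanced BHT UNIV act la ?N (\<lambda>t h. frag_of (\<phi> t, h))"
    by (rule balancedI) (simp_all add: \<phi>_add act frag_tensor_add1 frag_tensor_add2 frag_tensor_balanced)
  from lext_balanced[OF this rep_tensor[of ?x]]
  have "?l = lext (\<lambda>(t, h). frag_of (\<phi> t, h)) ?x +o ?N"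
    by (simp add: BH_coact_def tens_map_def induced_def frag_extend_eq_lext frag_map_eq_lext
        tensor_coset_eq_iff sweedler_eq_lext case_prod_unfold map_prod_def)
  also have "lext (\<lambda>(t, h). frag_of (\<phi> t, h)) ?x = ?r"
    unfolding lext_lext
  proof (rule lext_cong)
    fix p assume "p \<in> Poly_Mapping.keys (rep t)"
    then have "fst p \<in> B" using BHT_rep(2)[OF t] by auto
    then show "lext (\<lambda>(t, h). frag_of (\<phi> t, h))
        (case p of (b, h) \<Rightarrow> sweedler (\<lambda>(h', h''). frag_of (frag_of (b, h') +o NBH, h'')) (\<gamma> h)) =
      (case p of (b, h) \<Rightarrow> sweedler (\<lambda>(h', h''). frag_of (b * jj h', h'')) (\<gamma> h))"
      by (cases p) (simp add: lext_sweedler \<phi>_frag)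
  qed
  finally show ?thesis .
qed

lemmas \<phi>_coactR = \<phi>_coact[of "BH_actR \<H> B etaL", OF \<phi>_actR]
lemmas \<phi>_coactL = \<phi>_coact[of "BH_actL \<H> B etaL" "\<lambda>a l. etaL' l * a", OF \<phi>_actL]

lemma \<phi>_comodule_map_iff:
  "comodule_map \<H> (BH_comodule \<H> B etaL) (alg_comodule \<H> \<A>) \<phi> \<longleftrightarrow>
    (\<forall>t\<in>BHT. rR (\<phi> t) = lext (\<lambda>(b, h). sweedler (\<lambda>(h', h''). frag_of (b * jj h', h'')) (gR h)) (rep t) +o NR) \<and>
    (\<forall>t\<in>BHT. rL (\<phi> t) = lext (\<lambda>(b, h). sweedler (\<lambda>(h', h''). frag_of (b * jj h', h'')) (gL h)) (rep t) +o NL)"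
  by (simp add: comodule_map_def BH_comodule_def \<phi>_add \<phi>_actR \<phi>_actL \<phi>_coactR \<phi>_coactL)

lemma balR_jj: "balR NR (\<lambda>h' h''. frag_of (b * jj h', h''))"
proof (rule balancedI)
  fix m q n show "frag_of (b * jj (m * sR q), n) \<approx>\<^bsub>NR\<^esub> frag_of (b * jj m, n * tR q)"
    using NR_bal[of "b * jj m"] by (simp add: jj_sR mult.assoc)
qed (simp_all add: jj_add distrib_left NR_add)

lemma balL_jj: "b \<in> B \<Longrightarrow> balL NL (\<lambda>h' h''. frag_of (b * jj h', h''))"
proof (rule balancedI)
  fix m q n assume "b \<in> B"
  then have "b * (etaL' q * jj m) = etaL' q * (b * jj m)" by (simp add: coinv_etaR_commute flip: mult.assoc)
  then show "frag_of (b * jj (tL q * m), n) \<approx>\<^bsub>NL\<^esub> frag_of (b * jj m, sL q * n)"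
    using NL_bal[of q "b * jj m"] by (simp add: jj_tL)
qed (simp_all add: jj_add distrib_left NL_add)

end

context cleft_datum
begin

section \<open>The normal basis isomorphism of a cleft extension\<close>

lemma balBH_j: "balBH {} (\<lambda>b h. b * j h)"
  by (rule balancedI) (simp_all add: j_add j_sL distrib_left distrib_right mult.assoc)

sublocale BH_datum \<H> \<A> etaL j "sweedler (\<lambda>(b, h). b * j h)"
  using sweedler_coset[OF balBH_j refl]
  by unfold_locales (simp_all add: j_add j_sL j_sR j_tL)

abbreviation "\<Phi> \<equiv> sweedler (\<lambda>(b, h). b * j h)"

definition \<psi> :: "'a \<Rightarrow> ('a, 'h) tensor" where
  "\<psi> a = sweedler (\<lambda>(x, h). frag_of (proj x, h)) (rL a) +o NBH"

lemma keys_\<psi>: "Poly_Mapping.keys (sweedler (\<lambda>(x, h). frag_of (proj x, h)) t) \<subseteq> B \<times> UNIV"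
  unfolding sweedler_eq_lext frag_extend_eq_lext[symmetric]
  by (rule order_trans[OF keys_frag_extend]) (auto simp: keys_frag_of proj_B)

lemma \<psi>_BHT: "\<psi> a \<in> BHT"
  unfolding \<psi>_def by (rule BHT_I) (rule keys_\<psi>)

lemma \<Phi>_\<psi>: "\<Phi> (\<psi> a) = a"
  unfolding \<psi>_def using sum_proj_j[of a] by (simp add: \<phi>_coset[OF keys_\<psi>] lext_sweedler)

lemma balAL_proj: "balAL NBH (\<lambda>x h. frag_of (proj x, h))"
  by (rule balancedI) (simp_all add: proj_add proj_B NBH_add proj_etaL' NBH_bal)

text \<open>On \<open>b * j h\<close>, left \<open>B\<close>-linearity of \<open>rL\<close> and
  \<open>proj\<close> isolates \<open>proj (j m) = etaL (piL m)\<close>, which crosses the tensor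
  sign over \<open>L\<close>; the counit restores \<open>h\<close>.\<close>

lemma \<psi>_\<Phi>:
  assumes "t \<in> BHT"
  shows "\<psi> (\<Phi> t) = t"
proof -
  have 1: "sweedler (\<lambda>(x, k). frag_of (proj x, k)) (rL (b * j h)) \<approx>\<^bsub>NBH\<^esub> frag_of (b, h)" if b: "b \<in> B" for b h
  proof -
    have "balAL NBH (\<lambda>x h. frag_of (proj (b * x), h))"
    proof (rule balancedI)
      fix m q n show "frag_of (proj (b * (etaL' q * m)), n) \<approx>\<^bsub>NBH\<^esub> frag_of (proj (b * m), sL q * n)"
        using NBH_bal[OF B_mult[OF b proj_B[of m]], of q n] by (simp add: proj_coinv_mult[OF b] proj_etaL' mult.assoc)
    qed (use b in \<open>simp_all add: proj_coinv_mult[OF b] proj_add proj_B NBH_add B_mult distrib_left\<close>)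
    from eqmod_trans[OF rL_mult_coinv[OF b balAL_proj] rL_j[OF this]]
    have "sweedler (\<lambda>(x, k). frag_of (proj x, k)) (rL (b * j h)) \<approx>\<^bsub>NBH\<^esub>
        sweedler (\<lambda>(m, n). frag_of (b * etaL (piL m), n)) (gL h)"
      by (simp add: proj_coinv_mult[OF b] proj_j)
    also have "\<dots> \<approx>\<^bsub>NBH\<^esub> sweedler (\<lambda>(m, n). frag_of (b, sL (piL m) * n)) (gL h)"
      by (rule sweedler_eqmod) (rule NBH_bal[OF b])
    also have "\<dots> \<approx>\<^bsub>NBH\<^esub> frag_of (b, sweedler (\<lambda>(m, n). sL (piL m) * n) (gL h))"
      by (rule eqmod_sym, rule sweedler_hom_eqmod[of "\<lambda>y. frag_of (b, y)"]) (rule NBH_add(2)[OF b])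
    finally show ?thesis by (simp add: lb.counit_left)
  qed
  have "sweedler (\<lambda>(x, h). frag_of (proj x, h)) (rL (lext (\<lambda>(b, h). b * j h) (rep t))) \<approx>\<^bsub>NBH\<^esub>
      lext (\<lambda>p. sweedler (\<lambda>(x, h). frag_of (proj x, h)) (rL (case p of (b, h) \<Rightarrow> b * j h))) (rep t)"
    by (rule lext_hom_eqmod[of "\<lambda>a. sweedler (\<lambda>(x, h). frag_of (proj x, h)) (rL a)"]) (rule rL_add[OF balAL_proj])
  also have "\<dots> \<approx>\<^bsub>NBH\<^esub> lext frag_of (rep t)"
    by (rule lext_eqmod_keys) (use 1 BHT_rep(2)[OF assms] in auto)
  finally show ?thesis
    unfolding \<psi>_def using BHT_rep(1)[OF assms] assms
    by (simp add: \<phi>_eq lext_frag flip: tensor_coset_eq_iff)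
qed

text \<open>Both coactions are left \<open>B\<close>-linear and \<open>j\<close> is colinear, so the
  formulas hold on each term \<open>b * j h\<close> with \<open>b\<close> in
  \<open>B\<close>.\<close>

lemma \<Phi>_coact:
  assumes t: "t \<in> BHT"
  shows "rR (\<Phi> t) = lext (\<lambda>(b, h). sweedler (\<lambda>(h', h''). frag_of (b * j h', h'')) (gR h)) (rep t) +o NR"
    and "rL (\<Phi> t) = lext (\<lambda>(b, h). sweedler (\<lambda>(h', h''). frag_of (b * j h', h'')) (gL h)) (rep t) +o NL"
proof -
  have B: "b \<in> B" if "(b, h) \<in> Poly_Mapping.keys (rep t)" for b h
    using that BHT_rep(2)[OF t] by auto
  have frag: "rep (r a) = sweedler (\<lambda>(x, h). frag_of (x, h)) (r a)" for r :: "'a \<Rightarrow> ('a, 'h) tensor" and a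
    by (simp add: sweedler_eq_lext case_prod_unfold lext_frag)
  note F = balAR_frag[of 1 1, simplified]
  have "sweedler (\<lambda>(x, h). frag_of (x, h)) (rR (lext (\<lambda>(b, h). b * j h) (rep t))) \<approx>\<^bsub>NR\<^esub>
      lext (\<lambda>p. sweedler (\<lambda>(x, h). frag_of (x, h)) (rR (case p of (b, h) \<Rightarrow> b * j h))) (rep t)"
    by (rule lext_hom_eqmod[of "\<lambda>a. sweedler (\<lambda>(x, h). frag_of (x, h)) (rR a)"]) (rule rR_add[OF F])
  also have "\<dots> \<approx>\<^bsub>NR\<^esub> lext (\<lambda>(b, h). sweedler (\<lambda>(h', h''). frag_of (b * j h', h'')) (gR h)) (rep t)"
    by (rule lext_eqmod_keys)
      (use eqmod_trans[OF rR_mult_coinv[OF B F] rR_j[OF balAR_frag[of _ 1, simplified]]] in auto)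
  finally show "rR (\<Phi> t) = lext (\<lambda>(b, h). sweedler (\<lambda>(h', h''). frag_of (b * j h', h'')) (gR h)) (rep t) +o NR"
    using rR_rep[of "\<Phi> t"] by (simp add: \<phi>_eq[OF t] frag[of rR] flip: tensor_coset_eq_iff)
  note F = balAL_frag
  have F': "balAL NL (\<lambda>x h. frag_of (b * x, h))" if "b \<in> B" for b
  proof (rule balancedI)
    fix m q n
    have "b * (etaL' q * m) = etaL' q * (b * m)" using that by (simp add: coinv_etaR_commute flip: mult.assoc)
    then show "frag_of (b * (etaL' q * m), n) \<approx>\<^bsub>NL\<^esub> frag_of (b * m, sL q * n)"
      using NL_bal[of q "b * m"] by simp
  qed (simp_all add: distrib_left NL_add)
  have "sweedler (\<lambda>(x, h). frag_of (x, h)) (rL (lext (\<lambda>(b, h). b * j h) (rep t))) \<approx>\<^bsub>NL\<^esub>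
      lext (\<lambda>p. sweedler (\<lambda>(x, h). frag_of (x, h)) (rL (case p of (b, h) \<Rightarrow> b * j h))) (rep t)"
    by (rule lext_hom_eqmod[of "\<lambda>a. sweedler (\<lambda>(x, h). frag_of (x, h)) (rL a)"]) (rule rL_add[OF F])
  also have "\<dots> \<approx>\<^bsub>NL\<^esub> lext (\<lambda>(b, h). sweedler (\<lambda>(h', h''). frag_of (b * j h', h'')) (gL h)) (rep t)"
    by (rule lext_eqmod_keys)
      (use eqmod_trans[OF rL_mult_coinv[OF B F] rL_j[OF F'[OF B]]] in auto)
  finally show "rL (\<Phi> t) = lext (\<lambda>(b, h). sweedler (\<lambda>(h', h''). frag_of (b * j h', h'')) (gL h)) (rep t) +o NL"
    using rL_rep[of "\<Phi> t"] by (simp add: \<phi>_eq[OF t] frag[of rL] flip: tensor_coset_eq_iff)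
qed

lemma \<Phi>_iso: "BH_iso \<H> \<A> B etaL \<Phi>"
proof -
  have "bij_betw \<Phi> BHT UNIV"
    by (rule bij_betw_byWitness[where f' = \<psi>]) (auto simp: \<Phi>_\<psi> \<psi>_\<Phi> \<psi>_BHT)
  then show ?thesis
    by (simp add: BH_iso_def \<phi>_comodule_map_iff \<Phi>_coact \<phi>_left_mult)
qed

end

context BH_datum
begin

section \<open>Restricting a comodule map on the tensor product to
  \<open>1 \<otimes> h\<close>\<close>

lemma balBH_coactR: "balBH NR (\<lambda>b h. sweedler (\<lambda>(h', h''). frag_of (b * jj h', h'')) (gR h))"
proof (rule balancedI)
  fix m m' n
  show "sweedler (\<lambda>(h', h''). frag_of ((m + m') * jj h', h'')) (gR n) \<approx>\<^bsub>NR\<^esub>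
    sweedler (\<lambda>(h', h''). frag_of (m * jj h', h'')) (gR n) + sweedler (\<lambda>(h', h''). frag_of (m' * jj h', h'')) (gR n)"
    unfolding sweedler_add[symmetric] by (rule sweedler_eqmod) (simp add: distrib_right NR_add)
qed (use gR_add[OF balR_jj] eqmod_sym[OF gR_sL[OF balR_jj]] in \<open>simp_all add: jj_sL mult.assoc\<close>)

lemma balBH_coactL: "balBH NL (\<lambda>b h. sweedler (\<lambda>(h', h''). frag_of (b * jj h', h'')) (gL h))"
proof (rule balancedI)
  fix m m' n
  show "sweedler (\<lambda>(h', h''). frag_of ((m + m') * jj h', h'')) (gL n) \<approx>\<^bsub>NL\<^esub>
    sweedler (\<lambda>(h', h''). frag_of (m * jj h', h'')) (gL n) + sweedler (\<lambda>(h', h''). frag_of (m' * jj h', h'')) (gL n)"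
    unfolding sweedler_add[symmetric] by (rule sweedler_eqmod) (simp add: distrib_right NL_add)
qed (use gL_add[OF balL_jj] eqmod_sym[OF gL_lin(1)[OF balL_jj]] in \<open>simp_all add: jj_sL mult.assoc\<close>)

text \<open>Colinearity of \<open>\<phi>\<close> at \<open>1 \<otimes> h\<close>. The chosen
  representative of that coset is unknown, so it is compared with \<open>frag_of (1, h)\<close>
  through \<open>balBH_coactR\<close> and \<open>balBH_coactL\<close>.\<close>

lemma jj_comodule_map:
  assumes "comodule_map \<H> (BH_comodule \<H> B etaL) (alg_comodule \<H> \<A>) \<phi>"
  shows "comodule_map \<H> (regular_comodule \<H>) (alg_comodule \<H> \<A>) jj"
proof -
  let ?t = "\<lambda>h. frag_of (1, h) +o NBH"
  note co = assms[unfolded \<phi>_comodule_map_iff]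
  have jj: "jj h = \<phi> (?t h)" for h using \<phi>_frag[OF B_one, of h] by simp
  have "rR (jj h) = tens_map NR (map_prod jj id) (gR h)" for h
    using co BHT_frag[OF B_one, of h] lext_balanced[OF balBH_coactR rep_tensor[of "frag_of (1, h)"]]
    by (simp add: jj[of h] tens_map_def frag_map_eq_lext tensor_coset_eq_iff sweedler_eq_lext
        case_prod_unfold map_prod_def del: BH_simps)
  moreover have "rL (jj h) = tens_map NL (map_prod jj id) (gL h)" for h
    using co BHT_frag[OF B_one, of h] lext_balanced[OF balBH_coactL rep_tensor[of "frag_of (1, h)"]]
    by (simp add: jj[of h] tens_map_def frag_map_eq_lext tensor_coset_eq_iff sweedler_eq_lext
        case_prod_unfold map_prod_def del: BH_simps)
  ultimately show ?thesis
    by (simp add: comodule_map_def regular_comodule_def jj_add jj_sR jj_tL)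
qed

end

section \<open>The cleaving map of a Galois extension with normal basis\<close>

locale galois_BH_datum = L_ring_extension \<H> \<A> etaL
  for \<H> :: "('k::{comm_ring,comm_monoid_mult}, 'h::{ring,monoid_mult}, 'l::{ring,monoid_mult},
      'r::{ring,monoid_mult}) hopf_algebroid_data"
    and \<A> :: "('k, 'a::{ring,monoid_mult}, 'h, 'r) comodule_algebra_data" and etaL +
  fixes \<phi> :: "('a, 'h) tensor \<Rightarrow> 'a"
  assumes iso: "BH_iso \<H> \<A> B etaL \<phi>" and galois: "galois\<^sub>R \<H> \<A> B"
begin

definition j :: "'h \<Rightarrow> 'a" where
  "j h = \<phi> (frag_of (1, h) +o NBH)"

lemma \<phi>_hom:
  "t \<in> BHT \<Longrightarrow> t' \<in> BHT \<Longrightarrow> \<phi> (t + t') = \<phi> t + \<phi> t'"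
  "t \<in> BHT \<Longrightarrow> \<phi> (BH_actR \<H> B etaL t r) = \<phi> t * etaR r"
  "t \<in> BHT \<Longrightarrow> \<phi> (BH_actL \<H> B etaL t l) = etaL' l * \<phi> t"
  "b \<in> B \<Longrightarrow> t \<in> BHT \<Longrightarrow> \<phi> (BH_left_mult \<H> B etaL b t) = b * \<phi> t"
  using iso by (simp_all add: BH_iso_def comodule_map_def BH_comodule_def)

lemma \<phi>_bij: "bij_betw \<phi> BHT UNIV"
  using iso by (simp add: BH_iso_def)

lemma \<phi>_b_j: "b \<in> B \<Longrightarrow> \<phi> (frag_of (b, h) +o NBH) = b * j h"
  using \<phi>_hom(4)[OF _ BHT_frag[OF B_one, of h], of b] by (simp add: j_def BH_left_mult)

lemma \<phi>_coset_eq: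
  assumes "Poly_Mapping.keys x \<subseteq> B \<times> UNIV"
  shows "\<phi> (x +o NBH) = lext (\<lambda>(b, h). b * j h) x"
proof -
  \<comment> \<open>The support condition is carried along because \<open>\<phi>\<close> is known to
    be additive only on the carrier.\<close>
  have "Poly_Mapping.keys x \<subseteq> B \<times> UNIV \<and> \<phi> (x +o NBH) = lext (\<lambda>(b, h). b * j h) x"
    using assms
  proof (induction x rule: frag_induction)
    case zero
    \<comment> \<open>The zero coset is its own double, so its image equals its own double and
      vanishes.\<close>
    have "(0 +o NBH) + (0 +o NBH) = 0 +o NBH" by (subst tensor_add) simp
    then show ?case using \<phi>_hom(1)[of "0 +o NBH" "0 +o NBH"] BHT_I[of 0] by simp
  next
    case (one p)
    then show ?case using \<phi>_b_j[of "fst p" "snd p"] by (cases p) (auto simp: keys_frag_of)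
  next
    case (diff x y)
    have k: "Poly_Mapping.keys (x - y) \<subseteq> B \<times> UNIV"
      using diff by (intro order_trans[OF keys_diff Un_least]) simp_all
    have "((x - y) +o NBH) + (y +o NBH) = x +o NBH" by (simp add: tensor_add)
    then have "\<phi> ((x - y) +o NBH) + \<phi> (y +o NBH) = \<phi> (x +o NBH)"
      using \<phi>_hom(1)[of "(x - y) +o NBH" "y +o NBH"] BHT_I[OF k] BHT_I[of y] diff by simp
    with diff k show ?case by (simp add: lext_diff eq_diff_eq)
  qed
  then show ?thesis ..
qed

sublocale BH_datum \<H> \<A> etaL j \<phi>
proof
  note frag = BHT_frag[OF B_one]
  fix x y h and l r
  have "frag_of (1, x + y) +o NBH = (frag_of (1, x) +o NBH) + (frag_of (1, y) +o NBH)"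
    by (simp add: tensor_add tensor_coset_eq_iff NBH_add B_one)
  then show "j (x + y) = j x + j y" by (simp add: j_def \<phi>_hom frag)
  have "frag_of (1, sL l * h) +o NBH = frag_of (etaL l, h) +o NBH"
    using NBH_bal[OF B_one, of l h] by (simp add: tensor_coset_eq_iff eqmod_sym)
  then show "j (sL l * h) = etaL l * j h" using \<phi>_b_j[OF etaL_B, of l h] by (simp add: j_def)
  show "j (h * sR r) = j h * etaR r" using \<phi>_hom(2)[OF frag, of h r] by (simp add: j_def BH_actR)
  show "j (tL l * h) = etaL' l * j h" using \<phi>_hom(3)[OF frag, of h l] by (simp add: j_def BH_actL)
qed (rule \<phi>_coset_eq)

sublocale colinear_datum \<H> \<A> etaL j
  by unfold_locales (use iso in \<open>simp_all add: jj_sL jj_comodule_map BH_iso_def\<close>)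

text \<open>\<open>E\<close> is \<open>B \<otimes> \<pi>\<^sub>L\<close> transported to \<open>A\<close>.\<close>

definition E :: "'a \<Rightarrow> 'a" where
  "E a = sweedler (\<lambda>(b, h). b * etaL (piL h)) (the_inv_into BHT \<phi> a)"

lemma balBH_piL: "balBH {} (\<lambda>b h. b * etaL (piL h))"
  by (rule balancedI) (simp_all add: lb.counit_add etaL_add distrib_left distrib_right piL_lin etaL_mult mult.assoc)

lemma E_lext:
  assumes "Poly_Mapping.keys x \<subseteq> B \<times> UNIV"
  shows "E (lext (\<lambda>(b, h). b * j h) x) = lext (\<lambda>(b, h). b * etaL (piL h)) x"
proof -
  have "the_inv_into BHT \<phi> (\<phi> (x +o NBH)) = x +o NBH"
    using \<phi>_bij BHT_I[OF assms] by (simp add: bij_betw_def the_inv_into_f_f)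
  then show ?thesis
    using sweedler_coset[OF balBH_piL, of _ x] by (simp add: E_def \<phi>_coset_eq[OF assms])
qed

lemma lext_decomposition:
  obtains x where "Poly_Mapping.keys x \<subseteq> B \<times> UNIV" "a = lext (\<lambda>(b, h). b * j h) x"
proof -
  have "a \<in> \<phi> ` BHT" using \<phi>_bij by (simp add: bij_betw_def)
  then obtain t where t: "t \<in> BHT" "a = \<phi> t" by blast
  show thesis by (rule that[OF BHT_rep(2)[OF t(1)]]) (simp add: t(2) \<phi>_eq[OF t(1)])
qed

lemma E_add: "E (a + a') = E a + E a'"
proof -
  obtain x y where xy: "Poly_Mapping.keys x \<subseteq> B \<times> UNIV" "a = lext (\<lambda>(b, h). b * j h) x"
    "Poly_Mapping.keys y \<subseteq> B \<times> UNIV" "a' = lext (\<lambda>(b, h). b * j h) y"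
    by (rule lext_decomposition[of a], rule lext_decomposition[of a'])
  have "Poly_Mapping.keys (x + y) \<subseteq> B \<times> UNIV"
    by (rule order_trans[OF keys_add Un_least]) (rule xy)+
  from E_lext[OF this] show ?thesis by (simp add: xy lext_add E_lext)
qed

lemma E_b_j: "b \<in> B \<Longrightarrow> E (b * j h) = b * etaL (piL h)"
  using E_lext[of "frag_of (b, h)"] by (simp add: keys_frag_of)

text \<open>The elements \<open>b * j h\<close> generate \<open>A\<close> additively, by
  surjectivity of \<open>\<phi>\<close>.\<close>

lemma additive_eqI:
  fixes F G :: "'a \<Rightarrow> 'a"
  assumes "\<And>x y. F (x + y) = F x + F y" "\<And>x y. G (x + y) = G x + G y"
    and "\<And>b h. b \<in> B \<Longrightarrow> F (b * j h) = G (b * j h)"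
  shows "F a = G a"
proof -
  obtain x where x: "Poly_Mapping.keys x \<subseteq> B \<times> UNIV" "a = lext (\<lambda>(b, h). b * j h) x"
    by (rule lext_decomposition)
  have "F a = lext (\<lambda>p. F (case p of (b, h) \<Rightarrow> b * j h)) x"
    unfolding x(2) by (rule lext_hom[OF assms(1)])
  also have "\<dots> = lext (\<lambda>p. G (case p of (b, h) \<Rightarrow> b * j h)) x"
    by (rule lext_cong) (use x(1) assms(3) in auto)
  also have "\<dots> = G a"
    unfolding x(2) by (rule lext_hom[OF assms(2), symmetric])
  finally show ?thesis .
qed

lemma E_left:
  assumes b: "b \<in> B"
  shows "E (b * a) = b * E a"
proof (rule additive_eqI[where a = a])
  fix b' h assume b': "b' \<in> B"
  show "E (b * (b' * j h)) = b * E (b' * j h)"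
    using E_b_j[OF B_mult[OF b b'], of h] E_b_j[OF b', of h] by (simp add: mult.assoc)
qed (simp_all add: E_add distrib_left)

text \<open>\<open>etaL' l\<close> passes the coinvariant \<open>b\<close> and enters
  \<open>j\<close> as a left factor \<open>tL l\<close>, which \<open>piL\<close> turns into right
  multiplication by \<open>l\<close>.\<close>

lemma E_etaL': "E (etaL' l * a) = E a * etaL l"
proof (rule additive_eqI[where a = a])
  fix b h assume b: "b \<in> B"
  have "etaL' l * (b * j h) = b * j (tL l * h)"
    using b by (simp add: j_tL coinv_etaR_commute flip: mult.assoc)
  then show "E (etaL' l * (b * j h)) = E (b * j h) * etaL l"
    using b by (simp add: E_b_j piL_lin etaL_mult mult.assoc)
qed (simp_all add: E_add distrib_left distrib_right)

text \<open>The counterpart of \<open>sum_proj_j\<close>, obtained here from left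
  \<open>B\<close>-linearity of \<open>E\<close> and \<open>rL\<close> on the generators
  \<open>b * j h\<close>.\<close>

lemma sum_E_j: "sweedler (\<lambda>(x, h). E x * j h) (rL a) = a"
proof (rule additive_eqI[where a = a])
  have bal: "balAL {} (\<lambda>x h. E (c * x) * j h)" if c: "c \<in> B" for c
    by (rule balancedI)
      (simp_all add: E_left[OF c] E_add j_add distrib_left distrib_right E_etaL' j_sL mult.assoc)
  note bal1 = bal[OF B_one, simplified]
  show "sweedler (\<lambda>(x, h). E x * j h) (rL (x + y)) =
      sweedler (\<lambda>(x, h). E x * j h) (rL x) + sweedler (\<lambda>(x, h). E x * j h) (rL y)" for x y
    using rL_add[OF bal1] by simp
  fix b h assume b: "b \<in> B"
  have "sweedler (\<lambda>(x, h). E x * j h) (rL (b * j h)) = sweedler (\<lambda>(x, h). E (b * j x) * j h) (gL h)"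
    using eqmod_trans[OF rL_mult_coinv[OF b bal1] rL_j[OF bal[OF b]]] by simp
  also have "\<dots> = b * j (sweedler (\<lambda>(x, h). sL (piL x) * h) (gL h))"
    by (simp add: E_b_j[OF b] sweedler_hom[of j] j_add j_sL sweedler_mult_left mult.assoc)
  finally show "sweedler (\<lambda>(x, h). E x * j h) (rL (b * j h)) = b * j h" by (simp add: lb.counit_left)
qed simp_all

text \<open>The translation map of a Galois extension: a representative of the preimage of
  \<open>1 \<otimes> h\<close> under the canonical map, unique modulo \<open>NB\<close>.\<close>

definition transl :: "'h \<Rightarrow> ('a \<times> 'a \<Rightarrow>\<^sub>0 int)" where
  "transl h = (SOME x. can_free x \<approx>\<^bsub>NR\<^esub> frag_of (1, h))"

abbreviation mult_E :: "('a \<times> 'a \<Rightarrow>\<^sub>0 int) \<Rightarrow> 'a" where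
  "mult_E \<equiv> lext (\<lambda>(a, a'). a * E a')"

definition jc :: "'h \<Rightarrow> 'a" where
  "jc h = mult_E (transl h)"

lemma can_transl: "can_free (transl h) \<approx>\<^bsub>NR\<^esub> frag_of (1, h)"
  unfolding transl_def by (rule someI_ex) (use galois in \<open>simp add: galois_iff\<close>)

text \<open>Injectivity of the canonical map, combined with left \<open>B\<close>-linearity of
  \<open>E\<close>, which makes \<open>a * E a'\<close> balanced over \<open>B\<close>.\<close>

lemma mult_E_eqI:
  assumes "can_free x \<approx>\<^bsub>NR\<^esub> can_free y"
  shows "mult_E x = mult_E y"
proof -
  have "balanced UNIV B (*) (*) {} (\<lambda>a a'. a * E a')"
    by (rule balancedI) (simp_all add: E_add E_left distrib_left distrib_right mult.assoc)
  from lext_balanced[OF this] show ?thesis using assms galois by (simp add: galois_iff)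
qed

text \<open>The canonical map is left \<open>A\<close>-linear, so \<open>a\<close> times the
  translation of \<open>h\<close> is a preimage of \<open>a \<otimes> h\<close>; \<open>X\<close>
  extends this to all of \<open>v\<close>.\<close>

lemma mult_E_eq_jc:
  assumes "can_free x \<approx>\<^bsub>NR\<^esub> v"
  shows "mult_E x = lext (\<lambda>(a, h). a * jc h) v"
proof -
  define X where "X = lext (\<lambda>(a, h). lext (\<lambda>(p, q). frag_of (a * p, q)) (transl h)) v"
  have can: "can_free (lext (\<lambda>(p, q). frag_of (a * p, q)) y) = lext (\<lambda>(p, q). frag_of (a * p, q)) (can_free y)" for a y
    by (simp add: can_free_def lext_lext lext_sweedler case_prod_unfold mult.assoc sweedler_eq_lext)
  have "lext (\<lambda>(a, h). can_free (lext (\<lambda>(p, q). frag_of (a * p, q)) (transl h))) v \<approx>\<^bsub>NR\<^esub> lext (\<lambda>(a, h). frag_of (a, h)) v"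
  proof (rule lext2_eqmod)
    fix a h
    show "can_free (lext (\<lambda>(p, q). frag_of (a * p, q)) (transl h)) \<approx>\<^bsub>NR\<^esub> frag_of (a, h)"
      using lext_balanced[OF balAR_frag[of a 1, simplified] can_transl[of h]] by (simp add: can)
  qed
  moreover have "can_free X = lext (\<lambda>(a, h). can_free (lext (\<lambda>(p, q). frag_of (a * p, q)) (transl h))) v"
    unfolding X_def can_free_def lext_lext by (simp add: case_prod_unfold lext_lext)
  moreover have "lext (\<lambda>(a, h). frag_of (a, h)) v = v"
    by (simp add: case_prod_unfold lext_frag)
  ultimately have "can_free X \<approx>\<^bsub>NR\<^esub> v" by simp
  then have "mult_E x = mult_E X" by (rule mult_E_eqI[OF eqmod_trans[OF assms eqmod_sym]])
  also have "\<dots> = lext (\<lambda>(a, h). a * jc h) v"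
    by (simp add: X_def lext_lext jc_def lext_mult_left case_prod_unfold mult.assoc)
  finally show ?thesis .
qed

text \<open>So \<open>a * jc h\<close> is well defined on \<open>A \<otimes>\<^sub>R H\<close>,
  which contains additivity of \<open>jc\<close> and its rule for \<open>tR\<close>. Surjectivity of
  the canonical map supplies the preimage.\<close>

lemma jc_eqmod:
  assumes "v \<approx>\<^bsub>NR\<^esub> w"
  shows "lext (\<lambda>(a, h). a * jc h) v = lext (\<lambda>(a, h). a * jc h) w"
proof -
  obtain x where x: "can_free x \<approx>\<^bsub>NR\<^esub> v" using galois unfolding galois_iff by blast
  show ?thesis using mult_E_eq_jc[OF x] mult_E_eq_jc[OF eqmod_trans[OF x assms]] by simp
qed

lemma jc_add: "jc (x + y) = jc x + jc y"
  using jc_eqmod[OF NR_add(2)[of 1 x y]] by (simp add: lext_add)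

lemma jc_tR: "jc (h * tR r) = etaR r * jc h"
  using jc_eqmod[OF NR_bal[of 1 r h]] by simp

lemma jc_tL: "jc (tL l * h) = jc h * etaL l"
proof -
  \<comment> \<open>Acting by \<open>etaL' l\<close> on the second factor of the translation of
    \<open>h\<close> gives a preimage of \<open>1 \<otimes> tL l * h\<close>, since the coaction is
    right \<open>L\<close>-linear.\<close>
  define X where "X = lext (\<lambda>(p, q). frag_of (p, etaL' l * q)) (transl h)"
  have bal: "balAR NR (\<lambda>a h. frag_of (a, tL l * h))"
    by (rule balancedI) (simp_all add: NR_add NR_bal distrib_left flip: mult.assoc)
  have "can_free X = lext (\<lambda>(p, q). sweedler (\<lambda>(x, h). frag_of (p * x, h)) (rR (etaL' l * q))) (transl h)"
    by (simp add: X_def can_free_def lext_lext case_prod_unfold)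
  also have "\<dots> \<approx>\<^bsub>NR\<^esub> lext (\<lambda>(p, q). sweedler (\<lambda>(x, h). frag_of (p * x, tL l * h)) (rR q)) (transl h)"
    by (rule lext2_eqmod) (rule rR_L[OF balAR_frag[of _ 1, simplified]])
  also have "\<dots> = lext (\<lambda>(a, h). frag_of (a, tL l * h)) (can_free (transl h))"
    by (rule lext_can_free[symmetric])
  also have "\<dots> \<approx>\<^bsub>NR\<^esub> lext (\<lambda>(a, h). frag_of (a, tL l * h)) (frag_of (1, h))"
    by (rule lext_balanced[OF bal can_transl])
  finally have "can_free X \<approx>\<^bsub>NR\<^esub> frag_of (1, tL l * h)" by simp
  from mult_E_eq_jc[OF this] show ?thesis
    by (simp add: X_def lext_lext E_etaL' jc_def lext_mult_right case_prod_unfold mult.assoc)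
qed

text \<open>The canonical map sends \<open>1 \<otimes> a\<close> to \<open>rR a\<close>. So
  \<open>E\<close> has the same form as \<open>proj\<close> in the other direction.\<close>

lemma E_eq_jc: "E a = sweedler (\<lambda>(x, h). x * jc h) (rR a)"
  using mult_E_eq_jc[OF eqmod_refl, of "frag_of (1, a)"]
  by (simp add: can_free_def lext_sweedler)

lemma j_jc: "sweedler (\<lambda>(a, b). j a * jc b) (gR h) = etaL (piL h)"
proof -
  have "balAR {} (\<lambda>x h. x * jc h)"
    by (rule balancedI) (simp_all add: jc_add distrib_left distrib_right jc_tR mult.assoc)
  from rR_j[OF this, of h] E_b_j[OF B_one, of h] show ?thesis by (simp add: E_eq_jc)
qed

text \<open>Two balanced maps on \<open>A \<otimes>\<^sub>R H\<close> are compared at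
  \<open>1 \<otimes> h\<close>, written as an image under the canonical map. On the image of
  \<open>a \<otimes> a'\<close> both give \<open>a * a'\<close>, one by \<open>sum_E_j\<close> and
  the other by the counit of the coaction.\<close>

lemma jc_j: "sweedler (\<lambda>(a, b). jc a * j b) (gL h) = etaR (piR h)"
proof -
  have L: "balL {} (\<lambda>p q. jc p * j q)"
    by (rule balancedI) (simp_all add: jc_add j_add distrib_left distrib_right jc_tL j_sL mult.assoc)
  have 1: "balAR {} (\<lambda>x h. x * sweedler (\<lambda>(p, q). jc p * j q) (gL h))"
  proof (rule balancedI)
    fix m q n
    show "m * etaR q * sweedler (\<lambda>(p, q). jc p * j q) (gL n) \<approx>\<^bsub>{}\<^esub>
        m * sweedler (\<lambda>(p, q). jc p * j q) (gL (n * tR q))"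
      using gL_tR[OF L] by (simp add: jc_tR sweedler_mult_left mult.assoc)
  qed (use gL_add[OF L] in \<open>simp_all add: distrib_left distrib_right\<close>)
  have 2: "balAR {} (\<lambda>x h. x * etaR (piR h))"
    by (rule balancedI) (simp_all add: rb.counit_add etaR_add distrib_left distrib_right piR_lin etaR_mult mult.assoc)
  have 3: "sweedler (\<lambda>(u, k). a * u * sweedler (\<lambda>(p, q). jc p * j q) (gL k)) (rR a') = a * a'" for a a'
  proof -
    have "sweedler (\<lambda>(u, k). sweedler (\<lambda>(p, q). u * jc p * j q) (gL k)) (rR a') =
        sweedler (\<lambda>(m, n). sweedler (\<lambda>(u, p). u * jc p * j n) (rR m)) (rL a')"
      using eqmod_sym[OF r_mixed_RL[of "{}" "\<lambda>u p q. u * jc p * j q" a']]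
      by (simp add: balanced3_def jc_add j_add distrib_left distrib_right jc_tR jc_tL j_sL mult.assoc)
    also have "\<dots> = a'"
      by (simp add: E_eq_jc[symmetric] sum_E_j flip: sweedler_mult_right)
    finally show ?thesis
      by (simp add: mult.assoc flip: sweedler_mult_left)
  qed
  have 4: "sweedler (\<lambda>(u, k). a * u * etaR (piR k)) (rR a') = a * a'" for a a'
    by (simp add: mult.assoc rR_counit flip: sweedler_mult_left)
  have "lext (\<lambda>(x, h). x * sweedler (\<lambda>(p, q). jc p * j q) (gL h)) (can_free (transl h)) =
      lext (\<lambda>(x, h). x * etaR (piR h)) (can_free (transl h))"
    by (simp add: lext_can_free 3 4)
  with lext_balanced[OF 1 can_transl[of h]] lext_balanced[OF 2 can_transl[of h]] show ?thesis by simp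
qed

text \<open>Scalars act on \<open>H\<close> as right factors
  \<open>tR (scale\<^sub>R \<H> c 1)\<close>, so this is a case of \<open>jc_tR\<close>.\<close>

lemma jc_scale: "jc (scale\<^sub>H \<H> c h) = scale\<^sub>A \<A> c (jc h)"
proof -
  have "tR (scale\<^sub>R \<H> c 1) = scale\<^sub>H \<H> c 1"
    using rb.target by (simp add: algebra_antimap_def k_linear_def)
  then have "scale\<^sub>H \<H> c h = h * tR (scale\<^sub>R \<H> c 1)"
    using lb.H.scale_mult_right[of c h 1] by simp
  then show ?thesis using A.scale_mult_left[of c 1 "jc h"] by (simp add: jc_tR etaR_scale)
qed

lemma jc_convolution_inverse: "convolution_inverse \<H> \<A> etaL j jc"
  by (simp add: convolution_inverse_def k_linear_def jc_add jc_scale jc_tR jc_tL j_jc jc_j mult.assoc)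

lemma cleft: "cleft_extension \<H> \<A> B"
  unfolding cleft_extension_def cleaving_map_def
  using L_ring j_sL j_comodule_map jc_convolution_inverse by blast

end

theorem theorem3p12:
  fixes \<H> :: "('k::{comm_ring,comm_monoid_mult}, 'h::{ring,monoid_mult}, 'l::{ring,monoid_mult},
      'r::{ring,monoid_mult}) hopf_algebroid_data"
    and \<A> :: "('k, 'a::{ring,monoid_mult}, 'h, 'r) comodule_algebra_data"
    and B :: "'a set"
  assumes "hopf_algebroid \<H>"
    and "right_H_extension \<H> \<A> B"
  shows "cleft_extension \<H> \<A> B \<longleftrightarrow>
    galois\<^sub>R \<H> \<A> B \<and> (\<exists>\<eta>\<^sub>L. L_ring_unit \<H> \<A> B \<eta>\<^sub>L \<and> (\<exists>\<phi>. BH_iso \<H> \<A> B \<eta>\<^sub>L \<phi>))"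
proof -
  have B: "B = coinvariants \<H> \<A>" and "right_H_comodule_algebra \<H> \<A>"
    using assms(2) by (simp_all add: right_H_extension_def)
  then have ext: "hopf_extension \<H> \<A>" using assms(1) by (simp add: hopf_extension_def)
  show ?thesis
  proof
    assume "cleft_extension \<H> \<A> B"
    then obtain \<eta>\<^sub>L j j\<^sub>c where "L_ring_unit \<H> \<A> B \<eta>\<^sub>L" "\<forall>l h. j (s\<^sub>L \<H> l * h) = \<eta>\<^sub>L l * j h"
      "comodule_map \<H> (regular_comodule \<H>) (alg_comodule \<H> \<A>) j" "convolution_inverse \<H> \<A> \<eta>\<^sub>L j j\<^sub>c"
      by (auto simp: cleft_extension_def cleaving_map_def)
    then interpret cleft_datum \<H> \<A> \<eta>\<^sub>L j j\<^sub>c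
      using ext B by (auto simp: cleft_datum_def cleft_datum_axioms_def colinear_datum_def colinear_datum_axioms_def
          L_ring_extension_def L_ring_extension_axioms_def)
    show "galois\<^sub>R \<H> \<A> B \<and> (\<exists>\<eta>\<^sub>L. L_ring_unit \<H> \<A> B \<eta>\<^sub>L \<and> (\<exists>\<phi>. BH_iso \<H> \<A> B \<eta>\<^sub>L \<phi>))"
      using galois L_ring \<Phi>_iso unfolding B by blast
  next
    assume "galois\<^sub>R \<H> \<A> B \<and> (\<exists>\<eta>\<^sub>L. L_ring_unit \<H> \<A> B \<eta>\<^sub>L \<and> (\<exists>\<phi>. BH_iso \<H> \<A> B \<eta>\<^sub>L \<phi>))"
    then obtain \<eta>\<^sub>L \<phi> where "galois\<^sub>R \<H> \<A> B" "L_ring_unit \<H> \<A> B \<eta>\<^sub>L" "BH_iso \<H> \<A> B \<eta>\<^sub>L \<phi>"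
      by blast
    then interpret galois_BH_datum \<H> \<A> \<eta>\<^sub>L \<phi>
      using ext B by (auto simp: galois_BH_datum_def galois_BH_datum_axioms_def L_ring_extension_def L_ring_extension_axioms_def)
    show "cleft_extension \<H> \<A> B" using cleft by (simp add: B)
  qed
qed

end
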